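(* Suppose $\Omega\subset\mathbb{R}^2$ is a simply-connected domain, and $(w,\nu)$ is a unit-calibrated mixed IMCF cluster in $\Omega$. Then there is an $\infty$-harmonic function $u\in C^1(\Omega)$ such that $\nabla u=e^{-w}\nu^\perp$ in $\Omega$.
   Context: A domain is a connected open set. $\nu^\perp$ is the counterclockwise rotation of $\nu$ by $90^\circ$. $\nu_D$ denotes the outer unit normal of a $C^1$ region $D$. A line segment means a segment, point, ray or line. $\infty$-harmonic: $u\in C^0(\Omega)$ is $\infty$-harmonic if for every $z\in\Omega$ and every $C^2$ function $\varphi$ near $z$ with $\varphi(z)=u(z)$, one has $\nabla^2\varphi(\nabla\varphi,\nabla\varphi)(z)\ge 0$ whenever $\varphi\ge u$ near $z$, and $\le 0$ whenever $\varphi\le u$ near $z$. Simple IMCF cluster in an open set $U\subset\mathbb{R}^2$: data $(w,\nu,\{D_i\},\{\chi_i\})$, with $w$ a function and $\nu$ a vector field on $U$, such that (i) $\{D_i\}$ are disjoint $C^1$ domains in $U$, and $U\setminus\bigcup D_i$ is the disjoint union of countably many $C^1$ curves $\gamma_j$ without endpoints in $U$ (called ridges); (ii) $\chi_i\in\{\pm1\}$ for each $i$; (iii) $w,\nu$ are continuous with $|\nu|\le1$ in $U$; (iv) $w|_{D_i}\in\mathrm{Lip}_{\mathrm{loc}}(D_i)$, with $\chi_i\nu\cdot\nabla w=|\nabla w|$ a.e. in $D_i$, $\mathrm{div}(\chi_i\nu)=|\nabla w|$ weakly in $D_i$, and $\chi_i\nu=\nu_{D_i}$ on $\partial D_i\cap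 U$. Mixed IMCF cluster in a domain $\Omega$: a pair $(w,\nu)$ for which there are points $\{z_i\}$ and disjoint relatively closed line segments $\sigma_j$ in $\Omega$ such that (i) $w:\Omega\to\mathbb{R}\cup\{+\infty\}$ is continuous, and $e^{-w}\nu$ is a continuous vector field in $\Omega$ ($\nu$ is a vector field on $\{w<\infty\}$, and $e^{-w}\nu$ is understood to be $0$ where $w=+\infty$); (ii) $\{w=+\infty\}\subset\{z_i\}$, and on each $\sigma_j$ both $w$ and $\nu$ are constant, with $\nu\equiv\pm(\sigma_j')^\perp$, where $\sigma_j'$ is a unit tangent vector of $\sigma_j$; (iii) each compact subset of $\Omega$ meets finitely many $z_i$ and $\sigma_j$; (iv) with $A=\{z_i\}\cup(\bigcup\sigma_j)$, $(w,\nu)$ is a simple IMCF cluster in $\Omega\setminus A$, i.e. there exist $\{D_i\},\{\chi_i\}$ such that $(w,\nu,\{D_i\},\{\chi_i\})$ is a simple IMCF cluster in $\Omega\setminus A$. It is unit-calibrated if $|\nu|=1$ everywhere in $\{w<\infty\}$. *)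

theory Defs
  imports "HOL-Analysis.Analysis"
begin

section \<open>Planar calculus\<close>

definition perp :: "real^2 \<Rightarrow> real^2" where
  "perp v = vector [- v $ 2, v $ 1]"

text \<open>Meaningful only at points of differentiability; every use below is guarded accordingly.\<close>

definition grad :: "(real^2 \<Rightarrow> real) \<Rightarrow> real^2 \<Rightarrow> real^2" where
  "grad f x = (THE g. GDERIV f x :> g)"

definition hess :: "(real^2 \<Rightarrow> real) \<Rightarrow> real^2 \<Rightarrow> real^2^2" where
  "hess f x = matrix (frechet_derivative (grad f) (at x))"

text \<open>The next two notions are meant for open \<open>V\<close>.\<close>

definition C1_on :: "(real^2) set \<Rightarrow> (real^2 \<Rightarrow> real) \<Rightarrow> bool" where
  "C1_on V f \<longleftrightarrow> (\<forall>x\<in>V. f differentiable (at x)) \<and> continuous_on V (grad f)"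

definition C2_on :: "(real^2) set \<Rightarrow> (real^2 \<Rightarrow> real) \<Rightarrow> bool" where
  "C2_on V f \<longleftrightarrow> C1_on V f \<and> (\<forall>x\<in>V. grad f differentiable (at x)) \<and> continuous_on V (hess f)"

definition infinity_harmonic :: "(real^2) set \<Rightarrow> (real^2 \<Rightarrow> real) \<Rightarrow> bool" where
  "infinity_harmonic \<Omega> u \<longleftrightarrow> continuous_on \<Omega> u \<and>
     (\<forall>z\<in>\<Omega>. \<forall>V \<phi>. open V \<and> z \<in> V \<and> C2_on V \<phi> \<and> \<phi> z = u z \<longrightarrow>
        ((\<forall>\<^sub>F x in nhds z. \<phi> x \<ge> u x) \<longrightarrow> grad \<phi> z \<bullet> (hess \<phi> z *v grad \<phi> z) \<ge> 0) \<and>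
        ((\<forall>\<^sub>F x in nhds z. \<phi> x \<le> u x) \<longrightarrow> grad \<phi> z \<bullet> (hess \<phi> z *v grad \<phi> z) \<le> 0))"


section \<open>Regions, ridges and line segments\<close>

text \<open>Near \<open>p\<close> the set \<open>D\<close> lies on one side of a \<open>C\<^sup>1\<close> curve, given as the zero set of a
  defining function with nonvanishing gradient, and \<open>n\<close> is the outer unit normal of \<open>D\<close> at \<open>p\<close>.
  Such an \<open>n\<close> is uniquely determined by \<open>D\<close> and \<open>p\<close>.\<close>

definition outer_unit_normal :: "(real^2) set \<Rightarrow> real^2 \<Rightarrow> real^2 \<Rightarrow> bool" where
  "outer_unit_normal D p n \<longleftrightarrow>
     (\<exists>V f. open V \<and> p \<in> V \<and> C1_on V f \<and> (\<forall>x\<in>V. grad f x \<noteq> 0) \<and>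
        D \<inter> V = {x \<in> V. f x < 0} \<and> f p = 0 \<and> n = grad f p /\<^sub>R norm (grad f p))"

definition C1_domain_in :: "(real^2) set \<Rightarrow> (real^2) set \<Rightarrow> bool" where
  "C1_domain_in U D \<longleftrightarrow> D \<subseteq> U \<and> open D \<and> connected D \<and>
     (\<forall>p \<in> frontier D \<inter> U. \<exists>n. outer_unit_normal D p n)"

text \<open>Simple regular \<open>C\<^sup>1\<close> curves in \<open>U\<close>: either closed, or parametrized by an open interval
  (without loss of generality the whole real line) such that neither end converges to a point
  of \<open>U\<close>.\<close>

definition C1_curve_without_endpoints :: "(real^2) set \<Rightarrow> (real^2) set \<Rightarrow> bool" where
  "C1_curve_without_endpoints U \<gamma> \<longleftrightarrow>
     (\<exists>c c'. (\<forall>t::real. (c has_vector_derivative c' t) (at t)) \<and> continuous_on UNIV c' \<and>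
        (\<forall>t. c' t \<noteq> 0) \<and> \<gamma> = range c \<and> \<gamma> \<subseteq> U \<and>
        ((\<exists>T>0. (\<forall>t. c (t + T) = c t) \<and> inj_on c {0..<T}) \<or>
         (inj c \<and> \<not> (\<exists>z\<in>U. (c \<longlongrightarrow> z) at_top) \<and> \<not> (\<exists>z\<in>U. (c \<longlongrightarrow> z) at_bot))))"

text \<open>Segments (with or without their endpoints), points, rays and lines are exactly the nonempty
  convex subsets of a line.\<close>

definition line_segment :: "(real^2) set \<Rightarrow> bool" where
  "line_segment \<sigma> \<longleftrightarrow> \<sigma> \<noteq> {} \<and> convex \<sigma> \<and> collinear \<sigma>"

text \<open>If \<open>\<sigma>\<close> is a single point, every unit vector counts as tangent.\<close>

definition unit_tangent :: "(real^2) set \<Rightarrow> real^2 \<Rightarrow> bool" where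
  "unit_tangent \<sigma> e \<longleftrightarrow> norm e = 1 \<and> (\<forall>x\<in>\<sigma>. \<forall>y\<in>\<sigma>. \<exists>t. y - x = t *\<^sub>R e)"


section \<open>IMCF clusters\<close>

definition locally_Lipschitz_on :: "(real^2) set \<Rightarrow> (real^2 \<Rightarrow> real) \<Rightarrow> bool" where
  "locally_Lipschitz_on D w \<longleftrightarrow> (\<forall>x\<in>D. \<exists>r>0. \<exists>L. L-lipschitz_on (ball x r \<inter> D) w)"

text \<open>\<open>div X = f\<close> weakly in \<open>D\<close>, tested against compactly supported \<open>C\<^sup>1\<close> functions. In the
  definition of clusters \<open>X\<close> is continuous and \<open>f\<close> is measurable and locally bounded up to a null
  set, so that both integrands are integrable.\<close>

definition weak_divergence_eq ::
    "(real^2) set \<Rightarrow> (real^2 \<Rightarrow> real^2) \<Rightarrow> (real^2 \<Rightarrow> real) \<Rightarrow> bool" where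
  "weak_divergence_eq D X f \<longleftrightarrow>
     (\<forall>\<phi>. C1_on UNIV \<phi> \<and> compact (closure {x. \<phi> x \<noteq> 0}) \<and> closure {x. \<phi> x \<noteq> 0} \<subseteq> D \<longrightarrow>
        (LINT x:D|lebesgue. X x \<bullet> grad \<phi> x) = - (LINT x:D|lebesgue. f x * \<phi> x))"

text \<open>The regions \<open>D\<^sub>i\<close> and the ridges \<open>\<gamma>\<^sub>j\<close> are disjoint families, hence represented as the sets
  \<open>\<D>\<close> and \<open>\<G>\<close> of their members, and \<open>chi\<close> is a function on \<open>\<D>\<close>. Differentiability a.e. is
  automatic by Rademacher's theorem; it is spelled out because \<^term>\<open>grad\<close> is a total function.\<close>

definition simple_IMCF_cluster ::
    "(real^2) set \<Rightarrow> (real^2 \<Rightarrow> real) \<Rightarrow> (real^2 \<Rightarrow> real^2) \<Rightarrow> (real^2) set set \<Rightarrow>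
     ((real^2) set \<Rightarrow> real) \<Rightarrow> bool" where
  "simple_IMCF_cluster U w \<nu> \<D> chi \<longleftrightarrow>
     open U \<and>
     disjoint \<D> \<and> (\<forall>D\<in>\<D>. C1_domain_in U D) \<and>
     (\<exists>\<G>. countable \<G> \<and> disjoint \<G> \<and> (\<forall>\<gamma>\<in>\<G>. C1_curve_without_endpoints U \<gamma>) \<and>
        U - \<Union>\<D> = \<Union>\<G>) \<and>
     (\<forall>D\<in>\<D>. chi D \<in> {1, -1}) \<and>
     continuous_on U w \<and> continuous_on U \<nu> \<and> (\<forall>x\<in>U. norm (\<nu> x) \<le> 1) \<and>
     (\<forall>D\<in>\<D>.
        locally_Lipschitz_on D w \<and>
        (AE x in lebesgue. x \<in> D \<longrightarrow>
           w differentiable (at x) \<and> (chi D *\<^sub>R \<nu> x) \<bullet> grad w x = norm (grad w x)) \<and>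
        weak_divergence_eq D (\<lambda>x. chi D *\<^sub>R \<nu> x) (\<lambda>x. norm (grad w x)) \<and>
        (\<forall>p \<in> frontier D \<inter> U. outer_unit_normal D p (chi D *\<^sub>R \<nu> p)))"

definition exp_minus :: "ereal \<Rightarrow> real" where
  "exp_minus a = (if a = \<infinity> then 0 else exp (- real_of_ereal a))"

text \<open>The values of \<open>\<nu>\<close> on \<open>{w = \<infinity>}\<close> are irrelevant. Since \<open>\<nu>\<close> is a vector field on \<open>{w < \<infinity>}\<close>
  only, the constant value of \<open>w\<close> on a segment is finite.\<close>

definition mixed_IMCF_cluster ::
    "(real^2) set \<Rightarrow> (real^2 \<Rightarrow> ereal) \<Rightarrow> (real^2 \<Rightarrow> real^2) \<Rightarrow> bool" where
  "mixed_IMCF_cluster \<Omega> w \<nu> \<longleftrightarrow>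
     (\<exists>Z \<S>.
        Z \<subseteq> \<Omega> \<and> disjoint \<S> \<and>
        (\<forall>\<sigma>\<in>\<S>. line_segment \<sigma> \<and> closedin (top_of_set \<Omega>) \<sigma>) \<and>
        (\<forall>x\<in>\<Omega>. w x \<noteq> -\<infinity>) \<and> continuous_on \<Omega> w \<and>
        continuous_on \<Omega> (\<lambda>x. exp_minus (w x) *\<^sub>R \<nu> x) \<and>
        {x\<in>\<Omega>. w x = \<infinity>} \<subseteq> Z \<and>
        (\<forall>\<sigma>\<in>\<S>. \<exists>(a::real) n e. (\<forall>x\<in>\<sigma>. w x = ereal a \<and> \<nu> x = n) \<and>
           unit_tangent \<sigma> e \<and> n \<in> {perp e, - perp e}) \<and>
        (\<forall>K. compact K \<and> K \<subseteq> \<Omega> \<longrightarrow> finite (Z \<inter> K) \<and> finite {\<sigma>\<in>\<S>. \<sigma> \<inter> K \<noteq> {}}) \<and>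
        (\<exists>\<D> chi. simple_IMCF_cluster (\<Omega> - (Z \<union> \<Union>\<S>)) (\<lambda>x. real_of_ereal (w x)) \<nu> \<D> chi))"

definition unit_calibrated :: "(real^2) set \<Rightarrow> (real^2 \<Rightarrow> ereal) \<Rightarrow> (real^2 \<Rightarrow> real^2) \<Rightarrow> bool" where
  "unit_calibrated \<Omega> w \<nu> \<longleftrightarrow> (\<forall>x\<in>\<Omega>. w x < \<infinity> \<longrightarrow> norm (\<nu> x) = 1)"

end

theory Submission
  imports Defs "HOL-Complex_Analysis.Complex_Analysis"
begin

text \<open>
Put \<open>V = e\<^sup>-\<^sup>w \<nu>\<^sup>\<bottom>\<close>, where \<open>\<nu>\<^sup>\<bottom>\<close> is the rotated field \<^term>\<open>\<lambda>x. perp (\<nu> x)\<close>. The field \<open>V\<close> is continuous, and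
\<open>|V| = e\<^sup>-\<^sup>w\<close> because \<open>|\<nu>| = 1\<close>. Two things are to be shown: that \<open>V\<close> is the gradient of a function
\<open>u\<close>, and that \<open>u\<close> is infinity-harmonic.

\<^emph>\<open>The potential.\<close> In a region \<open>D\<close> with sign \<open>\<chi>\<close> let \<open>X = \<chi> \<nu>\<close>. Since \<open>X \<bullet> \<nabla>w = |\<nabla>w| = div X\<close>, the product
rule gives \<open>div (e\<^sup>-\<^sup>w X) = 0\<close>, so \<open>V\<close> is curl free in the sense of distributions; mollifying turns
this into a local primitive of \<open>V\<close> (\<open>has_local_primitive_in_region\<close>). The ridges, the segments and
the exceptional points are covered, near each point, by countably many Lipschitz arcs. One
arc is removable: of the \<open>n\<^sup>2\<close> cells of a grid on a rectangle only \<open>O(n)\<close> meet the arc, and each of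
these contributes \<open>o(1/n)\<close> to the circulation of the continuous field \<open>V\<close>
(\<open>circulation_across_arc\<close>). The Baire category theorem reduces countably many arcs to one
(\<open>has_local_primitive_off_arcs\<close>). Hence \<open>V\<close> has primitives locally everywhere, and the Riemann
mapping theorem reduces the existence of a global primitive to a disc or the plane
(\<open>simply_connected_primitive\<close>).

\<^emph>\<open>Infinity-harmonicity.\<close> Where \<open>V = 0\<close> a touching function is critical and there is nothing to
show. Where \<open>V(z) \<noteq> 0\<close> it suffices that \<open>u\<close> and \<open>-u\<close> grow on small spheres at least at the speed
\<open>|V(z)|\<close>: the sphere of radius \<open>r\<close> about \<open>z\<close> contains a point where \<open>u \<ge> u(z) + |V(z)| r\<close>. A second-order
expansion of the touching function at such points, as \<open>r\<close> tends to 0, gives the inequality for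
the infinity Laplacian (\<open>touching_from_above\<close>).

The growth is proved by climbing. If every point \<open>x \<noteq> z\<close> near \<open>z\<close> admits arbitrarily short steps
along which \<open>|V|\<close> does not decrease and \<open>u\<close> increases at a rate close to \<open>|V(x)|\<close>, then a maximum
of \<open>u\<close> over the points reachable from a start near \<open>z\<close> must lie on the sphere
(\<open>growth_on_spheres\<close>). No step is required at \<open>z\<close> itself, so isolated exceptional points, that is,
the points \<open>z\<^sub>i\<close> and the endpoints of the segments, do no harm.

The steps come from the equation \<open>\<nabla>w = |\<nabla>w| X\<close>, which makes \<open>w\<close> nonincreasing in every direction
\<open>v\<close> with \<open>X \<bullet> v < 0\<close>. The direction \<open>v = \<plusminus>\<nu>\<^sup>\<bottom> - \<delta> X\<close> has this property, differs from the direction of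
\<open>\<plusminus>V\<close> only by \<open>\<delta>\<close>, and at a boundary point of \<open>D\<close> it points into \<open>D\<close>, because \<open>X\<close> is the outer
normal (\<open>descent_direction\<close>). Thus ridge points need no separate treatment, once it is known that
every point off the segments and exceptional points lies in the closure of some region
(\<open>in_closure_of_region\<close>). On a segment \<open>w\<close> is constant and \<open>V\<close> is tangent, so one steps along it.
\<close>

section \<open>Gradients and the rotation by a right angle\<close>

lemma grad_eqI: "GDERIV f x :> g \<Longrightarrow> grad f x = g"
  unfolding grad_def
proof (rule the_equality)
  fix h assume "GDERIV f x :> g" "GDERIV f x :> h"
  then have "(\<lambda>v. v \<bullet> h) = (\<lambda>v. v \<bullet> g)"
    unfolding gderiv_def using has_derivative_unique by blast
  then show "h = g" by (metis inner_commute vector_eq_rdot)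
qed

text \<open>A linear functional on the plane is the inner product with the vector of its values on the basis,
so differentiability provides the vector that the definite description in \<^const>\<open>grad\<close> asks for.\<close>

lemma differentiable_imp_GDERIV_grad:
  assumes "f differentiable (at x)"
  shows "GDERIV f x :> grad f x"
proof -
  obtain f' where f': "(f has_derivative f') (at x)"
    using assms by (auto simp: differentiable_def)
  then interpret bounded_linear f' by (rule has_derivative_bounded_linear)
  have "f' = (\<lambda>v. v \<bullet> (\<Sum>b\<in>Basis. f' b *\<^sub>R b))"
  proof
    fix v
    have "f' v = f' (\<Sum>b\<in>Basis. (v \<bullet> b) *\<^sub>R b)" by (simp add: euclidean_representation)
    also have "\<dots> = (\<Sum>b\<in>Basis. (v \<bullet> b) * f' b)" by (simp add: sum scaleR)
    also have "\<dots> = v \<bullet> (\<Sum>b\<in>Basis. f' b *\<^sub>R b)"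
      by (simp add: inner_sum_right mult.commute)
    finally show "f' v = \<dots>" .
  qed
  then have "GDERIV f x :> (\<Sum>b\<in>Basis. f' b *\<^sub>R b)"
    unfolding gderiv_def using f' by simp
  then show ?thesis using grad_eqI by metis
qed

lemma GDERIV_imp_differentiable: "GDERIV f x :> g \<Longrightarrow> f differentiable (at x)"
  unfolding gderiv_def differentiable_def by blast

lemma GDERIV_directional:
  assumes "GDERIV f x :> g"
  shows "((\<lambda>t. f (x + t *\<^sub>R v)) has_real_derivative v \<bullet> g) (at 0)"
proof -
  have 1: "((\<lambda>t. x + t *\<^sub>R v) has_derivative (\<lambda>t. t *\<^sub>R v)) (at 0)"
    by (auto intro!: derivative_eq_intros)
  have 2: "(f has_derivative (\<lambda>v. v \<bullet> g)) (at (x + 0 *\<^sub>R v))"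
    using assms unfolding gderiv_def by simp
  show ?thesis
    using has_derivative_compose[OF 1 2] unfolding has_field_derivative_def
    by (simp add: mult.commute[of _ "_ \<bullet> _"] cong: )
qed

text \<open>First-order expansion along a ray, in the form in which short steps are estimated below.\<close>

lemma GDERIV_increment:
  assumes "GDERIV f x :> g" "e > 0"
  shows "\<exists>h0>0. \<forall>h. 0 < h \<and> h < h0 \<longrightarrow> \<bar>f (x + h *\<^sub>R v) - f x - h * (v \<bullet> g)\<bar> \<le> e * h"
proof -
  from GDERIV_directional[OF assms(1), of v]
  have "((\<lambda>h. (f (x + h *\<^sub>R v) - f x) / h) \<longlongrightarrow> v \<bullet> g) (at 0)"
    by (simp add: DERIV_def)
  then obtain d where d: "d > 0" "\<And>h. h \<noteq> 0 \<Longrightarrow> \<bar>h\<bar> < d \<Longrightarrow>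
      \<bar>(f (x + h *\<^sub>R v) - f x) / h - v \<bullet> g\<bar> < e"
    using assms(2) unfolding LIM_eq by (force simp: )
  show ?thesis
  proof (intro exI[of _ d] conjI d(1) allI impI)
    fix h assume h: "0 < h \<and> h < d"
    then have "\<bar>(f (x + h *\<^sub>R v) - f x) / h - v \<bullet> g\<bar> * h \<le> e * h"
      using d(2)[of h] by (intro mult_right_mono) auto
    moreover have "\<bar>(f (x + h *\<^sub>R v) - f x) / h - v \<bullet> g\<bar> * h = \<bar>((f (x + h *\<^sub>R v) - f x) / h - v \<bullet> g) * h\<bar>"
      using h by (simp add: abs_mult)
    moreover have "((f (x + h *\<^sub>R v) - f x) / h - v \<bullet> g) * h = f (x + h *\<^sub>R v) - f x - h * (v \<bullet> g)"
      using h by (simp add: field_simps)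
    ultimately show "\<bar>f (x + h *\<^sub>R v) - f x - h * (v \<bullet> g)\<bar> \<le> e * h" by simp
  qed
qed


lemma perp_components [simp]: "perp v $ 1 = - v $ 2" "perp v $ 2 = v $ 1"
  by (simp_all add: perp_def)

lemma perp_scaleR: "perp (c *\<^sub>R v) = c *\<^sub>R perp v"
  by (simp add: vec_eq_iff forall_2)

lemma perp_minus: "perp (- v) = - perp v"
  by (simp add: vec_eq_iff forall_2)

lemma perp_perp: "perp (perp v) = - v"
  by (simp add: vec_eq_iff forall_2)

lemma inner_perp: "v \<bullet> perp v = 0" "perp v \<bullet> v = 0" "perp v \<bullet> perp v = v \<bullet> v"
  by (simp_all add: inner_vec_def sum_2 algebra_simps)

lemma norm_perp: "norm (perp v) = norm v"
  by (simp add: norm_eq_sqrt_inner inner_perp)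

lemma continuous_on_perp: "continuous_on A f \<Longrightarrow> continuous_on A (\<lambda>x. perp (f x))"
proof -
  assume f: "continuous_on A f"
  have "linear perp" by (intro linearI) (simp_all add: vec_eq_iff forall_2)
  then have "continuous_on UNIV perp" by (intro linear_continuous_on) (simp add: linear_conv_bounded_linear)
  then show "continuous_on A (\<lambda>x. perp (f x))" by (rule continuous_on_compose2) (use f in auto)
qed

section \<open>Circulation of fields with local primitives\<close>

definition line_int :: "('a::euclidean_space \<Rightarrow> 'a) \<Rightarrow> 'a \<Rightarrow> 'a \<Rightarrow> real" where
  "line_int V a b = integral {0..1} (\<lambda>t. V (a + t *\<^sub>R (b - a)) \<bullet> (b - a))"

text \<open>Local exactness of the 1-form associated with the field. For a field that is merely continuous it
takes the place of a vanishing curl.\<close>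

definition has_local_primitive :: "('a::euclidean_space \<Rightarrow> 'a) \<Rightarrow> 'a \<Rightarrow> bool" where
  "has_local_primitive V x \<longleftrightarrow> (\<exists>r>0. \<exists>u. \<forall>y\<in>ball x r. GDERIV u y :> V y)"

text \<open>The line integral around the boundary of a parallelogram. The edges are signed, so degenerate and
negatively oriented parallelograms are allowed; comparing a point with its neighbours on all four
sides then needs no distinction of cases.\<close>

definition circulation :: "('a::euclidean_space \<Rightarrow> 'a) \<Rightarrow> 'a \<Rightarrow> 'a \<Rightarrow> 'a \<Rightarrow> real" where
  "circulation V p a b = line_int V p (p + a) + line_int V (p + a) (p + a + b)
     - line_int V (p + b) (p + a + b) - line_int V p (p + b)"

definition parallelogram :: "'a::euclidean_space \<Rightarrow> 'a \<Rightarrow> 'a \<Rightarrow> 'a set" where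
  "parallelogram p a b = (\<lambda>(s, t). p + s *\<^sub>R a + t *\<^sub>R b) ` ({0..1} \<times> {0..1})"

text \<open>Self-intersections and constant parametrizations are allowed, so that pieces of curves, bounded
segments and points fall under one notion.\<close>

definition Lipschitz_arc :: "'a::metric_space set \<Rightarrow> bool" where
  "Lipschitz_arc \<Gamma> \<longleftrightarrow> (\<exists>c L. L-lipschitz_on {0..1::real} c \<and> \<Gamma> = c ` {0..1})"

lemma has_local_primitive_nearby:
  assumes "has_local_primitive V x"
  shows "\<exists>r>0. \<forall>y\<in>ball x r. has_local_primitive V y"
proof -
  obtain r u where r: "r > 0" "\<And>y. y \<in> ball x r \<Longrightarrow> GDERIV u y :> V y"
    using assms unfolding has_local_primitive_def by blast
  have "has_local_primitive V y" if y: "y \<in> ball x r" for y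
  proof -
    obtain s where "s > 0" "ball y s \<subseteq> ball x r" using openE[OF open_ball y] by blast
    then have "\<forall>w\<in>ball y s. GDERIV u w :> V w" using r(2) by blast
    then show ?thesis unfolding has_local_primitive_def using \<open>s > 0\<close> by (intro exI[of _ s] conjI exI[of _ u])
  qed
  then show ?thesis using r(1) by blast
qed

lemma has_local_primitive_cong:
  assumes "open S" "x \<in> S" "\<And>y. y \<in> S \<Longrightarrow> V y = W y" "has_local_primitive V x"
  shows "has_local_primitive W x"
proof -
  obtain r u where r: "r > 0" "\<And>y. y \<in> ball x r \<Longrightarrow> GDERIV u y :> V y"
    using assms(4) unfolding has_local_primitive_def by blast
  obtain s where s: "s > 0" "ball x s \<subseteq> S" using openE[OF assms(1,2)] by blast
  have "GDERIV u y :> W y" if "y \<in> ball x (min r s)" for y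
    using r(2)[of y] assms(3)[of y] that s(2) by auto
  then have "\<forall>y\<in>ball x (min r s). GDERIV u y :> W y" by blast
  moreover have "0 < min r s" using r(1) s(1) by simp
  ultimately show ?thesis unfolding has_local_primitive_def by (intro exI[of _ "min r s"] conjI exI[of _ u])
qed

lemma point_in_closed_segment: "t \<in> {0..1} \<Longrightarrow> a + t *\<^sub>R (b - a) \<in> closed_segment a b"
  unfolding in_segment by (rule exI[of _ t]) (simp add: algebra_simps)

lemma line_int_gradient:
  assumes "\<And>x. x \<in> closed_segment a b \<Longrightarrow> GDERIV u x :> V x"
  shows "line_int V a b = u b - u a"
proof -
  have "((\<lambda>t. V (a + t *\<^sub>R (b - a)) \<bullet> (b - a)) has_integral (u (a + 1 *\<^sub>R (b - a)) - u (a + 0 *\<^sub>R (b - a)))) {0..1}"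
  proof (rule fundamental_theorem_of_calculus)
    fix t :: real assume t: "t \<in> {0..1}"
    have "a + t *\<^sub>R (b - a) \<in> closed_segment a b"
      using t by (rule point_in_closed_segment)
    then have "(u has_derivative (\<lambda>h. h \<bullet> V (a + t *\<^sub>R (b - a)))) (at (a + t *\<^sub>R (b - a)))"
      using assms unfolding gderiv_def by blast
    moreover have "((\<lambda>t. a + t *\<^sub>R (b - a)) has_derivative (\<lambda>h. h *\<^sub>R (b - a))) (at t within {0..1})"
      by (auto intro!: derivative_eq_intros)
    ultimately have "((\<lambda>t. u (a + t *\<^sub>R (b - a))) has_derivative
        (\<lambda>h. (h *\<^sub>R (b - a)) \<bullet> V (a + t *\<^sub>R (b - a)))) (at t within {0..1})"
      using has_derivative_compose by blast
    then show "((\<lambda>t. u (a + t *\<^sub>R (b - a))) has_vector_derivative V (a + t *\<^sub>R (b - a)) \<bullet> (b - a)) (at t within {0..1})"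
      unfolding has_vector_derivative_def by (simp add: inner_commute)
  qed simp
  from integral_unique[OF this] show ?thesis unfolding line_int_def by simp
qed

text \<open>On a fixed segment all line integrals are differences of one function, an antiderivative of the
tangential component. This yields additivity for points in any order.\<close>

lemma line_int_along:
  assumes "continuous_on (closed_segment a (a + d)) V"
  obtains G where "\<And>s s'. s \<in> {0..1} \<Longrightarrow> s' \<in> {0..1} \<Longrightarrow>
    line_int V (a + s *\<^sub>R d) (a + s' *\<^sub>R d) = G s' - G s"
proof
  define g where "g t = V (a + t *\<^sub>R d) \<bullet> d" for t
  define G where "G x = integral {0..x} g" for x
  have seg: "a + t *\<^sub>R d \<in> closed_segment a (a + d)" if "t \<in> {0..1}" for t
    using point_in_closed_segment[OF that, of a "a + d"] by simp
  have "continuous_on {0..1} g" unfolding g_def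
    by (intro continuous_intros continuous_on_compose2[OF assms]) (use seg in auto)
  then have G': "(G has_vector_derivative g t) (at t within {0..1})" if "t \<in> {0..1}" for t
    unfolding G_def using that by (rule integral_has_vector_derivative)
  fix s s' :: real assume s: "s \<in> {0..1}" "s' \<in> {0..1}"
  have between: "s + t * (s' - s) \<in> {0..1}" if "t \<in> {0..1}" for t
  proof -
    have "s + t * (s' - s) = (1 - t) *\<^sub>R s + t *\<^sub>R s'" by (simp add: algebra_simps)
    moreover have "\<dots> \<in> {0..1}" using s that by (intro convexD) auto
    ultimately show ?thesis by simp
  qed
  have "((\<lambda>t. V ((a + s *\<^sub>R d) + t *\<^sub>R ((a + s' *\<^sub>R d) - (a + s *\<^sub>R d))) \<bullet> ((a + s' *\<^sub>R d) - (a + s *\<^sub>R d)))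
      has_integral (G (s + 1 * (s' - s)) - G (s + 0 * (s' - s)))) {0..1}"
  proof (rule fundamental_theorem_of_calculus)
    fix t :: real assume t: "t \<in> {0..1}"
    have 1: "((\<lambda>t. s + t * (s' - s)) has_vector_derivative (s' - s)) (at t within {0..1})"
      by (auto intro!: derivative_eq_intros simp: has_real_derivative_iff_has_vector_derivative[symmetric])
    have 2: "(G has_vector_derivative g (s + t * (s' - s))) (at (s + t * (s' - s)) within (\<lambda>t. s + t * (s' - s)) ` {0..1})"
      by (rule has_vector_derivative_within_subset[OF G'[OF between[OF t]]]) (intro image_subsetI between)
    have "((G \<circ> (\<lambda>t. s + t * (s' - s))) has_vector_derivative (s' - s) *\<^sub>R g (s + t * (s' - s))) (at t within {0..1})"
      by (rule vector_diff_chain_within[OF 1 2])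
    moreover have "(s' - s) *\<^sub>R g (s + t * (s' - s)) = V ((a + s *\<^sub>R d) + t *\<^sub>R ((a + s' *\<^sub>R d) - (a + s *\<^sub>R d))) \<bullet> ((a + s' *\<^sub>R d) - (a + s *\<^sub>R d))"
    proof -
      have "(a + s' *\<^sub>R d) - (a + s *\<^sub>R d) = (s' - s) *\<^sub>R d" by (simp add: algebra_simps)
      moreover have "(a + s *\<^sub>R d) + t *\<^sub>R ((s' - s) *\<^sub>R d) = a + (s + t * (s' - s)) *\<^sub>R d"
        by (simp add: algebra_simps)
      ultimately show ?thesis by (simp only: g_def inner_scaleR_right real_scaleR_def)
    qed
    ultimately show "((\<lambda>t. G (s + t * (s' - s))) has_vector_derivative V ((a + s *\<^sub>R d) + t *\<^sub>R ((a + s' *\<^sub>R d) - (a + s *\<^sub>R d))) \<bullet> ((a + s' *\<^sub>R d) - (a + s *\<^sub>R d))) (at t within {0..1})"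
      by (simp add: o_def)
  qed simp
  then show "line_int V (a + s *\<^sub>R d) (a + s' *\<^sub>R d) = G s' - G s"
    unfolding line_int_def by (simp add: integral_unique)
qed

lemma line_int_collinear:
  assumes "continuous_on (closed_segment a b) V"
    and "x \<in> closed_segment a b" "y \<in> closed_segment a b" "z \<in> closed_segment a b"
  shows "line_int V x y + line_int V y z = line_int V x z"
proof -
  have "continuous_on (closed_segment a (a + (b - a))) V" using assms(1) by simp
  then obtain G where G: "\<And>s s'. s \<in> {0..1} \<Longrightarrow> s' \<in> {0..1} \<Longrightarrow>
    line_int V (a + s *\<^sub>R (b - a)) (a + s' *\<^sub>R (b - a)) = G s' - G s" using line_int_along by blast
  have *: "\<exists>t\<in>{0..1}. x = a + t *\<^sub>R (b - a)" if "x \<in> closed_segment a b" for x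
    using that unfolding closed_segment_def by (auto simp: algebra_simps)
  obtain s t r where "s \<in> {0..1}" "t \<in> {0..1}" "r \<in> {0..1}" "x = a + s *\<^sub>R (b - a)"
      "y = a + t *\<^sub>R (b - a)" "z = a + r *\<^sub>R (b - a)" using *[OF assms(2)] *[OF assms(3)] *[OF assms(4)] by blast
  then show ?thesis using G by simp
qed

lemma line_int_estimate:
  assumes "continuous_on (closed_segment a b) V" "\<And>x. x \<in> closed_segment a b \<Longrightarrow> norm (V x - v) \<le> e"
  shows "\<bar>line_int V a b - v \<bullet> (b - a)\<bar> \<le> e * norm (b - a)"
proof -
  have seg: "a + t *\<^sub>R (b - a) \<in> closed_segment a b" if "t \<in> {0..1}" for t
    using that by (rule point_in_closed_segment)
  have c: "continuous_on {0..1} (\<lambda>t. V (a + t *\<^sub>R (b - a)) \<bullet> (b - a))"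
    by (intro continuous_intros continuous_on_compose2[OF assms(1)]) (use seg in auto)
  have "line_int V a b - v \<bullet> (b - a) = integral {0..1} (\<lambda>t. V (a + t *\<^sub>R (b - a)) \<bullet> (b - a) - v \<bullet> (b - a))"
    unfolding line_int_def using integrable_continuous_real[OF c] by (subst integral_diff) auto
  also have "norm \<dots> \<le> (e * norm (b - a)) * (1 - 0)"
  proof (rule integral_bound)
    show "continuous_on {0..1} (\<lambda>t. V (a + t *\<^sub>R (b - a)) \<bullet> (b - a) - v \<bullet> (b - a))"
      by (intro continuous_intros c)
    fix t :: real assume "t \<in> {0..1}"
    then have "norm (V (a + t *\<^sub>R (b - a)) - v) * norm (b - a) \<le> e * norm (b - a)"
      using assms(2) seg by (intro mult_right_mono) auto
    then show "norm (V (a + t *\<^sub>R (b - a)) \<bullet> (b - a) - v \<bullet> (b - a)) \<le> e * norm (b - a)"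
      using Cauchy_Schwarz_ineq2[of "V (a + t *\<^sub>R (b - a)) - v" "b - a"] by (simp add: inner_diff_left)
  qed simp
  finally show ?thesis by simp
qed

lemma compact_parallelogram: "compact (parallelogram p a b)"
  unfolding parallelogram_def split_beta
  by (intro compact_continuous_image continuous_intros compact_Times) auto

lemma convex_parallelogram: "convex (parallelogram p a b)"
proof -
  have eq: "parallelogram p a b = (\<lambda>x. p + x) ` ((\<lambda>z. fst z *\<^sub>R a + snd z *\<^sub>R b) ` ({0..1} \<times> {0..1}))"
    unfolding parallelogram_def by (auto simp: image_iff add.assoc split_beta)
  have "linear (\<lambda>z. fst z *\<^sub>R a + snd z *\<^sub>R b)"
    by (intro linearI) (auto simp: algebra_simps)
  then show ?thesis unfolding eq
    by (intro convex_translation convex_linear_image convex_Times) auto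
qed

lemma parallelogramI:
  "s \<in> {0..1} \<Longrightarrow> t \<in> {0..1} \<Longrightarrow> p + s *\<^sub>R a + t *\<^sub>R b \<in> parallelogram p a b"
  unfolding parallelogram_def by force

lemma parallelogram_corners:
  "p \<in> parallelogram p a b" "p + a \<in> parallelogram p a b"
  "p + b \<in> parallelogram p a b" "p + a + b \<in> parallelogram p a b"
  using parallelogramI[of 0 0 p a b] parallelogramI[of 1 0 p a b]
    parallelogramI[of 0 1 p a b] parallelogramI[of 1 1 p a b] by simp_all

lemma parallelogram_sides:
  "closed_segment p (p + a) \<subseteq> parallelogram p a b"
  "closed_segment (p + a) (p + a + b) \<subseteq> parallelogram p a b"
  "closed_segment (p + b) (p + a + b) \<subseteq> parallelogram p a b"
  "closed_segment p (p + b) \<subseteq> parallelogram p a b"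
  by (intro closed_segment_subset parallelogram_corners convex_parallelogram)+

lemma parallelogram_diameter:
  assumes "x \<in> parallelogram p a b" "y \<in> parallelogram p a b"
  shows "dist x y \<le> norm a + norm b"
proof -
  obtain s t s' t' where *: "x = p + s *\<^sub>R a + t *\<^sub>R b" "y = p + s' *\<^sub>R a + t' *\<^sub>R b"
    "s \<in> {0..1}" "t \<in> {0..1}" "s' \<in> {0..1}" "t' \<in> {0..1}"
    using assms unfolding parallelogram_def by auto
  have "x - y = (s - s') *\<^sub>R a + (t - t') *\<^sub>R b" using * by (simp add: algebra_simps)
  then have "norm (x - y) \<le> \<bar>s - s'\<bar> * norm a + \<bar>t - t'\<bar> * norm b"
    by (metis norm_scaleR norm_triangle_ineq)
  also have "\<dots> \<le> 1 * norm a + 1 * norm b"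
    using * by (intro add_mono mult_right_mono) auto
  finally show ?thesis by (simp add: dist_norm)
qed

text \<open>A constant field has circulation 0, so only the oscillation of the field enters. On a cell of size
\<open>1/n\<close> the circulation of a continuous field is therefore \<open>o(1/n)\<close>.\<close>

lemma circulation_estimate:
  assumes "continuous_on (parallelogram p a b) V" "\<And>x. x \<in> parallelogram p a b \<Longrightarrow> norm (V x - v) \<le> e"
  shows "\<bar>circulation V p a b\<bar> \<le> 2 * e * (norm a + norm b)"
proof -
  note s = parallelogram_sides[where p=p and a=a and b=b]
  have e: "\<bar>line_int V x y - v \<bullet> (y - x)\<bar> \<le> e * norm (y - x)"
    if "closed_segment x y \<subseteq> parallelogram p a b" for x y
    by (rule line_int_estimate[OF continuous_on_subset[OF assms(1) that]]) (use that assms(2) in blast)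
  have "\<bar>line_int V p (p + a) - v \<bullet> a\<bar> \<le> e * norm a" using e[OF s(1)] by simp
  moreover have "\<bar>line_int V (p + a) (p + a + b) - v \<bullet> b\<bar> \<le> e * norm b" using e[OF s(2)] by simp
  moreover have "\<bar>line_int V (p + b) (p + a + b) - v \<bullet> a\<bar> \<le> e * norm a" using e[OF s(3)] by simp
  moreover have "\<bar>line_int V p (p + b) - v \<bullet> b\<bar> \<le> e * norm b" using e[OF s(4)] by simp
  moreover have "2 * e * (norm a + norm b) = e * norm a + e * norm b + e * norm a + e * norm b"
    by (simp add: algebra_simps)
  ultimately show ?thesis unfolding circulation_def by linarith
qed

lemma circulation_gradient:
  assumes "\<And>x. x \<in> parallelogram p a b \<Longrightarrow> GDERIV u x :> V x"
  shows "circulation V p a b = 0"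
proof -
  note s = parallelogram_sides[where p=p and a=a and b=b]
  have "line_int V p (p + a) = u (p + a) - u p" "line_int V (p + a) (p + a + b) = u (p + a + b) - u (p + a)"
    "line_int V (p + b) (p + a + b) = u (p + a + b) - u (p + b)" "line_int V p (p + b) = u (p + b) - u p"
    using assms s by (auto intro!: line_int_gradient)
  then show ?thesis by (simp add: circulation_def)
qed

abbreviation cell :: "'a::euclidean_space \<Rightarrow> 'a \<Rightarrow> 'a \<Rightarrow> nat \<Rightarrow> nat \<Rightarrow> nat \<Rightarrow> 'a" where
  "cell p a b n i j \<equiv> p + (real i / real n) *\<^sub>R a + (real j / real n) *\<^sub>R b"

lemma cell_subset:
  assumes "i < n" "j < n"
  shows "parallelogram (cell p a b n i j) ((1 / real n) *\<^sub>R a) ((1 / real n) *\<^sub>R b) \<subseteq> parallelogram p a b"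
proof
  fix x assume "x \<in> parallelogram (cell p a b n i j) ((1 / real n) *\<^sub>R a) ((1 / real n) *\<^sub>R b)"
  then obtain s t where st: "s \<in> {0..1}" "t \<in> {0..1}"
    "x = cell p a b n i j + s *\<^sub>R ((1 / real n) *\<^sub>R a) + t *\<^sub>R ((1 / real n) *\<^sub>R b)"
    unfolding parallelogram_def by auto
  have "x = p + ((real i + s) / real n) *\<^sub>R a + ((real j + t) / real n) *\<^sub>R b"
    unfolding st(3) by (simp add: add_divide_distrib scaleR_add_left algebra_simps)
  moreover have "(real i + s) / real n \<in> {0..1}" "(real j + t) / real n \<in> {0..1}"
    using assms st(1,2) by (auto simp: divide_le_eq)
  ultimately show "x \<in> parallelogram p a b" using parallelogramI by metis
qed

text \<open>Interior edges of the grid are traversed twice in opposite directions: the sum over the cells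
telescopes in rows and in columns.\<close>

lemma circulation_grid:
  assumes cont: "continuous_on (parallelogram p a b) V" and n: "0 < n"
  shows "circulation V p a b =
    (\<Sum>i<n. \<Sum>j<n. circulation V (cell p a b n i j) ((1 / real n) *\<^sub>R a) ((1 / real n) *\<^sub>R b))"
proof -
  define H where "H i j = line_int V (cell p a b n i j) (cell p a b n (Suc i) j)" for i j
  define W where "W i j = line_int V (cell p a b n i j) (cell p a b n i (Suc j))" for i j
  have in01: "real i / real n \<in> {0..1}" if "i \<le> n" for i using that n by simp
  have circ: "circulation V (cell p a b n i j) ((1 / real n) *\<^sub>R a) ((1 / real n) *\<^sub>R b) =
      (W (Suc i) j - W i j) + (H i j - H i (Suc j))" for i j
  proof -
    have 1: "cell p a b n i j + (1 / real n) *\<^sub>R a = cell p a b n (Suc i) j"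
      by (simp add: add_divide_distrib scaleR_add_left)
    have 2: "cell p a b n i j + (1 / real n) *\<^sub>R b = cell p a b n i (Suc j)" for i j
      by (simp add: add_divide_distrib scaleR_add_left)
    show ?thesis unfolding circulation_def H_def W_def 1 2 by simp
  qed
  have rowsum: "(\<Sum>i<n. H i j) = line_int V (p + (real j / real n) *\<^sub>R b) (p + (real j / real n) *\<^sub>R b + a)" if j: "j \<le> n" for j
  proof -
    let ?q = "p + (real j / real n) *\<^sub>R b"
    have "?q \<in> parallelogram p a b" "?q + a \<in> parallelogram p a b"
      using parallelogramI[of 0 "real j / real n" p a b] parallelogramI[of 1 "real j / real n" p a b] in01[OF j]
      by (simp_all add: algebra_simps)
    then have "continuous_on (closed_segment ?q (?q + a)) V"
      using cont continuous_on_subset convex_parallelogram closed_segment_subset by metis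
    then obtain G where G: "\<And>s s'. s \<in> {0..1} \<Longrightarrow> s' \<in> {0..1} \<Longrightarrow>
      line_int V (?q + s *\<^sub>R a) (?q + s' *\<^sub>R a) = G s' - G s" using line_int_along by blast
    have "H i j = G (real (Suc i) / real n) - G (real i / real n)" if "i < n" for i
      unfolding H_def using G[of "real i / real n" "real (Suc i) / real n"] in01[of i] in01[of "Suc i"] that
      by (simp add: ac_simps)
    then have "(\<Sum>i<n. H i j) = (\<Sum>i<n. G (real (Suc i) / real n) - G (real i / real n))" by simp
    also have "\<dots> = G 1 - G 0"
      using sum_lessThan_telescope[of "\<lambda>i. G (real i / real n)" n] n by simp
    also have "\<dots> = line_int V ?q (?q + a)" using G[of 0 1] by simp
    finally show ?thesis .
  qed
  have colsum: "(\<Sum>j<n. W i j) = line_int V (p + (real i / real n) *\<^sub>R a) (p + (real i / real n) *\<^sub>R a + b)" if i: "i \<le> n" for i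
  proof -
    let ?q = "p + (real i / real n) *\<^sub>R a"
    have "?q \<in> parallelogram p a b" "?q + b \<in> parallelogram p a b"
      using parallelogramI[of "real i / real n" 0 p a b] parallelogramI[of "real i / real n" 1 p a b] in01[OF i]
      by simp_all
    then have "continuous_on (closed_segment ?q (?q + b)) V"
      using cont continuous_on_subset convex_parallelogram closed_segment_subset by metis
    then obtain G where G: "\<And>s s'. s \<in> {0..1} \<Longrightarrow> s' \<in> {0..1} \<Longrightarrow>
      line_int V (?q + s *\<^sub>R b) (?q + s' *\<^sub>R b) = G s' - G s" using line_int_along by blast
    have "W i j = G (real (Suc j) / real n) - G (real j / real n)" if "j < n" for j
      unfolding W_def using G[of "real j / real n" "real (Suc j) / real n"] in01[of j] in01[of "Suc j"] that by simp
    then have "(\<Sum>j<n. W i j) = (\<Sum>j<n. G (real (Suc j) / real n) - G (real j / real n))" by simp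
    also have "\<dots> = G 1 - G 0"
      using sum_lessThan_telescope[of "\<lambda>i. G (real i / real n)" n] n by simp
    also have "\<dots> = line_int V ?q (?q + b)" using G[of 0 1] by simp
    finally show ?thesis .
  qed
  have "(\<Sum>i<n. \<Sum>j<n. circulation V (cell p a b n i j) ((1 / real n) *\<^sub>R a) ((1 / real n) *\<^sub>R b)) =
      (\<Sum>j<n. \<Sum>i<n. W (Suc i) j - W i j) + (\<Sum>i<n. \<Sum>j<n. H i j - H i (Suc j))"
    unfolding circ sum.distrib by (subst sum.swap) simp
  also have "\<dots> = (\<Sum>j<n. W n j - W 0 j) + (\<Sum>i<n. H i 0 - H i n)"
  proof -
    have "(\<Sum>i<n. W (Suc i) j - W i j) = W n j - W 0 j" for j
      using sum_lessThan_telescope[of "\<lambda>i. W i j" n] .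
    moreover have "(\<Sum>j<n. H i j - H i (Suc j)) = H i 0 - H i n" for i
      using sum_lessThan_telescope'[of "\<lambda>j. H i j" n] .
    ultimately show ?thesis by simp
  qed
  also have "\<dots> = circulation V p a b"
    unfolding sum_subtractf using rowsum[of 0] rowsum[of n] colsum[of 0] colsum[of n] n
    by (simp add: circulation_def add_ac)
  finally show ?thesis by simp
qed

text \<open>By compactness the cells of a fine enough grid lie in balls on which a primitive exists, and each
of them contributes 0.\<close>

lemma circulation_eq_0:
  assumes cont: "continuous_on (parallelogram p a b) V"
    and loc: "\<And>x. x \<in> parallelogram p a b \<Longrightarrow> has_local_primitive V x"
  shows "circulation V p a b = 0"
proof -
  define \<G> where "\<G> = {ball x r | x r. 0 < r \<and> (\<exists>u. \<forall>y\<in>ball x r. GDERIV u y :> V y)}"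
  have cover: "parallelogram p a b \<subseteq> \<Union>\<G>"
  proof
    fix x assume "x \<in> parallelogram p a b"
    from loc[OF this] obtain r u where "0 < r" "\<forall>y\<in>ball x r. GDERIV u y :> V y"
      unfolding has_local_primitive_def by blast
    then have "ball x r \<in> \<G>" "x \<in> ball x r" unfolding \<G>_def by auto
    then show "x \<in> \<Union>\<G>" by blast
  qed
  have "\<And>G. G \<in> \<G> \<Longrightarrow> open G" by (auto simp: \<G>_def)
  from Heine_Borel_lemma[OF compact_parallelogram cover this]
  obtain e where e: "0 < e" "\<And>x. x \<in> parallelogram p a b \<Longrightarrow> \<exists>G\<in>\<G>. ball x e \<subseteq> G" by blast
  obtain n where n: "(norm a + norm b) / e < real n" using reals_Archimedean2 by blast
  then have n0: "0 < n" using e(1) by (metis divide_nonneg_pos add_nonneg_nonneg norm_ge_zero not_less of_nat_0 of_nat_le_0_iff le_less_trans less_le_not_le neq0_conv)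
  have "circulation V (cell p a b n i j) ((1 / real n) *\<^sub>R a) ((1 / real n) *\<^sub>R b) = 0"
    if ij: "i < n" "j < n" for i j
  proof -
    let ?q = "cell p a b n i j" let ?P = "parallelogram ?q ((1 / real n) *\<^sub>R a) ((1 / real n) *\<^sub>R b)"
    have "?q \<in> ?P" by (rule parallelogram_corners)
    then obtain G where G: "G \<in> \<G>" "ball ?q e \<subseteq> G" using e(2) cell_subset[OF ij] by blast
    have "?P \<subseteq> ball ?q e"
    proof
      fix x assume "x \<in> ?P"
      then have "dist ?q x \<le> norm ((1 / real n) *\<^sub>R a) + norm ((1 / real n) *\<^sub>R b)"
        using parallelogram_diameter[OF \<open>?q \<in> ?P\<close>] by blast
      also have "\<dots> = (norm a + norm b) / real n" by (simp add: add_divide_distrib)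
      also have "\<dots> < e" using n n0 e(1) by (simp add: field_simps)
      finally show "x \<in> ball ?q e" by simp
    qed
    then show ?thesis using G circulation_gradient unfolding \<G>_def by blast
  qed
  then show ?thesis unfolding circulation_grid[OF cont n0] by simp
qed

lemma has_local_primitive_scaleR:
  assumes "has_local_primitive V x"
  shows "has_local_primitive (\<lambda>y. c *\<^sub>R V y) x"
proof -
  obtain r u where r: "r > 0" "\<And>y. y \<in> ball x r \<Longrightarrow> GDERIV u y :> V y"
    using assms unfolding has_local_primitive_def by blast
  have "GDERIV (\<lambda>y. c * u y) y :> c *\<^sub>R V y" if "y \<in> ball x r" for y
    using has_derivative_mult_right[OF r(2)[OF that, unfolded gderiv_def], of c] unfolding gderiv_def by simp
  then have "\<forall>y\<in>ball x r. GDERIV (\<lambda>y. c * u y) y :> c *\<^sub>R V y" by blast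
  then show ?thesis unfolding has_local_primitive_def by (intro exI[of _ r] conjI r(1) exI[of _ "\<lambda>y. c * u y"])
qed

section \<open>Removable arcs and primitives on simply connected domains\<close>

text \<open>Two cells that meet the same set of diameter at most \<open>L/n\<close> have indices that differ by at most a
constant, because \<open>a\<close> and \<open>b\<close> are independent, quantitatively with constant \<open>\<kappa>\<close>. Hence the number of
such cells is bounded independently of \<open>n\<close>.\<close>

lemma near_cells_card:
  fixes p a b :: "'a::euclidean_space"
  assumes n: "0 < (n::nat)" and \<kappa>: "0 < \<kappa>"
    and indep: "\<And>s t. \<kappa> * \<bar>s\<bar> \<le> norm (s *\<^sub>R a + t *\<^sub>R b)" "\<And>s t. \<kappa> * \<bar>t\<bar> \<le> norm (s *\<^sub>R a + t *\<^sub>R b)"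
    and diam: "\<And>x y. x \<in> C \<Longrightarrow> y \<in> C \<Longrightarrow> dist x y \<le> L / real n"
  defines "m \<equiv> nat \<lceil>(L + 2 * (norm a + norm b)) / \<kappa>\<rceil>"
  defines "N \<equiv> {(i, j). i < n \<and> j < n \<and>
    parallelogram (cell p a b n i j) ((1 / real n) *\<^sub>R a) ((1 / real n) *\<^sub>R b) \<inter> C \<noteq> {}}"
  shows "card N \<le> (2 * m + 1)\<^sup>2"
proof (cases "N = {}")
  case False
  then obtain i0 j0 where 0: "(i0, j0) \<in> N" by auto
  let ?B = "L + 2 * (norm a + norm b)"
  have near: "\<bar>real i - real i0\<bar> \<le> real m \<and> \<bar>real j - real j0\<bar> \<le> real m" if ij: "(i, j) \<in> N" for i j
  proof -
    obtain x where x: "x \<in> parallelogram (cell p a b n i j) ((1 / real n) *\<^sub>R a) ((1 / real n) *\<^sub>R b)" "x \<in> C"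
      using ij by (auto simp: N_def)
    obtain y where y: "y \<in> parallelogram (cell p a b n i0 j0) ((1 / real n) *\<^sub>R a) ((1 / real n) *\<^sub>R b)" "y \<in> C"
      using 0 by (auto simp: N_def)
    have eq: "norm ((1 / real n) *\<^sub>R a) + norm ((1 / real n) *\<^sub>R b) = (norm a + norm b) / real n"
      by (simp add: add_divide_distrib)
    have "dist (cell p a b n i j) x \<le> (norm a + norm b) / real n"
      using parallelogram_diameter[OF parallelogram_corners(1) x(1)] eq by simp
    moreover have "dist y (cell p a b n i0 j0) \<le> (norm a + norm b) / real n"
      using parallelogram_diameter[OF y(1) parallelogram_corners(1)] eq by simp
    moreover have "dist x y \<le> L / real n" using diam x y by blast
    moreover have "dist (cell p a b n i j) (cell p a b n i0 j0) \<le>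
      dist (cell p a b n i j) x + dist x y + dist y (cell p a b n i0 j0)"
      using dist_triangle[of "cell p a b n i j" "cell p a b n i0 j0" x]
        dist_triangle[of x "cell p a b n i0 j0" y] by linarith
    ultimately have "dist (cell p a b n i j) (cell p a b n i0 j0) \<le>
        (norm a + norm b) / real n + L / real n + (norm a + norm b) / real n" by linarith
    also have "\<dots> = ?B / real n" by (simp add: add_divide_distrib)
    finally have d: "dist (cell p a b n i j) (cell p a b n i0 j0) \<le> ?B / real n" .
    have "cell p a b n i j - cell p a b n i0 j0 =
        ((real i - real i0) / real n) *\<^sub>R a + ((real j - real j0) / real n) *\<^sub>R b"
      by (simp add: diff_divide_distrib scaleR_diff_left)
    then have nd: "norm (((real i - real i0) / real n) *\<^sub>R a + ((real j - real j0) / real n) *\<^sub>R b) \<le> ?B / real n"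
      using d by (simp add: dist_norm)
    have "\<kappa> * \<bar>(real i - real i0) / real n\<bar> \<le> ?B / real n" using order_trans[OF indep(1) nd] .
    then have "\<kappa> * \<bar>real i - real i0\<bar> \<le> ?B" using n by (simp add: abs_divide divide_le_cancel)
    then have 1: "\<bar>real i - real i0\<bar> \<le> ?B / \<kappa>" using \<kappa> by (simp add: pos_le_divide_eq mult.commute)
    have "\<kappa> * \<bar>(real j - real j0) / real n\<bar> \<le> ?B / real n" using order_trans[OF indep(2) nd] .
    then have "\<kappa> * \<bar>real j - real j0\<bar> \<le> ?B" using n by (simp add: abs_divide divide_le_cancel)
    then have 2: "\<bar>real j - real j0\<bar> \<le> ?B / \<kappa>" using \<kappa> by (simp add: pos_le_divide_eq mult.commute)
    have "?B / \<kappa> \<le> real m" unfolding m_def by (rule real_nat_ceiling_ge)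
    then show ?thesis using 1 2 by linarith
  qed
  have "N \<subseteq> {i0 - m..i0 + m} \<times> {j0 - m..j0 + m}"
  proof clarify
    fix i j assume "(i, j) \<in> N"
    from near[OF this] show "i \<in> {i0 - m..i0 + m} \<and> j \<in> {j0 - m..j0 + m}" by auto
  qed
  then have "card N \<le> card ({i0 - m..i0 + m} \<times> {j0 - m..j0 + m})" by (intro card_mono) auto
  also have "\<dots> \<le> (2 * m + 1) * (2 * m + 1)"
    unfolding card_cartesian_product by (intro mult_le_mono) auto
  finally show ?thesis by (simp add: power2_eq_square)
qed simp

text \<open>Removability of an arc. Cut the arc into \<open>n\<close> pieces of diameter at most \<open>L/n\<close>: each piece meets a
bounded number of cells of the grid of mesh \<open>1/n\<close>, so \<open>O(n)\<close> cells meet the arc. Each of these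
contributes at most a constant times \<open>\<eta>/n\<close>, where \<open>\<eta>\<close> is the oscillation of the field at scale \<open>1/n\<close>, and the
remaining cells contribute nothing.\<close>

lemma circulation_across_arc:
  fixes V :: "'a::euclidean_space \<Rightarrow> 'a"
  assumes cont: "continuous_on (parallelogram p a b) V" and arc: "Lipschitz_arc \<Gamma>" and \<kappa>: "0 < \<kappa>"
    and indep: "\<And>s t. \<kappa> * \<bar>s\<bar> \<le> norm (s *\<^sub>R a + t *\<^sub>R b)" "\<And>s t. \<kappa> * \<bar>t\<bar> \<le> norm (s *\<^sub>R a + t *\<^sub>R b)"
    and loc: "\<And>x. x \<in> parallelogram p a b \<Longrightarrow> x \<notin> \<Gamma> \<Longrightarrow> has_local_primitive V x"
  shows "circulation V p a b = 0"
proof -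
  obtain c :: "real \<Rightarrow> 'a" and L where c: "L-lipschitz_on {0..1} c" "\<Gamma> = c ` {0..1}"
    using arc unfolding Lipschitz_arc_def by blast
  define l where "l = norm a + norm b"
  define m where "m = nat \<lceil>(L + 2 * (norm a + norm b)) / \<kappa>\<rceil>"
  define M where "M = (2 * m + 1)\<^sup>2"
  have l0: "0 \<le> l" by (simp add: l_def)
  have bound: "\<bar>circulation V p a b\<bar> \<le> (2 * real M * l) * \<eta>" if \<eta>: "0 < \<eta>" for \<eta>
  proof -
    have "uniformly_continuous_on (parallelogram p a b) V"
      using compact_uniformly_continuous[OF cont compact_parallelogram] .
    then obtain \<delta> where \<delta>: "0 < \<delta>" "\<And>x y. x \<in> parallelogram p a b \<Longrightarrow> y \<in> parallelogram p a b \<Longrightarrow>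
        dist x y < \<delta> \<Longrightarrow> dist (V x) (V y) < \<eta>"
      using \<eta> unfolding uniformly_continuous_on_def by (metis dist_commute)
    \<comment> \<open>Mesh so fine that each cell has diameter less than the modulus of continuity.\<close>
    obtain n where n: "l / \<delta> < real n" using reals_Archimedean2 by blast
    have "0 \<le> l / \<delta>" using l0 \<delta>(1) by simp
    then have n0: "0 < n" using n by (cases n) auto
    define P where "P i j = parallelogram (cell p a b n i j) ((1 / real n) *\<^sub>R a) ((1 / real n) *\<^sub>R b)" for i j
    define g where "g i j = circulation V (cell p a b n i j) ((1 / real n) *\<^sub>R a) ((1 / real n) *\<^sub>R b)" for i j
    define N where "N = {(i, j). i < n \<and> j < n \<and> P i j \<inter> \<Gamma> \<noteq> {}}"
    have sub: "P i j \<subseteq> parallelogram p a b" if "i < n" "j < n" for i j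
      unfolding P_def using that by (rule cell_subset)
    have zero: "g i j = 0" if "i < n" "j < n" "P i j \<inter> \<Gamma> = {}" for i j
      unfolding g_def
    proof (rule circulation_eq_0)
      show "continuous_on (parallelogram (cell p a b n i j) ((1 / real n) *\<^sub>R a) ((1 / real n) *\<^sub>R b)) V"
        using continuous_on_subset[OF cont sub[OF that(1,2)]] by (simp add: P_def)
      show "has_local_primitive V x"
        if "x \<in> parallelogram (cell p a b n i j) ((1 / real n) *\<^sub>R a) ((1 / real n) *\<^sub>R b)" for x
        using that loc[of x] sub[OF \<open>i < n\<close> \<open>j < n\<close>] \<open>P i j \<inter> \<Gamma> = {}\<close> unfolding P_def by blast
    qed
    have small: "\<bar>g i j\<bar> \<le> 2 * \<eta> * (l / real n)" if "i < n" "j < n" for i j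
    proof -
      have "\<bar>g i j\<bar> \<le> 2 * \<eta> * (norm ((1 / real n) *\<^sub>R a) + norm ((1 / real n) *\<^sub>R b))"
        unfolding g_def
      proof (rule circulation_estimate)
        show "continuous_on (parallelogram (cell p a b n i j) ((1 / real n) *\<^sub>R a) ((1 / real n) *\<^sub>R b)) V"
          using continuous_on_subset[OF cont sub[OF that]] by (simp add: P_def)
        fix x assume x: "x \<in> parallelogram (cell p a b n i j) ((1 / real n) *\<^sub>R a) ((1 / real n) *\<^sub>R b)"
        have q: "cell p a b n i j \<in> P i j" unfolding P_def by (rule parallelogram_corners)
        have "dist x (cell p a b n i j) \<le> norm ((1 / real n) *\<^sub>R a) + norm ((1 / real n) *\<^sub>R b)"
          using parallelogram_diameter[OF x] q unfolding P_def by blast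
        also have "\<dots> = l / real n" by (simp add: l_def add_divide_distrib)
        also have "\<dots> < \<delta>" using n n0 \<delta>(1) by (simp add: field_simps)
        finally have "dist (V x) (V (cell p a b n i j)) < \<eta>"
          using x q sub[OF that] by (intro \<delta>(2)) (auto simp: P_def)
        then show "norm (V x - V (cell p a b n i j)) \<le> \<eta>" by (simp add: dist_norm)
      qed
      then show ?thesis by (simp add: l_def add_divide_distrib)
    qed
    have cardN: "card N \<le> n * M"
    proof -
      define C where "C k = c ` {real k / real n..real (Suc k) / real n}" for k
      define Nk where "Nk k = {(i, j). i < n \<and> j < n \<and> P i j \<inter> C k \<noteq> {}}" for k
      have Csub: "{real k / real n..real (Suc k) / real n} \<subseteq> {0..1}" if "k < n" for k
      proof -
        have "real (Suc k) / real n \<le> 1" using that by (simp add: divide_le_eq)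
        then show ?thesis by (auto intro: order_trans)
      qed
      have "N \<subseteq> (\<Union>k<n. Nk k)"
      proof clarify
        fix i j assume "(i, j) \<in> N"
        then have ij: "i < n" "j < n" and "P i j \<inter> \<Gamma> \<noteq> {}" by (auto simp: N_def)
        then obtain t where t: "t \<in> {0..1}" "c t \<in> P i j" using c(2) by blast
        \<comment> \<open>The parameter 1 belongs to the last piece.\<close>
        define k where "k = (if t = 1 then n - 1 else nat \<lfloor>t * real n\<rfloor>)"
        have "k < n \<and> t \<in> {real k / real n..real (Suc k) / real n}"
        proof (cases "t = 1")
          case True
          then show ?thesis using n0 by (simp add: k_def of_nat_diff)
        next
          case False
          then have t1: "0 \<le> t" "t < 1" using t by auto
          then have "t * real n < real n" using n0 by simp
          then have "k < n" using t1 n0 False unfolding k_def by (simp add: nat_less_iff floor_less_iff)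
          moreover have "real k \<le> t * real n" "t * real n \<le> real k + 1"
            using t1 False unfolding k_def by simp_all
          ultimately show ?thesis using n0 by (simp add: divide_le_eq le_divide_eq)
        qed
        then have "c t \<in> C k" "k < n" unfolding C_def by auto
        then show "(i, j) \<in> (\<Union>k<n. Nk k)" using ij t unfolding Nk_def by auto
      qed
      moreover have "finite (Nk k)" for k
        by (rule finite_subset[of _ "{..<n} \<times> {..<n}"]) (auto simp: Nk_def)
      ultimately have "card N \<le> card (\<Union>k<n. Nk k)" by (intro card_mono) auto
      also have "\<dots> \<le> (\<Sum>k<n. card (Nk k))" by (rule card_UN_le) simp
      also have "\<dots> \<le> (\<Sum>k<n. M)"
      proof (rule sum_mono)
        fix k assume "k \<in> {..<n}"
        then have k: "k < n" by simp
        show "card (Nk k) \<le> M" unfolding Nk_def P_def M_def m_def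
        proof (rule near_cells_card[OF n0 \<kappa> indep])
          fix x y assume "x \<in> C k" "y \<in> C k"
          then obtain s t where st: "x = c s" "y = c t"
            "s \<in> {real k / real n..real (Suc k) / real n}" "t \<in> {real k / real n..real (Suc k) / real n}"
            unfolding C_def by blast
          have "dist x y \<le> L * dist s t"
            unfolding st(1,2) using lipschitz_onD[OF c(1)] st(3,4) Csub[OF k] by blast
          also have "dist s t \<le> 1 / real n"
            using st(3,4) by (simp add: dist_real_def abs_le_iff add_divide_distrib)
          finally show "dist x y \<le> L / real n"
            using lipschitz_on_nonneg[OF c(1)] by (simp add: mult_left_mono)
        qed
      qed
      also have "\<dots> = n * M" by simp
      finally show ?thesis .
    qed
    have "circulation V p a b = (\<Sum>(i, j)\<in>{..<n} \<times> {..<n}. g i j)"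
      unfolding circulation_grid[OF cont n0] g_def[symmetric] sum.cartesian_product by simp
    also have "\<dots> = (\<Sum>(i, j)\<in>N. g i j)"
      by (rule sum.mono_neutral_right) (auto simp: N_def zero)
    also have "\<bar>\<dots>\<bar> \<le> (\<Sum>(i, j)\<in>N. 2 * \<eta> * (l / real n))"
      by (rule order_trans[OF sum_abs sum_mono]) (use small in \<open>auto simp: N_def\<close>)
    also have "\<dots> = real (card N) * (2 * \<eta> * (l / real n))" by (simp add: split_beta)
    also have "\<dots> \<le> real (n * M) * (2 * \<eta> * (l / real n))"
      using cardN l0 \<eta> by (intro mult_right_mono) (simp_all only: of_nat_le_iff, simp)
    also have "\<dots> = (2 * real M * l) * \<eta>" using n0 by simp
    finally show ?thesis .
  qed
  have "\<bar>circulation V p a b\<bar> \<le> 0"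
  proof (rule field_le_epsilon)
    fix e :: real assume e: "0 < e"
    have D: "0 < 2 * real M * l + 1" using l0 by (intro add_nonneg_pos) auto
    have "\<bar>circulation V p a b\<bar> \<le> (2 * real M * l) * (e / (2 * real M * l + 1))"
      using D e by (intro bound) auto
    also have "\<dots> \<le> (2 * real M * l + 1) * (e / (2 * real M * l + 1))"
      using D e by (intro mult_right_mono) auto
    also have "\<dots> = e" using D by simp
    finally show "\<bar>circulation V p a b\<bar> \<le> 0 + e" by simp
  qed
  then show ?thesis by simp
qed

lemma circulation_degenerate: "circulation V p 0 b = 0" "circulation V p a 0 = 0"
  by (simp_all add: circulation_def line_int_def)

lemma mem_symmetric_closed_segment:
  assumes "0 \<le> k"
  shows "w \<in> closed_segment (Complex (- k) c) (Complex k c) \<longleftrightarrow> Im w = c \<and> \<bar>Re w\<bar> \<le> k"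
    and "w \<in> closed_segment (Complex c (- k)) (Complex c k) \<longleftrightarrow> Re w = c \<and> \<bar>Im w\<bar> \<le> k"
proof -
  have "closed_segment (- k) k = {- k..k}" using assms by (simp add: closed_segment_eq_real_ivl)
  moreover have "x \<in> {- k..k} \<longleftrightarrow> \<bar>x\<bar> \<le> k" for x :: real by auto
  ultimately show "w \<in> closed_segment (Complex (- k) c) (Complex k c) \<longleftrightarrow> Im w = c \<and> \<bar>Re w\<bar> \<le> k"
    "w \<in> closed_segment (Complex c (- k)) (Complex c k) \<longleftrightarrow> Re w = c \<and> \<bar>Im w\<bar> \<le> k"
    using closed_segment_same_Im[of "Complex (- k) c" "Complex k c"]
      closed_segment_same_Re[of "Complex c (- k)" "Complex c k"] by simp_all
qed

text \<open>The primitive is the line integral from 0 along the real axis and then vertically. Vanishing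
circulation allows one to pass from \<open>z\<close> to a nearby \<open>y\<close> by a horizontal and a vertical piece at \<open>z\<close>
instead, where continuity of the field gives the derivative. Solidity of the set provides all the
rectangles that occur; discs about 0 and the whole plane are solid.\<close>

lemma primitive_on_solid:
  fixes V :: "complex \<Rightarrow> complex"
  assumes S: "open S" and solid: "\<And>z w. z \<in> S \<Longrightarrow> \<bar>Re w\<bar> \<le> \<bar>Re z\<bar> \<Longrightarrow> \<bar>Im w\<bar> \<le> \<bar>Im z\<bar> \<Longrightarrow> w \<in> S"
    and cont: "continuous_on S V"
    and circ: "\<And>p \<alpha> \<beta>. parallelogram p (of_real \<alpha>) (\<i> * of_real \<beta>) \<subseteq> S \<Longrightarrow>
      circulation V p (of_real \<alpha>) (\<i> * of_real \<beta>) = 0"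
  shows "\<exists>u. \<forall>z\<in>S. GDERIV u z :> V z"
proof (intro exI ballI)
  define u where "u z = line_int V 0 (of_real (Re z)) + line_int V (of_real (Re z)) z" for z
  fix z assume z: "z \<in> S"
  have horizontal: "line_int V x y + line_int V y w = line_int V x w"
    if S: "Complex m c \<in> S" and xyw: "Im x = c" "Im y = c" "Im w = c" "\<bar>Re x\<bar> \<le> \<bar>m\<bar>" "\<bar>Re y\<bar> \<le> \<bar>m\<bar>" "\<bar>Re w\<bar> \<le> \<bar>m\<bar>"
    for x y w m c
  proof (rule line_int_collinear[of "Complex (- \<bar>m\<bar>) c" "Complex \<bar>m\<bar> c"])
    note seg = mem_symmetric_closed_segment(1)[OF abs_ge_zero[of m]]
    show "continuous_on (closed_segment (Complex (- \<bar>m\<bar>) c) (Complex \<bar>m\<bar> c)) V"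
      by (rule continuous_on_subset[OF cont]) (use seg solid[OF S] in auto)
  qed (use xyw in \<open>auto simp: mem_symmetric_closed_segment(1)[OF abs_ge_zero[of m]]\<close>)
  have vertical: "line_int V x y + line_int V y w = line_int V x w"
    if S: "Complex c m \<in> S" and xyw: "Re x = c" "Re y = c" "Re w = c" "\<bar>Im x\<bar> \<le> \<bar>m\<bar>" "\<bar>Im y\<bar> \<le> \<bar>m\<bar>" "\<bar>Im w\<bar> \<le> \<bar>m\<bar>"
    for x y w m c
  proof (rule line_int_collinear[of "Complex c (- \<bar>m\<bar>)" "Complex c \<bar>m\<bar>"])
    note seg = mem_symmetric_closed_segment(2)[OF abs_ge_zero[of m]]
    show "continuous_on (closed_segment (Complex c (- \<bar>m\<bar>)) (Complex c \<bar>m\<bar>)) V"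
      by (rule continuous_on_subset[OF cont]) (use seg solid[OF S] in auto)
  qed (use xyw in \<open>auto simp: mem_symmetric_closed_segment(2)[OF abs_ge_zero[of m]]\<close>)
  show "GDERIV u z :> V z"
    unfolding gderiv_def has_derivative_at_alt
  proof (intro conjI allI impI)
    show "bounded_linear (\<lambda>h. h \<bullet> V z)" by (rule bounded_linear_inner_left)
    fix e :: real assume e: "0 < e"
    obtain d1 where d1: "0 < d1" "ball z d1 \<subseteq> S" using openE[OF S z] .
    have "continuous (at z) V" using cont S z continuous_on_eq_continuous_at by blast
    then obtain d2 where d2: "0 < d2" "\<And>w. dist w z < d2 \<Longrightarrow> dist (V w) (V z) < e / 2"
      using e unfolding continuous_at_eps_delta by (metis half_gt_zero)
    define d where "d = min d1 d2"
    show "\<exists>d>0. \<forall>y. norm (y - z) < d \<longrightarrow> norm (u y - u z - (y - z) \<bullet> V z) \<le> e * norm (y - z)"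
    proof (intro exI[of _ d] conjI allI impI)
      show "0 < d" using d1 d2 by (simp add: d_def)
      fix y assume y: "norm (y - z) < d"
      define q where "q = Complex (Re y) (Im z)"
      have qz: "norm (q - z) \<le> norm (y - z)" and yq: "norm (y - q) \<le> norm (y - z)"
        using abs_Re_le_cmod[of "y - z"] abs_Im_le_cmod[of "y - z"] by (simp_all add: q_def cmod_def)
      have inb: "z \<in> ball z d" "q \<in> ball z d" "y \<in> ball z d"
        using y qz \<open>0 < d\<close> by (auto simp: dist_norm norm_minus_commute)
      have bS: "ball z d \<subseteq> S" using d1 by (auto simp: d_def)
      then have qS: "q \<in> S" and yS: "y \<in> S" using inb by auto
      have h: "line_int V 0 (of_real (Re y)) = line_int V 0 (of_real (Re z)) + line_int V (of_real (Re z)) (of_real (Re y))"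
      proof (cases "\<bar>Re y\<bar> \<le> \<bar>Re z\<bar>")
        case True
        have "Complex (Re z) 0 \<in> S" by (rule solid[OF z]) auto
        from horizontal[OF this, of 0 "of_real (Re z)" "of_real (Re y)"] True show ?thesis by simp
      next
        case False
        have "Complex (Re y) 0 \<in> S" by (rule solid[OF yS]) auto
        from horizontal[OF this, of 0 "of_real (Re z)" "of_real (Re y)"] False show ?thesis by simp
      qed
      have v: "line_int V (of_real (Re y)) y = line_int V (of_real (Re y)) q + line_int V q y"
      proof (cases "\<bar>Im y\<bar> \<le> \<bar>Im z\<bar>")
        case True
        have "Complex (Re y) (Im z) \<in> S" using qS by (simp add: q_def)
        from vertical[OF this, of "of_real (Re y)" q y] True show ?thesis by (simp add: q_def)
      next
        case False
        have "Complex (Re y) (Im y) \<in> S" using yS by simp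
        from vertical[OF this, of "of_real (Re y)" q y] False show ?thesis by (simp add: q_def)
      qed
      have "parallelogram (of_real (Re z)) (of_real (Re y - Re z)) (\<i> * of_real (Im z)) \<subseteq> S"
      proof
        fix w assume "w \<in> parallelogram (of_real (Re z)) (of_real (Re y - Re z)) (\<i> * of_real (Im z))"
        then obtain s t where st: "s \<in> {0..1}" "t \<in> {0..1}"
          "w = of_real (Re z) + s *\<^sub>R of_real (Re y - Re z) + t *\<^sub>R (\<i> * of_real (Im z))"
          unfolding parallelogram_def by auto
        have Rw: "Re w = (1 - s) * Re z + s * Re y" and Iw: "Im w = t * Im z"
          unfolding st(3) by (simp_all add: algebra_simps)
        have I: "\<bar>Im w\<bar> \<le> \<bar>Im z\<bar>" unfolding Iw abs_mult using st(2) by (simp add: mult_left_le_one_le)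
        have "\<bar>Re w\<bar> \<le> (1 - s) * \<bar>Re z\<bar> + s * \<bar>Re y\<bar>"
          unfolding Rw using st(1) abs_triangle_ineq[of "(1 - s) * Re z" "s * Re y"] by (simp add: abs_mult)
        also have "\<dots> \<le> max \<bar>Re z\<bar> \<bar>Re y\<bar>" using st(1) by (intro convex_bound_le) auto
        finally have "\<bar>Re w\<bar> \<le> \<bar>Re z\<bar> \<or> \<bar>Re w\<bar> \<le> \<bar>Re q\<bar>" by (auto simp: q_def)
        then show "w \<in> S" using solid[OF z _ I] solid[OF qS, of w] I by (auto simp: q_def)
      qed
      from circ[OF this] have "line_int V (of_real (Re z)) (of_real (Re y)) + line_int V (of_real (Re y)) q
          - line_int V z q - line_int V (of_real (Re z)) z = 0"
      proof -
        have 1: "complex_of_real (Re z) + of_real (Re y - Re z) = of_real (Re y)" by simp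
        have 2: "complex_of_real (Re y) + \<i> * of_real (Im z) = q"
          by (simp add: q_def complex_eq_iff)
        have 3: "complex_of_real (Re z) + \<i> * of_real (Im z) = z" by (simp add: complex_eq_iff)
        assume "circulation V (of_real (Re z)) (of_real (Re y - Re z)) (\<i> * of_real (Im z)) = 0"
        then show ?thesis unfolding circulation_def 1 2 3 .
      qed
      then have uu: "u y - u z = line_int V z q + line_int V q y"
        unfolding u_def using h v by linarith
      have segs: "closed_segment z q \<subseteq> ball z d" "closed_segment q y \<subseteq> ball z d"
        by (intro closed_segment_subset inb convex_ball)+
      have est: "\<bar>line_int V x w - V z \<bullet> (w - x)\<bar> \<le> e / 2 * norm (w - x)"
        if sg: "closed_segment x w \<subseteq> ball z d" for x w
      proof (rule line_int_estimate)
        show "continuous_on (closed_segment x w) V"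
          using continuous_on_subset[OF cont] sg bS by blast
        fix t assume "t \<in> closed_segment x w"
        then have "dist t z < d2" using sg by (auto simp: d_def dist_commute)
        from d2(2)[OF this] show "norm (V t - V z) \<le> e / 2" by (simp add: dist_norm)
      qed
      have "u y - u z - (y - z) \<bullet> V z =
          (line_int V z q - V z \<bullet> (q - z)) + (line_int V q y - V z \<bullet> (y - q))"
        unfolding uu by (simp add: inner_diff_right inner_diff_left inner_commute)
      also have "\<bar>\<dots>\<bar> \<le> e / 2 * norm (q - z) + e / 2 * norm (y - q)"
        using est[OF segs(1)] est[OF segs(2)] by linarith
      also have "\<dots> \<le> e / 2 * norm (y - z) + e / 2 * norm (y - z)"
        using qz yq e by (intro add_mono mult_left_mono) auto
      finally show "norm (u y - u z - (y - z) \<bullet> V z) \<le> e * norm (y - z)" by simp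
    qed
  qed
qed

lemma solid_ball: 
  assumes "z \<in> ball 0 r" "\<bar>Re w\<bar> \<le> \<bar>Re z\<bar>" "\<bar>Im w\<bar> \<le> \<bar>Im z\<bar>"
  shows "w \<in> ball 0 r"
proof -
  have "cmod w \<le> cmod z" unfolding cmod_def
    using assms(2,3) by (intro real_sqrt_le_mono add_mono) (simp_all add: abs_le_square_iff)
  then show ?thesis using assms(1) by simp
qed

lemma primitive_across_arc:
  fixes V :: "complex \<Rightarrow> complex"
  assumes S: "open S" and solid: "\<And>z w. z \<in> S \<Longrightarrow> \<bar>Re w\<bar> \<le> \<bar>Re z\<bar> \<Longrightarrow> \<bar>Im w\<bar> \<le> \<bar>Im z\<bar> \<Longrightarrow> w \<in> S"
    and cont: "continuous_on S V" and arc: "Lipschitz_arc \<Gamma>"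
    and loc: "\<And>x. x \<in> S \<Longrightarrow> x \<notin> \<Gamma> \<Longrightarrow> has_local_primitive V x"
  shows "\<exists>u. \<forall>z\<in>S. GDERIV u z :> V z"
proof (rule primitive_on_solid[OF S solid cont])
  fix p \<alpha> \<beta> assume sub: "parallelogram p (of_real \<alpha>) (\<i> * of_real \<beta>) \<subseteq> S"
  show "circulation V p (of_real \<alpha>) (\<i> * of_real \<beta>) = 0"
  proof (cases "\<alpha> = 0 \<or> \<beta> = 0")
    case False
    \<comment> \<open>The edges are orthogonal, so their lengths bound the coordinates.\<close>
    define \<kappa> where "\<kappa> = min \<bar>\<alpha>\<bar> \<bar>\<beta>\<bar>"
    have eq: "s *\<^sub>R complex_of_real \<alpha> + t *\<^sub>R (\<i> * of_real \<beta>) = Complex (s * \<alpha>) (t * \<beta>)" for s t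
      by (simp add: complex_eq_iff)
    show ?thesis
    proof (rule circulation_across_arc[OF continuous_on_subset[OF cont sub] arc, of \<kappa>])
      show "0 < \<kappa>" using False by (simp add: \<kappa>_def)
      show "\<kappa> * \<bar>s\<bar> \<le> norm (s *\<^sub>R complex_of_real \<alpha> + t *\<^sub>R (\<i> * of_real \<beta>))" for s t
      proof -
        have "\<kappa> * \<bar>s\<bar> \<le> \<bar>\<alpha>\<bar> * \<bar>s\<bar>" by (intro mult_right_mono) (auto simp: \<kappa>_def)
        also have "\<dots> \<le> cmod (Complex (s * \<alpha>) (t * \<beta>))"
          using abs_Re_le_cmod[of "Complex (s * \<alpha>) (t * \<beta>)"] by (simp add: abs_mult mult.commute)
        finally show ?thesis unfolding eq .
      qed
      show "\<kappa> * \<bar>t\<bar> \<le> norm (s *\<^sub>R complex_of_real \<alpha> + t *\<^sub>R (\<i> * of_real \<beta>))" for s t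
      proof -
        have "\<kappa> * \<bar>t\<bar> \<le> \<bar>\<beta>\<bar> * \<bar>t\<bar>" by (intro mult_right_mono) (auto simp: \<kappa>_def)
        also have "\<dots> \<le> cmod (Complex (s * \<alpha>) (t * \<beta>))"
          using abs_Im_le_cmod[of "Complex (s * \<alpha>) (t * \<beta>)"] by (simp add: abs_mult mult.commute)
        finally show ?thesis unfolding eq .
      qed
      show "\<And>x. x \<in> parallelogram p (of_real \<alpha>) (\<i> * of_real \<beta>) \<Longrightarrow> x \<notin> \<Gamma> \<Longrightarrow> has_local_primitive V x"
        using loc sub by blast
    qed
  qed (auto simp: circulation_degenerate)
qed

lemma Lipschitz_arc_compact: "Lipschitz_arc \<Gamma> \<Longrightarrow> compact \<Gamma>"
  unfolding Lipschitz_arc_def by (auto intro: compact_continuous_image lipschitz_on_continuous_on)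

lemma GDERIV_translate:
  assumes "GDERIV u (x - a) :> g"
  shows "GDERIV (\<lambda>z. u (z - a)) x :> g"
proof -
  have "((\<lambda>z. z - a) has_derivative (\<lambda>h. h)) (at x)" by (auto intro!: derivative_eq_intros)
  from has_derivative_compose[OF this assms[unfolded gderiv_def]] show ?thesis unfolding gderiv_def .
qed

lemma has_local_primitive_translate:
  assumes "has_local_primitive V (a + x)"
  shows "has_local_primitive (\<lambda>z. V (a + z)) x"
proof -
  obtain r u where r: "0 < r" "\<And>y. y \<in> ball (a + x) r \<Longrightarrow> GDERIV u y :> V y"
    using assms unfolding has_local_primitive_def by blast
  have "GDERIV (\<lambda>z. u (z - (- a))) y :> V (a + y)" if "y \<in> ball x r" for y
    using that r(2)[of "a + y"] by (intro GDERIV_translate) (simp add: dist_norm add.commute)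
  then have "\<forall>y\<in>ball x r. GDERIV (\<lambda>z. u (z - (- a))) y :> V (a + y)" by blast
  then show ?thesis unfolding has_local_primitive_def
    by (intro exI[of _ r] conjI r(1) exI[of _ "\<lambda>z. u (z - (- a))"])
qed

lemma has_local_primitive_across_arc:
  fixes V :: "complex \<Rightarrow> complex"
  assumes e: "0 < e" and cont: "continuous_on (ball y e) V" and arc: "Lipschitz_arc \<Gamma>"
    and loc: "\<And>x. x \<in> ball y e \<Longrightarrow> x \<notin> \<Gamma> \<Longrightarrow> has_local_primitive V x"
  shows "has_local_primitive V y"
proof -
  have arc': "Lipschitz_arc ((\<lambda>x. x - y) ` \<Gamma>)"
  proof -
    obtain c L where c: "L-lipschitz_on {0..1::real} c" "\<Gamma> = c ` {0..1}"
      using arc unfolding Lipschitz_arc_def by blast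
    have "L-lipschitz_on {0..1} (\<lambda>t. c t - y)" using c(1) by (simp add: lipschitz_on_def dist_norm)
    moreover have "(\<lambda>x. x - y) ` \<Gamma> = (\<lambda>t. c t - y) ` {0..1}" using c(2) by auto
    ultimately show ?thesis unfolding Lipschitz_arc_def by blast
  qed
  have "\<exists>u. \<forall>z\<in>ball 0 e. GDERIV u z :> V (y + z)"
  proof (rule primitive_across_arc[of "ball 0 e" "\<lambda>z. V (y + z)", OF open_ball solid_ball _ arc'])
    show "continuous_on (ball 0 e) (\<lambda>z. V (y + z))"
      by (intro continuous_on_compose2[OF cont] continuous_intros) (auto simp: dist_norm)
    fix x assume x: "x \<in> ball 0 e" "x \<notin> (\<lambda>x. x - y) ` \<Gamma>"
    then have "y + x \<notin> \<Gamma>" by (metis add_diff_cancel_left' image_eqI)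
    then show "has_local_primitive (\<lambda>z. V (y + z)) x"
      using x(1) by (intro has_local_primitive_translate loc) (auto simp: dist_norm)
  qed auto
  then obtain u where u: "\<And>z. z \<in> ball 0 e \<Longrightarrow> GDERIV u z :> V (y + z)" by blast
  have "GDERIV (\<lambda>z. u (z - y)) x :> V x" if "x \<in> ball y e" for x
  proof (rule GDERIV_translate)
    have "x - y \<in> ball 0 e" using that by (simp add: dist_norm norm_minus_commute)
    from u[OF this] show "GDERIV u (x - y) :> V x" by simp
  qed
  then have "\<forall>x\<in>ball y e. GDERIV (\<lambda>z. u (z - y)) x :> V x" by blast
  then show ?thesis unfolding has_local_primitive_def by (intro exI[of _ e] conjI e exI[of _ "\<lambda>z. u (z - y)"])
qed

text \<open>Suppose that the set \<open>B\<close> of points without local primitive is nonempty. Near one of its points \<open>B\<close>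
is a closed set covered by countably many closed arcs, so by Baire's theorem some relatively open
nonempty part of it is contained in a single arc; but single arcs are removable.\<close>

lemma has_local_primitive_off_arcs:
  fixes V :: "complex \<Rightarrow> complex"
  assumes S: "open S" and cont: "continuous_on S V"
    and cover: "\<And>p. p \<in> S \<Longrightarrow> \<exists>r>0. \<exists>\<G>. countable \<G> \<and> (\<forall>\<Gamma>\<in>\<G>. Lipschitz_arc \<Gamma>) \<and>
      (\<forall>x\<in>ball p r \<inter> S - \<Union>\<G>. has_local_primitive V x)"
    and p: "p \<in> S"
  shows "has_local_primitive V p"
proof (rule ccontr)
  assume bad: "\<not> has_local_primitive V p"
  define B where "B = {x \<in> S. \<not> has_local_primitive V x}"
  obtain r0 \<G> where r0: "0 < r0" and \<G>: "countable \<G>" "\<And>\<Gamma>. \<Gamma> \<in> \<G> \<Longrightarrow> Lipschitz_arc \<Gamma>"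
    "\<And>x. x \<in> ball p r0 \<Longrightarrow> x \<in> S \<Longrightarrow> x \<notin> \<Union>\<G> \<Longrightarrow> has_local_primitive V x"
    using cover[OF p] by blast
  obtain r1 where r1: "0 < r1" "ball p r1 \<subseteq> S" using openE[OF S p] .
  define r where "r = min r0 r1 / 2"
  have r: "0 < r" "r < r0" "r < r1" using r0 r1 by (auto simp: r_def)
  \<comment> \<open>Baire's theorem needs a closed set; taking the closure of the part of \<open>B\<close> in the open disc
    ensures that every relatively open part of \<open>T\<close> contains points of \<open>B\<close> inside the disc.\<close>
  define T where "T = closure (B \<inter> ball p r)"
  have Tball: "T \<subseteq> cball p r"
    unfolding T_def by (rule closure_minimal) auto
  have TB: "T \<subseteq> B"
  proof
    fix x assume x: "x \<in> T"
    then have "x \<in> cball p r" using Tball by blast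
    then have xS: "x \<in> S" using r1 r by (auto simp: subset_eq)
    have "\<not> has_local_primitive V x"
    proof
      assume "has_local_primitive V x"
      then obtain e where e: "0 < e" "\<And>y. y \<in> ball x e \<Longrightarrow> has_local_primitive V y"
        using has_local_primitive_nearby by blast
      obtain y where "y \<in> B" "dist y x < e"
        using x e(1) unfolding T_def closure_approachable by blast
      then show False using e(2)[of y] by (simp add: B_def dist_commute)
    qed
    then show "x \<in> B" using xS by (simp add: B_def)
  qed
  have Tcov: "T \<subseteq> \<Union>\<G>"
  proof
    fix x assume x: "x \<in> T"
    then have "x \<in> ball p r0" "x \<in> B" using Tball r TB by auto
    then show "x \<in> \<Union>\<G>" using \<G>(3)[of x] by (auto simp: B_def)
  qed
  have pT: "p \<in> T" unfolding T_def using bad p r(1) by (intro closure_subset[THEN subsetD]) (simp add: B_def)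
  have "\<exists>\<Gamma>\<in>\<G>. \<not> T \<subseteq> closure (T - \<Gamma>)"
  proof (rule ccontr)
    assume "\<not> ?thesis"
    then have dense: "\<And>\<Gamma>. \<Gamma> \<in> \<G> \<Longrightarrow> T \<subseteq> closure (T - \<Gamma>)" by blast
    have "T \<subseteq> closure (\<Inter> ((\<lambda>\<Gamma>. T - \<Gamma>) ` \<G>))"
    proof (rule Baire)
      show "closed T" by (simp add: T_def)
      show "countable ((\<lambda>\<Gamma>. T - \<Gamma>) ` \<G>)" using \<G>(1) by simp
      fix U assume "U \<in> (\<lambda>\<Gamma>. T - \<Gamma>) ` \<G>"
      then obtain \<Gamma> where \<Gamma>: "\<Gamma> \<in> \<G>" "U = T - \<Gamma>" by blast
      have "closed \<Gamma>" using \<G>(2)[OF \<Gamma>(1)] Lipschitz_arc_compact compact_imp_closed by blast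
      then have "openin (top_of_set T) (T \<inter> - \<Gamma>)" by (intro openin_open_Int) (simp add: open_Compl)
      then show "openin (top_of_set T) U \<and> T \<subseteq> closure U" using dense[OF \<Gamma>(1)] \<Gamma>(2) by (simp add: Diff_eq)
    qed
    moreover have "\<Inter> ((\<lambda>\<Gamma>. T - \<Gamma>) ` \<G>) = {}" using Tcov pT by auto
    ultimately show False using pT by auto
  qed
  then obtain \<Gamma> x where \<Gamma>: "\<Gamma> \<in> \<G>" and x: "x \<in> T" "x \<notin> closure (T - \<Gamma>)" by blast
  obtain e1 where e1: "0 < e1" "\<And>y. y \<in> T - \<Gamma> \<Longrightarrow> \<not> dist y x < e1"
    using x(2) unfolding closure_approachable by blast
  obtain y where y: "y \<in> B" "y \<in> ball p r" "dist y x < e1"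
    using x(1) e1(1) unfolding T_def closure_approachable by blast
  have "y \<in> ball p r \<inter> ball x e1" using y by (simp add: dist_commute)
  then obtain e where e: "0 < e" "ball y e \<subseteq> ball p r \<inter> ball x e1"
    using openE[OF open_Int[OF open_ball open_ball]] by metis
  have "has_local_primitive V y"
  proof (rule has_local_primitive_across_arc[OF e(1) _ \<G>(2)[OF \<Gamma>]])
    have "ball y e \<subseteq> S" using e(2) r1(2) r(3) by (auto simp: subset_eq)
    then show "continuous_on (ball y e) V" using cont continuous_on_subset by blast
    fix z assume z: "z \<in> ball y e" "z \<notin> \<Gamma>"
    show "has_local_primitive V z"
    proof (rule ccontr)
      assume nz: "\<not> has_local_primitive V z"
      have "z \<in> B \<inter> ball p r" using nz z(1) e(2) \<open>ball y e \<subseteq> S\<close> by (auto simp: B_def)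
      then have "z \<in> T - \<Gamma>" using z(2) closure_subset[of "B \<inter> ball p r"] unfolding T_def by blast
      moreover have "dist z x < e1" using z(1) e(2) by (auto simp: dist_commute)
      ultimately show False using e1(2) by blast
    qed
  qed
  then show False using y(1) by (simp add: B_def)
qed

lemma primitive_on_solid_of_local:
  fixes V :: "complex \<Rightarrow> complex"
  assumes "open S" and "\<And>z w. z \<in> S \<Longrightarrow> \<bar>Re w\<bar> \<le> \<bar>Re z\<bar> \<Longrightarrow> \<bar>Im w\<bar> \<le> \<bar>Im z\<bar> \<Longrightarrow> w \<in> S"
    and "continuous_on S V" and loc: "\<And>x. x \<in> S \<Longrightarrow> has_local_primitive V x"
  shows "\<exists>u. \<forall>z\<in>S. GDERIV u z :> V z"
proof -
  have "0-lipschitz_on {0..1} (\<lambda>_::real. 0::complex)" by (simp add: lipschitz_on_def)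
  then have arc: "Lipschitz_arc {0::complex}" unfolding Lipschitz_arc_def by force
  show ?thesis
    by (rule primitive_across_arc[OF assms(1) _ assms(3) arc]) (use assms(2) loc in blast)+
qed

text \<open>Pulling back a gradient by a holomorphic map multiplies it by the conjugate of the derivative,
since \<open>(g' h) \<bullet> v = h \<bullet> (cnj g' v)\<close>.\<close>

lemma GDERIV_holomorphic_compose:
  assumes "GDERIV u (g z) :> v" "(g has_field_derivative g') (at z)"
  shows "GDERIV (\<lambda>z. u (g z)) z :> cnj g' * v"
proof -
  have "((\<lambda>z. u (g z)) has_derivative (\<lambda>h. (g' * h) \<bullet> v)) (at z)"
    using has_derivative_compose[OF assms(2)[unfolded has_field_derivative_def] assms(1)[unfolded gderiv_def]] .
  moreover have "(\<lambda>h. (g' * h) \<bullet> v) = (\<lambda>h. h \<bullet> (cnj g' * v))"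
    by (auto simp: inner_complex_def algebra_simps)
  ultimately show ?thesis unfolding gderiv_def by simp
qed

text \<open>If the domain is not the whole plane, pull the field back to the unit disc by the inverse Riemann
map, integrate there, and transport the primitive back.\<close>

lemma simply_connected_primitive:
  fixes V :: "complex \<Rightarrow> complex"
  assumes S: "open S" "simply_connected S" and cont: "continuous_on S V"
    and loc: "\<And>x. x \<in> S \<Longrightarrow> has_local_primitive V x"
  shows "\<exists>u. \<forall>z\<in>S. GDERIV u z :> V z"
proof -
  consider "S = {}" | "S = UNIV" | f g where "f holomorphic_on S" "g holomorphic_on ball 0 1"
    "\<And>z. z \<in> S \<Longrightarrow> f z \<in> ball 0 1 \<and> g (f z) = z" "\<And>z. z \<in> ball 0 1 \<Longrightarrow> g z \<in> S \<and> f (g z) = z"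
    using Riemann_mapping_theorem[of S] S by blast
  then show ?thesis
  proof cases
    case 2
    then show ?thesis using primitive_on_solid_of_local[OF S(1) _ cont loc] by blast
  next
    case 3
    define W where "W z = cnj (deriv g z) * V (g z)" for z
    have g': "(g has_field_derivative deriv g z) (at z)" if "z \<in> ball 0 1" for z
      using holomorphic_derivI[OF 3(2) open_ball that] .
    have f': "(f has_field_derivative deriv f z) (at z)" if "z \<in> S" for z
      using holomorphic_derivI[OF 3(1) S(1) that] .
    have "\<exists>u. \<forall>z\<in>ball 0 1. GDERIV u z :> W z"
    proof (rule primitive_on_solid_of_local[OF open_ball solid_ball])
      have "continuous_on (ball 0 1) (deriv g)"
        using holomorphic_deriv[OF 3(2) open_ball] holomorphic_on_imp_continuous_on by blast
      moreover have "continuous_on (ball 0 1) (\<lambda>z. V (g z))"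
        by (rule continuous_on_compose2[OF cont holomorphic_on_imp_continuous_on[OF 3(2)]]) (use 3(4) in blast)
      ultimately show "continuous_on (ball 0 1) W" unfolding W_def by (intro continuous_intros)
      fix x :: complex assume x: "x \<in> ball 0 1"
      obtain r u where r: "0 < r" "\<And>y. y \<in> ball (g x) r \<Longrightarrow> GDERIV u y :> V y"
        using loc[of "g x"] 3(4)[OF x] unfolding has_local_primitive_def by blast
      have "isCont g x" using g'[OF x] DERIV_isCont by blast
      then obtain s where s: "0 < s" "\<And>y. dist y x < s \<Longrightarrow> dist (g y) (g x) < r"
        using r(1) unfolding continuous_at_eps_delta by blast
      obtain s' where s': "0 < s'" "ball x s' \<subseteq> ball 0 1" using openE[OF open_ball x] .
      have "GDERIV (\<lambda>z. u (g z)) y :> W y" if "y \<in> ball x (min s s')" for y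
        unfolding W_def
      proof (rule GDERIV_holomorphic_compose)
        show "GDERIV u (g y) :> V (g y)" using that s(2)[of y] by (intro r(2)) (simp add: dist_commute)
        show "(g has_field_derivative deriv g y) (at y)" using that s'(2) by (intro g') auto
      qed
      then have "\<forall>y\<in>ball x (min s s'). GDERIV (\<lambda>z. u (g z)) y :> W y" by blast
      moreover have "0 < min s s'" using s(1) s'(1) by simp
      ultimately show "has_local_primitive W x" unfolding has_local_primitive_def
        by (intro exI[of _ "min s s'"] conjI exI[of _ "\<lambda>z. u (g z)"])
    qed auto
    then obtain u where u: "\<And>z. z \<in> ball 0 1 \<Longrightarrow> GDERIV u z :> W z" by blast
    have "GDERIV (\<lambda>z. u (f z)) x :> V x" if x: "x \<in> S" for x
    proof -
      have fx: "f x \<in> ball 0 1" "g (f x) = x" using 3(3)[OF x] by auto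
      have "((\<lambda>x. g (f x)) has_field_derivative deriv g (f x) * deriv f x) (at x)"
        using DERIV_chain2[OF g'[OF fx(1)] f'[OF x]] .
      moreover have "((\<lambda>x. g (f x)) has_field_derivative 1) (at x)"
        by (rule has_field_derivative_transform_within_open[OF DERIV_ident S(1) x]) (use 3(3) in auto)
      ultimately have "deriv g (f x) * deriv f x = 1" by (rule DERIV_unique)
      then have eq: "cnj (deriv f x) * (cnj (deriv g (f x)) * V x) = V x"
        by (metis (no_types, lifting) complex_cnj_mult complex_cnj_one mult.assoc mult.commute mult.left_neutral)
      have "GDERIV (\<lambda>z. u (f z)) x :> cnj (deriv f x) * W (f x)"
        by (rule GDERIV_holomorphic_compose[OF u[OF fx(1)] f'[OF x]])
      then show ?thesis unfolding W_def fx(2) eq .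
    qed
    then show ?thesis by blast
  qed auto
qed

text \<open>The isometric identification of the two models of the Euclidean plane; complex analysis is used
only for the existence of the potential.\<close>

definition to_complex :: "real^2 \<Rightarrow> complex" where
  "to_complex x = Complex (x $ 1) (x $ 2)"

definition of_complex :: "complex \<Rightarrow> real^2" where
  "of_complex z = vector [Re z, Im z]"

lemma of_to_complex [simp]: "of_complex (to_complex x) = x" "to_complex (of_complex z) = z"
  by (simp_all add: of_complex_def to_complex_def vec_eq_iff forall_2)

lemma linear_to_complex: "linear to_complex" and linear_of_complex: "linear of_complex"
  by (auto intro!: linearI simp: of_complex_def to_complex_def vec_eq_iff forall_2 complex_eq_iff)

lemma inner_to_complex: "to_complex x \<bullet> z = x \<bullet> of_complex z"
  by (simp add: to_complex_def of_complex_def inner_complex_def inner_vec_def sum_2)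

lemma dist_to_complex: "dist (to_complex x) (to_complex y) = dist x y"
proof -
  have "norm (to_complex x) = norm x" for x
    unfolding norm_eq_sqrt_inner inner_to_complex by simp
  then show ?thesis unfolding dist_norm using linear_diff[OF linear_to_complex] by metis
qed

lemma dist_of_complex: "dist (of_complex x) (of_complex y) = dist x y"
  using dist_to_complex[of "of_complex x" "of_complex y"] by simp

lemma GDERIV_of_complex:
  assumes "GDERIV u (of_complex z) :> g"
  shows "GDERIV (\<lambda>z. u (of_complex z)) z :> to_complex g"
proof -
  have "(of_complex has_derivative of_complex) (at z)"
    using linear_of_complex linear_imp_has_derivative by blast
  from has_derivative_compose[OF this assms[unfolded gderiv_def]] show ?thesis
    unfolding gderiv_def by (simp add: inner_commute[of _ "to_complex g"] inner_to_complex inner_commute[of g])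
qed

lemma GDERIV_to_complex:
  assumes "GDERIV u (to_complex x) :> g"
  shows "GDERIV (\<lambda>x. u (to_complex x)) x :> of_complex g"
proof -
  have "(to_complex has_derivative to_complex) (at x)"
    using linear_to_complex linear_imp_has_derivative by blast
  from has_derivative_compose[OF this assms[unfolded gderiv_def]] show ?thesis
    unfolding gderiv_def by (simp add: inner_to_complex)
qed

text \<open>The form in which the potential is constructed: a continuous field on a simply connected open set
that has local primitives off countably many Lipschitz arcs is a gradient.\<close>

theorem plane_primitive_off_arcs:
  fixes V :: "real^2 \<Rightarrow> real^2"
  assumes S: "open S" "simply_connected S" and cont: "continuous_on S V"
    and cover: "\<And>p. p \<in> S \<Longrightarrow> \<exists>r>0. \<exists>\<G>. countable \<G> \<and> (\<forall>\<Gamma>\<in>\<G>. Lipschitz_arc \<Gamma>) \<and>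
      (\<forall>x\<in>ball p r \<inter> S - \<Union>\<G>. has_local_primitive V x)"
  shows "\<exists>u. \<forall>x\<in>S. GDERIV u x :> V x"
proof -
  define W where "W z = to_complex (V (of_complex z))" for z
  define T where "T = of_complex -` S"
  have TS: "T = to_complex ` S" unfolding T_def by (auto intro: image_eqI[of _ _ "of_complex _"])
  have cto: "continuous_on A to_complex" for A by (rule linear_continuous_on[OF linear_conv_bounded_linear[THEN iffD1, OF linear_to_complex]])
  have cof: "continuous_on A of_complex" for A by (rule linear_continuous_on[OF linear_conv_bounded_linear[THEN iffD1, OF linear_of_complex]])
  have T: "open T" unfolding T_def using S(1) cof by (simp add: open_vimage)
  have homeo: "S homeomorphic T" unfolding homeomorphic_def homeomorphism_def
    by (intro exI[of _ to_complex] exI[of _ of_complex]) (auto simp: TS cto cof image_image)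
  have sT: "simply_connected T" using homeomorphic_simply_connected_eq[OF homeo] S(2) by simp
  have cW: "continuous_on T W" unfolding W_def
    by (intro continuous_on_compose2[OF cto] continuous_on_compose2[OF cont] cof) (auto simp: T_def)
  have locW: "has_local_primitive W (to_complex x)" if prim: "has_local_primitive V x" for x
  proof -
    obtain r u where r: "0 < r" "\<And>y. y \<in> ball x r \<Longrightarrow> GDERIV u y :> V y"
      using prim unfolding has_local_primitive_def by blast
    have "GDERIV (\<lambda>z. u (of_complex z)) z :> W z" if "z \<in> ball (to_complex x) r" for z
      unfolding W_def
    proof (rule GDERIV_of_complex[OF r(2)])
      show "of_complex z \<in> ball x r" using that dist_to_complex[of x "of_complex z"] by simp
    qed
    then have "\<forall>z\<in>ball (to_complex x) r. GDERIV (\<lambda>z. u (of_complex z)) z :> W z" by blast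
    then show ?thesis unfolding has_local_primitive_def
      by (intro exI[of _ r] conjI r(1) exI[of _ "\<lambda>z. u (of_complex z)"])
  qed
  have "has_local_primitive W q" if q: "q \<in> T" for q
  proof (rule has_local_primitive_off_arcs[OF T cW _ q])
    fix z assume "z \<in> T"
    then have "of_complex z \<in> S" by (simp add: T_def)
    from cover[OF this] obtain r \<G> where r: "0 < r" "countable \<G>" "\<And>\<Gamma>. \<Gamma> \<in> \<G> \<Longrightarrow> Lipschitz_arc \<Gamma>"
      "\<And>x. x \<in> ball (of_complex z) r \<inter> S - \<Union>\<G> \<Longrightarrow> has_local_primitive V x" by blast
    have arcs: "Lipschitz_arc (to_complex ` \<Gamma>)" if "\<Gamma> \<in> \<G>" for \<Gamma>
    proof -
      obtain c L where c: "L-lipschitz_on {0..1::real} c" "\<Gamma> = c ` {0..1}"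
        using r(3)[OF \<open>\<Gamma> \<in> \<G>\<close>] unfolding Lipschitz_arc_def by blast
      have "L-lipschitz_on {0..1} (\<lambda>t. to_complex (c t))"
        using c(1) by (simp add: lipschitz_on_def dist_to_complex)
      moreover have "to_complex ` \<Gamma> = (\<lambda>t. to_complex (c t)) ` {0..1}" using c(2) by auto
      ultimately show ?thesis unfolding Lipschitz_arc_def by blast
    qed
    have "has_local_primitive W x" if "x \<in> ball z r \<inter> T - \<Union> ((`) to_complex ` \<G>)" for x
    proof -
      have "of_complex x \<in> ball (of_complex z) r \<inter> S - \<Union>\<G>"
      proof -
        have "of_complex x \<notin> \<Gamma>" if "\<Gamma> \<in> \<G>" for \<Gamma>
        proof
          assume "of_complex x \<in> \<Gamma>"
          then have "to_complex (of_complex x) \<in> to_complex ` \<Gamma>" by (rule imageI)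
          then show False using \<open>x \<in> ball z r \<inter> T - _\<close> that by auto
        qed
        then show ?thesis using that by (auto simp: T_def dist_of_complex)
      qed
      from locW[OF r(4)[OF this]] show ?thesis by simp
    qed
    then show "\<exists>r>0. \<exists>\<G>. countable \<G> \<and> (\<forall>\<Gamma>\<in>\<G>. Lipschitz_arc \<Gamma>) \<and>
      (\<forall>x\<in>ball z r \<inter> T - \<Union>\<G>. has_local_primitive W x)"
      using r(1,2) arcs by (intro exI[of _ r] conjI exI[of _ "(`) to_complex ` \<G>"]) auto
  qed
  then obtain u where u: "\<And>z. z \<in> T \<Longrightarrow> GDERIV u z :> W z"
    using simply_connected_primitive[OF T sT cW] by blast
  have "GDERIV (\<lambda>x. u (to_complex x)) x :> V x" if "x \<in> S" for x
    using GDERIV_to_complex[OF u[of "to_complex x"]] that by (simp add: T_def W_def)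
  then show ?thesis by blast
qed

section \<open>Mollification and weakly divergence-free fields\<close>

text \<open>A nonnegative \<open>C\<^sup>1\<close> function supported in the disc of radius \<open>1/n\<close>, which serves both as mollifying
kernel and as test function. It is not normalized; \<open>bump_mass\<close> below is its integral.\<close>

definition bump :: "real \<Rightarrow> real^2 \<Rightarrow> real" where
  "bump n y = (max 0 (1 - n\<^sup>2 * (y \<bullet> y)))\<^sup>2"

definition bump_grad :: "real \<Rightarrow> real^2 \<Rightarrow> real^2" where
  "bump_grad n y = (- 4 * n\<^sup>2 * max 0 (1 - n\<^sup>2 * (y \<bullet> y))) *\<^sub>R y"

definition square :: "real \<Rightarrow> (real^2) set" where
  "square s = cbox (vector [- s, - s]) (vector [s, s])"

lemma mem_square: "y \<in> square s \<longleftrightarrow> \<bar>y $ 1\<bar> \<le> s \<and> \<bar>y $ 2\<bar> \<le> s"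
  by (auto simp: square_def mem_box_cart forall_2)

lemma norm_le_sum2: "norm (y :: real^2) \<le> \<bar>y $ 1\<bar> + \<bar>y $ 2\<bar>"
  using norm_le_l1_cart[of y] by (simp add: sum_2)

lemma square_norm: "y \<in> square s \<Longrightarrow> norm y \<le> 2 * s"
  using norm_le_sum2[of y] by (auto simp: mem_square)

lemma norm_square: "norm y \<le> s \<Longrightarrow> y \<in> square s"
  using component_le_norm_cart[of y 1] component_le_norm_cart[of y 2] by (auto simp: mem_square)

lemma content_square: "0 \<le> s \<Longrightarrow> measure lborel (square s) = 4 * s\<^sup>2"
proof -
  assume s: "0 \<le> s"
  have "square s \<noteq> {}" using norm_square[of 0 s] s by auto
  then show ?thesis unfolding square_def
    by (subst content_cbox_cart) (simp_all add: UNIV_2 power2_eq_square)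
qed

lemma DERIV_max_sq: "((\<lambda>t. (max 0 t)\<^sup>2) has_real_derivative 2 * max 0 t) (at (t::real))"
proof -
  consider "t < 0" | "t > 0" | "t = 0" by linarith
  then show ?thesis
  proof cases
    case 1
    have "((\<lambda>t. (max 0 t)\<^sup>2) has_real_derivative 0) (at t)"
      by (rule has_field_derivative_transform_within_open[OF DERIV_const[of 0], of "{..<0}"]) (use 1 in auto)
    then show ?thesis using 1 by simp
  next
    case 2
    have "((\<lambda>t::real. t\<^sup>2) has_real_derivative 2 * t) (at t)" by (auto intro!: derivative_eq_intros)
    then have "((\<lambda>t. (max 0 t)\<^sup>2) has_real_derivative 2 * t) (at t)"
      by (rule has_field_derivative_transform_within_open[of _ _ _ "{0<..}"]) (use 2 in auto)
    then show ?thesis using 2 by simp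
  next
    case 3
    have "(\<lambda>h::real. (max 0 h)\<^sup>2 / h) \<midarrow>0\<rightarrow> 0"
    proof (rule Lim_null_comparison[where g="\<lambda>h. \<bar>h\<bar>"])
      have "norm ((max 0 h)\<^sup>2 / h) \<le> \<bar>h\<bar>" for h :: real
        by (cases "h > 0") (auto simp: power2_eq_square max_def)
      then show "\<forall>\<^sub>F h in at (0::real). norm ((max 0 h)\<^sup>2 / h) \<le> \<bar>h\<bar>" by simp
      show "(\<lambda>h::real. \<bar>h\<bar>) \<midarrow>0\<rightarrow> 0" by (rule tendsto_rabs_zero) (rule tendsto_ident_at)
    qed
    then show ?thesis using 3 by (simp add: DERIV_def)
  qed
qed

lemma GDERIV_bump: "GDERIV (bump n) y :> bump_grad n y"
proof -
  have "((\<lambda>y::real^2. 1 - n\<^sup>2 * (y \<bullet> y)) has_derivative (\<lambda>h. h \<bullet> ((- 2 * n\<^sup>2) *\<^sub>R y))) (at y)"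
    by (auto intro!: derivative_eq_intros simp: inner_commute algebra_simps)
  then have "GDERIV (\<lambda>y::real^2. 1 - n\<^sup>2 * (y \<bullet> y)) y :> (- 2 * n\<^sup>2) *\<^sub>R y" unfolding gderiv_def .
  from GDERIV_DERIV_compose[OF this DERIV_max_sq] show ?thesis
    unfolding bump_def bump_grad_def by (simp add: mult_ac)
qed

lemma continuous_on_bump [continuous_intros]: "continuous_on A f \<Longrightarrow> continuous_on A (\<lambda>x. bump n (f x))"
  unfolding bump_def by (intro continuous_intros)

lemma continuous_on_bump_grad [continuous_intros]: "continuous_on A f \<Longrightarrow> continuous_on A (\<lambda>x. bump_grad n (f x))"
  unfolding bump_grad_def by (intro continuous_intros)

lemma bump_nonneg: "0 \<le> bump n y" by (simp add: bump_def)

lemma bump_support: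
  assumes "0 < n" "1 / n \<le> norm y"
  shows "bump n y = 0" "bump_grad n y = 0"
proof -
  have "1 \<le> n * norm y" using assms by (simp add: field_simps)
  then have "1\<^sup>2 \<le> (n * norm y)\<^sup>2" by (intro power_mono) auto
  then have "1 \<le> n\<^sup>2 * (y \<bullet> y)" by (simp add: power_mult_distrib power2_norm_eq_inner)
  then show "bump n y = 0" "bump_grad n y = 0" by (simp_all add: bump_def bump_grad_def)
qed

lemma bump_outside_square:
  assumes "0 < n" "y \<notin> square (1 / n)"
  shows "bump n y = 0" "bump_grad n y = 0"
  using assms norm_square[of y "1 / n"] bump_support[of n y] by force+

lemma norm_bump_grad_le:
  assumes n: "0 < n"
  shows "norm (bump_grad n y) \<le> 4 * n"
proof (cases "1 / n \<le> norm y")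
  case True
  then show ?thesis using bump_support(2)[OF n] n by simp
next
  case False
  have 1: "\<bar>max 0 (1 - n\<^sup>2 * (y \<bullet> y))\<bar> \<le> 1" by simp
  have "norm (bump_grad n y) = 4 * n\<^sup>2 * \<bar>max 0 (1 - n\<^sup>2 * (y \<bullet> y))\<bar> * norm y"
    by (simp add: bump_grad_def abs_mult)
  also have "\<dots> \<le> 4 * n\<^sup>2 * 1 * (1 / n)"
    using False n 1 by (intro mult_mono) (auto intro!: mult_nonneg_nonneg)
  also have "\<dots> = 4 * n" using n by (simp add: power2_eq_square)
  finally show ?thesis .
qed

definition bump_mass :: "real \<Rightarrow> real" where
  "bump_mass n = integral (square (1 / n)) (bump n)"

text \<open>The lower bound has the order \<open>n\<^sup>-\<^sup>2\<close> of the area of the support. This makes the estimate for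
derivatives of mollified functions below independent of \<open>n\<close>.\<close>

lemma bump_mass_ge:
  assumes n: "0 < n"
  shows "1 / (8 * n\<^sup>2) \<le> bump_mass n"
proof -
  have int: "bump n integrable_on square s" for s
    unfolding square_def by (intro integrable_continuous continuous_intros)
  have sub: "square (1 / (4 * n)) \<subseteq> square (1 / n)"
    using n by (auto simp: mem_square field_simps)
  have "1 / (8 * n\<^sup>2) = integral (square (1 / (4 * n))) (\<lambda>y. 1 / 2)"
    using content_square[of "1 / (4 * n)"] n by (simp add: square_def power2_eq_square)
  also have "\<dots> \<le> integral (square (1 / (4 * n))) (bump n)"
  proof (rule integral_le)
    show "(\<lambda>y. 1 / 2) integrable_on square (1 / (4 * n))" unfolding square_def by (rule integrable_const)
    show "bump n integrable_on square (1 / (4 * n))" by (rule int)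
    fix y assume y: "y \<in> square (1 / (4 * n))"
    have "\<bar>y $ 1\<bar>\<^sup>2 \<le> (1 / (4 * n))\<^sup>2" by (rule power_mono) (use y in \<open>auto simp: mem_square\<close>)
    moreover have "\<bar>y $ 2\<bar>\<^sup>2 \<le> (1 / (4 * n))\<^sup>2" by (rule power_mono) (use y in \<open>auto simp: mem_square\<close>)
    ultimately have "y \<bullet> y \<le> 2 * (1 / (4 * n))\<^sup>2"
      by (simp add: inner_vec_def sum_2 power2_eq_square)
    then have "n\<^sup>2 * (y \<bullet> y) \<le> n\<^sup>2 * (2 * (1 / (4 * n))\<^sup>2)" by (intro mult_left_mono) auto
    also have "\<dots> = 1 / 8" using n by (simp add: power2_eq_square)
    finally have "7 / 8 \<le> 1 - n\<^sup>2 * (y \<bullet> y)" by linarith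
    then have m: "7 / 8 \<le> max 0 (1 - n\<^sup>2 * (y \<bullet> y))" by (rule max.coboundedI2)
    have "(7 / 8)\<^sup>2 \<le> bump n y" unfolding bump_def by (rule power_mono[OF m]) simp
    then show "1 / 2 \<le> bump n y" by (simp add: power2_eq_square)
  qed
  also have "\<dots> \<le> bump_mass n"
    unfolding bump_mass_def by (rule integral_subset_le[OF sub int int]) (simp add: bump_nonneg)
  finally show ?thesis .
qed

lemma bump_mass_pos: "0 < n \<Longrightarrow> 0 < bump_mass n"
  using bump_mass_ge[of n] by (smt (verit) divide_pos_pos zero_less_power)

text \<open>Integrating over a fixed box, and not over the plane, makes the result \<open>C\<^sup>1\<close> everywhere for every
function that is continuous on the box. The whole kernel enters the integral only at points that
are farther than its radius from the complement of the box; the estimates below are for such points.\<close>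

definition mollified :: "(real^2) set \<Rightarrow> real \<Rightarrow> (real^2 \<Rightarrow> real) \<Rightarrow> real^2 \<Rightarrow> real" where
  "mollified B n f x = integral B (\<lambda>y. bump n (y - x) * f y)"

definition mollified_grad :: "(real^2) set \<Rightarrow> real \<Rightarrow> (real^2 \<Rightarrow> real) \<Rightarrow> real^2 \<Rightarrow> real^2" where
  "mollified_grad B n f x = - integral B (\<lambda>y. f y *\<^sub>R bump_grad n (y - x))"

text \<open>Differentiation under the integral sign moves the derivative onto the kernel.\<close>

lemma GDERIV_mollified:
  assumes f: "continuous_on (cbox a b) f"
  shows "GDERIV (mollified (cbox a b) n f) x :> mollified_grad (cbox a b) n f x"
proof -
  have c: "continuous_on (UNIV \<times> cbox a b) (\<lambda>(x, y). - (f y *\<^sub>R bump_grad n (y - x)))"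
    unfolding split_beta
    by (intro continuous_intros continuous_on_compose2[OF f]) auto
  have int: "(\<lambda>y. - (f y *\<^sub>R bump_grad n (y - x))) integrable_on cbox a b" for x
    by (intro integrable_continuous continuous_intros f)
  have "((\<lambda>x. integral (cbox a b) (\<lambda>y. bump n (y - x) * f y)) has_derivative
      blinfun_apply (integral (cbox a b) (\<lambda>y. blinfun_inner_left (- (f y *\<^sub>R bump_grad n (y - x)))))) (at x within UNIV)"
  proof (rule leibniz_rule)
    fix x y assume "y \<in> cbox a b"
    have "((\<lambda>x. y - x) has_derivative (\<lambda>h. - h)) (at x)" by (auto intro!: derivative_eq_intros)
    from has_derivative_compose[OF this GDERIV_bump[unfolded gderiv_def]]
    have "((\<lambda>x. bump n (y - x)) has_derivative (\<lambda>h. (- h) \<bullet> bump_grad n (y - x))) (at x)" .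
    from has_derivative_mult_left[OF this, of "f y"]
    show "((\<lambda>x. bump n (y - x) * f y) has_derivative blinfun_apply (blinfun_inner_left (- (f y *\<^sub>R bump_grad n (y - x))))) (at x within UNIV)"
      by (simp add: mult.commute)
  next
    show "(\<lambda>y. bump n (y - x) * f y) integrable_on cbox a b" for x
      by (intro integrable_continuous continuous_intros f)
    show "continuous_on (UNIV \<times> cbox a b) (\<lambda>(x, y). blinfun_inner_left (- (f y *\<^sub>R bump_grad n (y - x))))"
      using bounded_linear.continuous_on[OF bounded_linear_blinfun_inner_left c] by (simp add: split_beta)
  qed auto
  moreover have "integral (cbox a b) (\<lambda>y. blinfun_inner_left (- (f y *\<^sub>R bump_grad n (y - x)))) =
      blinfun_inner_left (integral (cbox a b) (\<lambda>y. - (f y *\<^sub>R bump_grad n (y - x))))"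
    using integral_linear[OF int bounded_linear_blinfun_inner_left] by (simp add: o_def)
  ultimately show ?thesis unfolding gderiv_def mollified_def mollified_grad_def by simp
qed

lemma continuous_on_mollified_grad:
  assumes f: "continuous_on (cbox a b) f"
  shows "continuous_on UNIV (mollified_grad (cbox a b) n f)"
  unfolding mollified_grad_def[abs_def]
proof (intro continuous_on_minus integral_continuous_on_param)
  show "continuous_on (UNIV \<times> cbox a b) (\<lambda>(x, y). f y *\<^sub>R bump_grad n (y - x))"
    unfolding split_beta
    by (intro continuous_intros continuous_on_compose2[OF f]) auto
qed

lemma integral_localize:
  fixes g :: "real^2 \<Rightarrow> 'b::euclidean_space"
  assumes n: "0 < n" and B: "cball x (2 / n) \<subseteq> cbox a b" and c: "continuous_on (cbox a b) g"
    and z: "\<And>y. y - x \<notin> square (1 / n) \<Longrightarrow> g y = 0"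
  shows "integral (cbox a b) g = integral (square (1 / n)) (\<lambda>y. g (x + y))"
proof -
  let ?l = "vector [- (1 / n), - (1 / n)] :: real^2" and ?u = "vector [1 / n, 1 / n] :: real^2"
  have mem: "y \<in> cbox (?l + x) (?u + x) \<longleftrightarrow> y - x \<in> square (1 / n)" for y
    by (auto simp: square_def mem_box_cart forall_2)
  have sub: "cbox (?l + x) (?u + x) \<subseteq> cbox a b"
  proof
    fix y assume "y \<in> cbox (?l + x) (?u + x)"
    then have "norm (y - x) \<le> 2 * (1 / n)" using mem square_norm by blast
    then show "y \<in> cbox a b" using B by (auto simp: dist_norm norm_minus_commute)
  qed
  have "(g has_integral integral (cbox (?l + x) (?u + x)) g) (cbox (?l + x) (?u + x))"
    by (intro integrable_integral integrable_continuous continuous_on_subset[OF c sub])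
  then have "(g has_integral integral (cbox (?l + x) (?u + x)) g) (cbox a b)"
    by (rule has_integral_on_superset) (use z mem sub in auto)
  then have "integral (cbox a b) g = integral (cbox (?l + x) (?u + x)) g" by (rule integral_unique)
  also have "\<dots> = integral (cbox ?l ?u) (g \<circ> (+) x)" by (rule integral_shift_cbox_plus[symmetric])
  finally show ?thesis by (simp add: square_def o_def)
qed

lemma mollified_localize:
  assumes n: "0 < n" and B: "cball x (2 / n) \<subseteq> cbox a b" and c: "continuous_on (cbox a b) f"
  shows "mollified (cbox a b) n f x = integral (square (1 / n)) (\<lambda>y. bump n y * f (x + y))"
    "mollified_grad (cbox a b) n f x = - integral (square (1 / n)) (\<lambda>y. f (x + y) *\<^sub>R bump_grad n y)"
proof -
  have "integral (cbox a b) (\<lambda>y. bump n (y - x) * f y) = integral (square (1 / n)) (\<lambda>y. bump n ((x + y) - x) * f (x + y))"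
    by (intro integral_localize[OF n B] continuous_intros c) (simp add: bump_outside_square n)
  then show "mollified (cbox a b) n f x = integral (square (1 / n)) (\<lambda>y. bump n y * f (x + y))"
    by (simp add: mollified_def)
  have "integral (cbox a b) (\<lambda>y. f y *\<^sub>R bump_grad n (y - x)) = integral (square (1 / n)) (\<lambda>y. f (x + y) *\<^sub>R bump_grad n ((x + y) - x))"
    by (intro integral_localize[OF n B] continuous_intros c) (simp add: bump_outside_square n)
  then show "mollified_grad (cbox a b) n f x = - integral (square (1 / n)) (\<lambda>y. f (x + y) *\<^sub>R bump_grad n y)"
    by (simp add: mollified_grad_def)
qed

lemma shifted_square_subset:
  assumes B: "cball x (2 / n) \<subseteq> B" and y: "y \<in> square (1 / n)"
  shows "x + y \<in> B" "norm y \<le> 2 / n"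
  using square_norm[OF y] B by (auto simp: dist_norm)

lemma mollified_approx:
  assumes n: "0 < n" and B: "cball x (2 / n) \<subseteq> cbox a b" and c: "continuous_on (cbox a b) f"
    and e: "\<And>y. norm y \<le> 2 / n \<Longrightarrow> \<bar>f (x + y) - f x\<bar> \<le> e"
  shows "\<bar>mollified (cbox a b) n f x / bump_mass n - f x\<bar> \<le> e"
proof -
  let ?Q = "square (1 / n)"
  have cf: "continuous_on ?Q (\<lambda>y. f (x + y))"
    by (intro continuous_on_compose2[OF c] continuous_intros) (use shifted_square_subset[OF B] in auto)
  have ib: "(\<lambda>y. bump n y * g y) integrable_on ?Q" if "continuous_on ?Q g" for g
    using that unfolding square_def by (intro integrable_continuous continuous_intros)
  have "mollified (cbox a b) n f x - f x * bump_mass n = integral ?Q (\<lambda>y. bump n y * (f (x + y) - f x))"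
    using integral_diff[OF ib[OF cf] ib[of "\<lambda>_. f x"]]
    by (simp add: mollified_localize[OF n B c] bump_mass_def right_diff_distrib mult.commute)
  moreover have "norm (integral ?Q (\<lambda>y. bump n y * (f (x + y) - f x))) \<le> integral ?Q (\<lambda>y. bump n y * e)"
  proof (rule integral_norm_bound_integral)
    show "(\<lambda>y. bump n y * (f (x + y) - f x)) integrable_on ?Q" by (intro ib continuous_intros cf)
    show "(\<lambda>y. bump n y * e) integrable_on ?Q" by (intro ib continuous_intros)
    fix y assume "y \<in> ?Q"
    then have "\<bar>f (x + y) - f x\<bar> \<le> e" using e shifted_square_subset[OF B] by blast
    then show "norm (bump n y * (f (x + y) - f x)) \<le> bump n y * e"
      by (simp add: abs_mult bump_nonneg mult_left_mono)
  qed
  moreover have "integral ?Q (\<lambda>y. bump n y * e) = e * bump_mass n"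
    unfolding bump_mass_def by simp
  ultimately have "\<bar>mollified (cbox a b) n f x - f x * bump_mass n\<bar> \<le> e * bump_mass n" by (simp only: real_norm_def)
  moreover have "mollified (cbox a b) n f x / bump_mass n - f x = (mollified (cbox a b) n f x - f x * bump_mass n) / bump_mass n"
    using bump_mass_pos[OF n] by (simp add: field_simps)
  ultimately show ?thesis
    using bump_mass_pos[OF n] by (simp add: abs_divide pos_divide_le_eq)
qed

text \<open>The mollification of an affine function is affine with the same slope, up to the mass of the
kernel. Uniqueness of the gradient turns this into a moment identity for \<open>bump_grad\<close>, without
computing any moment.\<close>

lemma mollified_grad_affine:
  assumes n: "0 < n" and B: "cball x (3 / n) \<subseteq> cbox a b"
  shows "mollified_grad (cbox a b) n (\<lambda>y. c + g \<bullet> (y - x)) x = bump_mass n *\<^sub>R g"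
proof -
  let ?f = "\<lambda>y. c + g \<bullet> (y - x)" and ?Q = "square (1 / n)"
  have cf: "continuous_on (cbox a b) ?f" by (intro continuous_intros)
  define k where "k = integral ?Q (\<lambda>y. bump n y * (c + g \<bullet> y))"
  have eq: "k + (g \<bullet> (x' - x)) * bump_mass n = mollified (cbox a b) n ?f x'" if "x' \<in> ball x (1 / n)" for x'
  proof -
    have "cball x' (2 / n) \<subseteq> cbox a b"
    proof
      fix y assume "y \<in> cball x' (2 / n)"
      then have "dist x y \<le> 3 / n" using that dist_triangle[of x y x'] by (simp add: dist_commute add_divide_distrib[symmetric])
      then show "y \<in> cbox a b" using B by auto
    qed
    then have "mollified (cbox a b) n ?f x' = integral ?Q (\<lambda>y. bump n y * (c + g \<bullet> ((x' + y) - x)))"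
      by (rule mollified_localize[OF n _ cf])
    also have "\<dots> = integral ?Q (\<lambda>y. bump n y * (c + g \<bullet> y) + (g \<bullet> (x' - x)) * bump n y)"
      by (rule integral_cong) (simp add: algebra_simps inner_add_right inner_diff_right)
    also have "\<dots> = k + (g \<bullet> (x' - x)) * bump_mass n"
      unfolding k_def bump_mass_def
      by (subst integral_add) (auto simp: square_def intro!: integrable_continuous continuous_intros)
    finally show ?thesis by simp
  qed
  have "((\<lambda>x'. k + (g \<bullet> (x' - x)) * bump_mass n) has_derivative (\<lambda>h. h \<bullet> (bump_mass n *\<^sub>R g))) (at x)"
    by (auto intro!: derivative_eq_intros simp: inner_commute mult.commute)
  then have "(mollified (cbox a b) n ?f has_derivative (\<lambda>h. h \<bullet> (bump_mass n *\<^sub>R g))) (at x)"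
    by (rule has_derivative_transform_within_open[of _ _ _ _ "ball x (1 / n)"]) (use eq n in auto)
  then have "GDERIV (mollified (cbox a b) n ?f) x :> bump_mass n *\<^sub>R g" unfolding gderiv_def .
  with GDERIV_mollified[OF cf] show ?thesis using grad_eqI by metis
qed

text \<open>By the preceding identity one may subtract the affine function \<open>f x + g \<bullet> y\<close>. The rest is at most
\<open>e/n\<close> on the support of the kernel, whose gradient is at most \<open>4 n\<close> on an area \<open>4/n\<^sup>2\<close>, while the mass is at
least \<open>1/(8 n\<^sup>2)\<close>. For \<open>g = 0\<close> and a Lipschitz function this bounds the gradients of the
mollifications; at a point of differentiability it shows that they converge to the gradient.\<close>

lemma mollified_grad_approx:
  assumes n: "0 < n" and B: "cball x (3 / n) \<subseteq> cbox a b" and c: "continuous_on (cbox a b) f"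
    and e: "\<And>y. norm y \<le> 2 / n \<Longrightarrow> \<bar>f (x + y) - f x - g \<bullet> y\<bar> \<le> e / n"
  shows "norm (mollified_grad (cbox a b) n f x /\<^sub>R bump_mass n - g) \<le> 128 * e"
proof -
  let ?Q = "square (1 / n)"
  have B2: "cball x (2 / n) \<subseteq> cbox a b"
    by (rule order_trans[OF subset_cball B]) (use n in \<open>simp add: divide_right_mono\<close>)
  have cf: "continuous_on ?Q (\<lambda>y. f (x + y))"
    by (intro continuous_on_compose2[OF c] continuous_intros) (use shifted_square_subset[OF B2] in auto)
  have ib: "(\<lambda>y. h y *\<^sub>R bump_grad n y) integrable_on ?Q" if "continuous_on ?Q h" for h
    using that unfolding square_def by (intro integrable_continuous continuous_intros)
  have aff: "mollified_grad (cbox a b) n (\<lambda>y. f x + g \<bullet> (y - x)) x =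
      - integral ?Q (\<lambda>y. (f x + g \<bullet> ((x + y) - x)) *\<^sub>R bump_grad n y)"
    by (intro mollified_localize(2)[OF n B2] continuous_intros)
  have "mollified_grad (cbox a b) n f x - bump_mass n *\<^sub>R g =
      - integral ?Q (\<lambda>y. f (x + y) *\<^sub>R bump_grad n y) + integral ?Q (\<lambda>y. (f x + g \<bullet> ((x + y) - x)) *\<^sub>R bump_grad n y)"
    unfolding mollified_localize(2)[OF n B2 c] mollified_grad_affine[OF n B, of "f x" g, symmetric] aff by simp
  also have "\<dots> = - integral ?Q (\<lambda>y. (f (x + y) - f x - g \<bullet> y) *\<^sub>R bump_grad n y)"
  proof -
    have "integral ?Q (\<lambda>y. f (x + y) *\<^sub>R bump_grad n y) - integral ?Q (\<lambda>y. (f x + g \<bullet> y) *\<^sub>R bump_grad n y)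
      = integral ?Q (\<lambda>y. f (x + y) *\<^sub>R bump_grad n y - (f x + g \<bullet> y) *\<^sub>R bump_grad n y)"
      by (intro integral_diff[symmetric] ib cf continuous_intros)
    moreover have "(\<lambda>y. f (x + y) *\<^sub>R bump_grad n y - (f x + g \<bullet> y) *\<^sub>R bump_grad n y) =
        (\<lambda>y. (f (x + y) - f x - g \<bullet> y) *\<^sub>R bump_grad n y)"
      by (simp add: fun_eq_iff algebra_simps)
    moreover have "- I + J = - (I - J)" for I J :: "real^2" by simp
    ultimately show ?thesis by (simp only: add_diff_cancel_left')
  qed
  finally have eq: "norm (mollified_grad (cbox a b) n f x - bump_mass n *\<^sub>R g) =
      norm (integral ?Q (\<lambda>y. (f (x + y) - f x - g \<bullet> y) *\<^sub>R bump_grad n y))" by simp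
  have "\<dots> \<le> integral ?Q (\<lambda>y. e / n * (4 * n))"
  proof (rule integral_norm_bound_integral)
    show "(\<lambda>y. (f (x + y) - f x - g \<bullet> y) *\<^sub>R bump_grad n y) integrable_on ?Q"
      by (intro ib continuous_intros cf)
    show "(\<lambda>y. e / n * (4 * n)) integrable_on ?Q" unfolding square_def by (rule integrable_const)
    fix y assume y: "y \<in> ?Q"
    have "norm ((f (x + y) - f x - g \<bullet> y) *\<^sub>R bump_grad n y) = \<bar>f (x + y) - f x - g \<bullet> y\<bar> * norm (bump_grad n y)"
      by simp
    also have "\<dots> \<le> e / n * (4 * n)"
      using e[OF shifted_square_subset(2)[OF B2 y]] norm_bump_grad_le[OF n, of y] by (intro mult_mono) auto
    finally show "norm ((f (x + y) - f x - g \<bullet> y) *\<^sub>R bump_grad n y) \<le> e / n * (4 * n)" .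
  qed
  also have "\<dots> = 16 * e / n\<^sup>2"
    using content_square[of "1 / n"] n by (simp add: square_def power2_eq_square)
  also have "\<dots> = 128 * e * (1 / (8 * n\<^sup>2))" by simp
  also have "\<dots> \<le> 128 * e * bump_mass n"
  proof (rule mult_left_mono[OF bump_mass_ge[OF n]])
    have "0 \<le> e / n" using e[of 0] n by simp
    then show "0 \<le> 128 * e" using n by (simp add: zero_le_divide_iff)
  qed
  finally have le: "norm (mollified_grad (cbox a b) n f x - bump_mass n *\<^sub>R g) \<le> 128 * e * bump_mass n" unfolding eq .
  have "mollified_grad (cbox a b) n f x /\<^sub>R bump_mass n - g = (mollified_grad (cbox a b) n f x - bump_mass n *\<^sub>R g) /\<^sub>R bump_mass n"
    using bump_mass_pos[OF n] by (simp add: scaleR_diff_right)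
  also have "norm \<dots> \<le> 128 * e"
    using le bump_mass_pos[OF n] by (simp add: divide_inverse_commute[symmetric] pos_divide_le_eq)
  finally show ?thesis .
qed

text \<open>The primitive is the line integral along rays from the center. Differentiating under the integral
and using the symmetry \<open>\<partial>\<^sub>2 V\<^sub>1 = \<partial>\<^sub>1 V\<^sub>2\<close>, the integrand becomes the derivative of \<open>t V(p + t (x - p))\<close>
with respect to \<open>t\<close>.\<close>

lemma Poincare_ball:
  fixes V1 V2 :: "real^2 \<Rightarrow> real" and G1 G2 :: "real^2 \<Rightarrow> real^2"
  assumes d: "\<And>x. x \<in> ball p r \<Longrightarrow> GDERIV V1 x :> G1 x" "\<And>x. x \<in> ball p r \<Longrightarrow> GDERIV V2 x :> G2 x"
    and c: "continuous_on (ball p r) G1" "continuous_on (ball p r) G2"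
    and closed: "\<And>x. x \<in> ball p r \<Longrightarrow> G1 x $ 2 = G2 x $ 1"
  shows "\<exists>u. u p = 0 \<and> (\<forall>x\<in>ball p r. GDERIV u x :> vector [V1 x, V2 x])"
proof -
  define V where "V x = (vector [V1 x, V2 x] :: real^2)" for x
  define \<gamma> where "\<gamma> x t = p + t *\<^sub>R (x - p)" for x t
  define u where "u x = integral (cbox 0 1) (\<lambda>t. V1 (\<gamma> x t) * (x - p) $ 1 + V2 (\<gamma> x t) * (x - p) $ 2)" for x
  have "u p = 0" by (simp add: u_def)
  have in_ball: "\<gamma> x t \<in> ball p r" if "x \<in> ball p r" "t \<in> cbox 0 1" for x t
  proof -
    have "norm (t *\<^sub>R (x - p)) \<le> norm (x - p)" using that(2) by (auto simp: mult_left_le_one_le)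
    then show ?thesis using that(1) by (auto simp: \<gamma>_def dist_norm norm_minus_commute)
  qed
  have cV: "continuous_on (ball p r) V1" "continuous_on (ball p r) V2"
    using d unfolding gderiv_def
    by (auto intro!: continuous_at_imp_continuous_on has_derivative_continuous)
  have "GDERIV u x :> vector [V1 x, V2 x]" if x: "x \<in> ball p r" for x
  proof -
    define g where "g x t = t *\<^sub>R ((x - p) $ 1 *\<^sub>R G1 (\<gamma> x t) + (x - p) $ 2 *\<^sub>R G2 (\<gamma> x t)) + V (\<gamma> x t)" for x t
    have cg: "continuous_on (ball p r \<times> cbox 0 1) (\<lambda>(x, t). g x t)"
    proof -
      have c\<gamma>: "continuous_on (ball p r \<times> cbox 0 1) (\<lambda>z. \<gamma> (fst z) (snd z))"
        unfolding \<gamma>_def by (intro continuous_intros)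
      have comp: "continuous_on (ball p r \<times> cbox 0 1) (\<lambda>z. h (\<gamma> (fst z) (snd z)))" if "continuous_on (ball p r) h"
        for h :: "real^2 \<Rightarrow> 'z::topological_space"
        by (rule continuous_on_compose2[OF that c\<gamma>]) (use in_ball in auto)
      have "V = (\<lambda>x. V1 x *\<^sub>R axis 1 1 + V2 x *\<^sub>R axis 2 1)"
        by (auto simp: V_def vec_eq_iff forall_2 axis_def)
      then have "continuous_on (ball p r) V" using cV by (auto intro!: continuous_intros)
      then show ?thesis unfolding g_def split_beta
        by (intro continuous_intros comp c)
    qed
    have ig: "g x integrable_on cbox 0 1"
    proof (rule integrable_continuous)
      have "continuous_on (cbox 0 1) (\<lambda>t. (\<lambda>(x, t). g x t) (x, t))"
        by (rule continuous_on_compose2[OF cg]) (use x in \<open>auto intro!: continuous_intros\<close>)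
      then show "continuous_on (cbox 0 1) (g x)" by simp
    qed
    have "(u has_derivative blinfun_apply (integral (cbox 0 1) (\<lambda>t. blinfun_inner_left (g x t)))) (at x within ball p r)"
      unfolding u_def[abs_def]
    proof (rule leibniz_rule)
      fix x t assume xt: "x \<in> ball p r" "t \<in> cbox (0::real) 1"
      have l: "((\<lambda>x. \<gamma> x t) has_derivative (\<lambda>h. t *\<^sub>R h)) (at x)"
        unfolding \<gamma>_def by (auto intro!: derivative_eq_intros)
      have d1: "((\<lambda>x. V1 (\<gamma> x t)) has_derivative (\<lambda>h. (t *\<^sub>R h) \<bullet> G1 (\<gamma> x t))) (at x)"
        using has_derivative_compose[OF l d(1)[OF in_ball[OF xt], unfolded gderiv_def]] .
      have d2: "((\<lambda>x. V2 (\<gamma> x t)) has_derivative (\<lambda>h. (t *\<^sub>R h) \<bullet> G2 (\<gamma> x t))) (at x)"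
        using has_derivative_compose[OF l d(2)[OF in_ball[OF xt], unfolded gderiv_def]] .
      have comp: "((\<lambda>x. (x - p) $ i) has_derivative (\<lambda>h. h $ i)) (at x)" for i
      proof -
        have "((\<lambda>x. x - p) has_derivative (\<lambda>h. h)) (at x)" by (auto intro!: derivative_eq_intros)
        from bounded_linear.has_derivative[OF bounded_linear_vec_nth this] show ?thesis .
      qed
      have "((\<lambda>x. V1 (\<gamma> x t) * (x - p) $ 1 + V2 (\<gamma> x t) * (x - p) $ 2) has_derivative
         (\<lambda>h. h \<bullet> g x t)) (at x)"
        by (rule has_derivative_eq_rhs[OF has_derivative_add[OF has_derivative_mult[OF d1 comp] has_derivative_mult[OF d2 comp]]])
           (auto simp: fun_eq_iff g_def V_def inner_vec_def sum_2 algebra_simps)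
      then show "((\<lambda>x. V1 (\<gamma> x t) * (x - p) $ 1 + V2 (\<gamma> x t) * (x - p) $ 2) has_derivative
          blinfun_apply (blinfun_inner_left (g x t))) (at x within ball p r)"
        by (simp add: has_derivative_at_withinI)
    next
      fix x assume x: "x \<in> ball p r"
      have "continuous_on (cbox 0 1) (\<lambda>t. \<gamma> x t)" unfolding \<gamma>_def by (intro continuous_intros)
      then show "(\<lambda>t. V1 (\<gamma> x t) * (x - p) $ 1 + V2 (\<gamma> x t) * (x - p) $ 2) integrable_on cbox 0 1"
        by (intro integrable_continuous continuous_intros continuous_on_compose2[OF cV(1)] continuous_on_compose2[OF cV(2)])
           (use in_ball[OF x] in auto)
    next
      show "continuous_on (ball p r \<times> cbox 0 1) (\<lambda>(x, t). blinfun_inner_left (g x t))"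
        using bounded_linear.continuous_on[OF bounded_linear_blinfun_inner_left cg] by (simp add: split_beta)
    qed (use x in auto)
    moreover have "integral (cbox 0 1) (\<lambda>t. blinfun_inner_left (g x t)) = blinfun_inner_left (integral (cbox 0 1) (g x))"
      using integral_linear[OF ig bounded_linear_blinfun_inner_left] by (simp add: o_def)
    moreover have "integral (cbox 0 1) (g x) = V x"
    proof -
      have "(g x has_integral (1 *\<^sub>R V (\<gamma> x 1) - 0 *\<^sub>R V (\<gamma> x 0))) {0..1}"
      proof (rule fundamental_theorem_of_calculus)
        fix t :: real assume t: "t \<in> {0..1}"
        have xt: "\<gamma> x t \<in> ball p r" using in_ball[OF x] t by auto
        have l: "((\<lambda>t. \<gamma> x t) has_derivative (\<lambda>h. h *\<^sub>R (x - p))) (at t within {0..1})"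
          unfolding \<gamma>_def by (auto intro!: derivative_eq_intros)
        have d1: "((\<lambda>t. V1 (\<gamma> x t)) has_derivative (\<lambda>h. (h *\<^sub>R (x - p)) \<bullet> G1 (\<gamma> x t))) (at t within {0..1})"
          using has_derivative_compose[OF l d(1)[OF xt, unfolded gderiv_def]] .
        have d2: "((\<lambda>t. V2 (\<gamma> x t)) has_derivative (\<lambda>h. (h *\<^sub>R (x - p)) \<bullet> G2 (\<gamma> x t))) (at t within {0..1})"
          using has_derivative_compose[OF l d(2)[OF xt, unfolded gderiv_def]] .
        have "V = (\<lambda>x. V1 x *\<^sub>R axis 1 1 + V2 x *\<^sub>R axis 2 1)"
          by (auto simp: V_def vec_eq_iff forall_2 axis_def)
        then have eq: "(\<lambda>t. t *\<^sub>R V (\<gamma> x t)) = (\<lambda>t. t *\<^sub>R (V1 (\<gamma> x t) *\<^sub>R axis 1 1 + V2 (\<gamma> x t) *\<^sub>R axis 2 1))"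
          by simp
        show "((\<lambda>t. t *\<^sub>R V (\<gamma> x t)) has_vector_derivative g x t) (at t within {0..1})"
          unfolding has_vector_derivative_def eq
          by (rule has_derivative_eq_rhs, (rule derivative_intros d1 d2)+)
             (use closed[OF xt] in \<open>auto simp: fun_eq_iff g_def V_def vec_eq_iff forall_2 axis_def inner_vec_def sum_2 algebra_simps\<close>)
      qed simp
      from integral_unique[OF this] show ?thesis by (simp add: \<gamma>_def)
    qed
    ultimately have "(u has_derivative (\<lambda>h. h \<bullet> V x)) (at x within ball p r)" by simp
    then show ?thesis
      unfolding gderiv_def V_def using x at_within_open[OF x open_ball] by simp
  qed
  then show ?thesis using \<open>u p = 0\<close> by blast
qed

lemma borel_measurable_lebesgue_continuous:
  fixes f :: "real^2 \<Rightarrow> 'b::euclidean_space"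
  assumes "continuous_on D f" "open D"
  shows "(\<lambda>x. indicator D x *\<^sub>R f x) \<in> borel_measurable lebesgue"
proof -
  have "(\<lambda>x. indicator D x *\<^sub>R f x) \<in> borel_measurable borel"
    using assms by (intro borel_measurable_continuous_on_indicator) auto
  then show ?thesis by (intro measurable_completion) simp
qed

lemma GDERIV_zero_off_closed:
  assumes "closed C" "x \<notin> C" "\<And>y. y \<notin> C \<Longrightarrow> \<phi> y = 0"
  shows "GDERIV \<phi> x :> 0"
proof -
  have "((\<lambda>_. 0::real) has_derivative (\<lambda>h. h \<bullet> 0)) (at x)" by simp
  then have "(\<phi> has_derivative (\<lambda>h. h \<bullet> 0)) (at x)"
    by (rule has_derivative_transform_within_open[of _ _ _ _ "- C"]) (use assms in auto)
  then show ?thesis unfolding gderiv_def .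
qed

text \<open>The product rule \<open>div (e\<^sup>-\<^sup>w X) = e\<^sup>-\<^sup>w (div X - X \<bullet> \<nabla>w) = 0\<close>. The function \<open>e\<^sup>-\<^sup>w \<phi>\<close> is only Lipschitz and hence
not admissible as a test function, so \<open>w\<close> is first replaced by its mollifications \<open>w\<^sub>k\<close>. Their
gradients are bounded and converge to \<open>\<nabla>w\<close> almost everywhere, so that dominated convergence applies.\<close>

lemma weak_divergence_weighted:
  fixes w :: "real^2 \<Rightarrow> real"
  assumes D: "open D" and Xc: "continuous_on D X" and Xn: "\<And>x. x \<in> D \<Longrightarrow> norm (X x) \<le> 1"
    and B: "cbox a b \<subseteq> D" and Lip: "L-lipschitz_on (cbox a b) w"
    and ae: "AE x in lebesgue. x \<in> D \<longrightarrow> w differentiable (at x) \<and> X x \<bullet> grad w x = norm (grad w x)"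
    and weak: "weak_divergence_eq D X (\<lambda>x. norm (grad w x))"
    and \<phi>: "C1_on UNIV \<phi>" and C: "compact C" "0 < \<rho>" "\<And>x. x \<in> C \<Longrightarrow> cball x \<rho> \<subseteq> cbox a b"
    and z: "\<And>x. x \<notin> C \<Longrightarrow> \<phi> x = 0"
  shows "integral (cbox a b) (\<lambda>x. (exp (- w x) *\<^sub>R X x) \<bullet> grad \<phi> x) = 0"
proof -
  \<comment> \<open>Kernel radii \<open>1/n k\<close> that tend to 0 and respect the margin \<open>\<rho>\<close> around the support of \<open>\<phi>\<close>.\<close>
  define n where "n k = real (Suc k) + 3 / \<rho>" for k
  have n1: "1 \<le> n k" for k using C(2) by (simp add: n_def)
  have npos: "0 < n k" for k using n1[of k] by linarith
  have n3: "3 / n k \<le> \<rho>" for k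
  proof -
    have "3 / \<rho> \<le> n k" by (simp add: n_def)
    then show ?thesis using C(2) npos[of k] by (simp add: field_simps)
  qed
  have ninf: "(\<lambda>k. 1 / n k) \<longlonglongrightarrow> 0"
  proof (rule tendsto_sandwich[OF _ _ tendsto_const LIMSEQ_inverse_real_of_nat])
    show "\<forall>\<^sub>F k in sequentially. 0 \<le> 1 / n k" using less_imp_le[OF npos] by (intro always_eventually allI) simp
    have "real (Suc k) \<le> n k" for k using C(2) by (simp add: n_def)
    then show "\<forall>\<^sub>F k in sequentially. 1 / n k \<le> inverse (real (Suc k))"
      by (intro always_eventually allI) (simp only: inverse_eq_divide, intro divide_left_mono, auto intro!: mult_pos_pos npos)
  qed
  have CB: "C \<subseteq> cbox a b" using C(2,3) by force
  have wc: "continuous_on (cbox a b) w" using Lip by (rule lipschitz_on_continuous_on)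
  have L0: "0 \<le> L" using Lip by (rule lipschitz_on_nonneg)
  define wk where "wk k x = mollified (cbox a b) (n k) w x / bump_mass (n k)" for k x
  define g where "g k x = mollified_grad (cbox a b) (n k) w x /\<^sub>R bump_mass (n k)" for k x
  have wk': "GDERIV (wk k) x :> g k x" for k x
  proof -
    have h: "(mollified (cbox a b) (n k) w has_derivative (\<lambda>h. h \<bullet> mollified_grad (cbox a b) (n k) w x)) (at x)"
      using GDERIV_mollified[OF wc] unfolding gderiv_def .
    show ?thesis unfolding gderiv_def wk_def g_def
      by (rule has_derivative_eq_rhs[OF bounded_linear.has_derivative[OF bounded_linear_divide h]])
         (auto simp: divide_inverse_commute mult.commute)
  qed
  have gc: "continuous_on UNIV (g k)" for k
    unfolding g_def by (intro continuous_intros continuous_on_mollified_grad wc)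
  have wkc: "continuous_on UNIV (wk k)" for k
    using wk' unfolding gderiv_def by (intro continuous_at_imp_continuous_on ballI has_derivative_continuous) auto
  have nb: "cball x (3 / n k) \<subseteq> cbox a b" "cball x (2 / n k) \<subseteq> cbox a b" if "x \<in> C" for x k
  proof -
    have "2 / n k \<le> 3 / n k" using npos[of k] by (simp add: divide_right_mono)
    then show "cball x (3 / n k) \<subseteq> cbox a b" "cball x (2 / n k) \<subseteq> cbox a b"
      using C(3)[OF that] n3[of k] subset_cball[of "3 / n k" \<rho> x] subset_cball[of "2 / n k" \<rho> x] by auto
  qed
  have lip: "\<bar>w (x + y) - w x\<bar> \<le> 2 * L / n k" if "x \<in> C" "norm y \<le> 2 / n k" for x y k
  proof -
    have "x + y \<in> cbox a b" using nb(2)[OF that(1), of k] that(2) by (auto simp: dist_norm)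
    then have "dist (w (x + y)) (w x) \<le> L * dist (x + y) x"
      using lipschitz_onD[OF Lip] CB that(1) by blast
    also have "\<dots> \<le> L * (2 / n k)" using that(2) L0 by (intro mult_left_mono) (auto simp: dist_norm)
    finally show ?thesis by (simp add: dist_real_def mult.commute)
  qed
  have wk_near: "\<bar>wk k x - w x\<bar> \<le> 2 * L / n k" if "x \<in> C" for x k
    unfolding wk_def by (rule mollified_approx[OF npos nb(2)[OF that] wc lip[OF that]])
  have g_bound: "norm (g k x) \<le> 256 * L" if "x \<in> C" for x k
    using mollified_grad_approx[OF npos nb(1)[OF that] wc, of k 0 "2 * L"] lip[OF that] by (simp add: g_def)
  have g_lim: "(\<lambda>k. g k x) \<longlonglongrightarrow> grad w x" if x: "x \<in> C" and dw: "w differentiable (at x)" for x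
  proof (rule LIMSEQ_I)
    fix r :: real assume r: "0 < r"
    define e where "e = r / 512"
    have e: "0 < e" using r by (simp add: e_def)
    have "(w has_derivative (\<lambda>h. h \<bullet> grad w x)) (at x)"
      using differentiable_imp_GDERIV_grad[OF dw] unfolding gderiv_def .
    then obtain d where d: "0 < d" "\<And>y. norm (y - x) < d \<Longrightarrow>
        norm (w y - w x - (y - x) \<bullet> grad w x) \<le> e * norm (y - x)"
      using e unfolding has_derivative_at_alt by blast
    have "\<forall>\<^sub>F k in sequentially. 1 / n k < d / 2" using ninf d(1) by (intro order_tendstoD(2)) auto
    then obtain k0 where k0: "\<And>k. k \<ge> k0 \<Longrightarrow> 1 / n k < d / 2" unfolding eventually_sequentially by blast
    show "\<exists>no. \<forall>k\<ge>no. norm (g k x - grad w x) < r"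
    proof (intro exI[of _ k0] allI impI)
      fix k assume "k \<ge> k0"
      then have kd: "2 / n k < d" using k0[of k] by simp
      have "norm (g k x - grad w x) \<le> 128 * (2 * e)"
        unfolding g_def
      proof (rule mollified_grad_approx[OF npos nb(1)[OF x] wc])
        fix y :: "real^2" assume y: "norm y \<le> 2 / n k"
        have "\<bar>w (x + y) - w x - y \<bullet> grad w x\<bar> \<le> e * norm y"
          using d(2)[of "x + y"] y kd by simp
        also have "\<dots> \<le> e * (2 / n k)" using y e by (intro mult_left_mono) auto
        finally show "\<bar>w (x + y) - w x - grad w x \<bullet> y\<bar> \<le> 2 * e / n k"
          by (simp add: inner_commute mult.commute)
      qed
      then show "norm (g k x - grad w x) < r" using r by (simp add: e_def)
    qed
  qed
  have w_lim: "(\<lambda>k. wk k x) \<longlonglongrightarrow> w x" if "x \<in> C" for x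
  proof (rule LIM_zero_cancel, rule Lim_null_comparison)
    show "\<forall>\<^sub>F k in sequentially. norm (wk k x - w x) \<le> 2 * L * (1 / n k)"
      using wk_near[OF that] by simp
    show "(\<lambda>k. 2 * L * (1 / n k)) \<longlonglongrightarrow> 0" using tendsto_mult_left[OF ninf, of "2 * L"] by simp
  qed
  have gr\<phi>: "GDERIV \<phi> x :> grad \<phi> x" for x
    using \<phi> differentiable_imp_GDERIV_grad by (auto simp: C1_on_def)
  have gr\<phi>c: "continuous_on UNIV (grad \<phi>)" using \<phi> by (simp add: C1_on_def)
  have \<phi>c: "continuous_on UNIV \<phi>"
    using gr\<phi> unfolding gderiv_def by (intro continuous_at_imp_continuous_on ballI has_derivative_continuous) auto
  have Ccl: "closed C" using C(1) by (rule compact_imp_closed)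
  have gz: "grad \<phi> x = 0" if "x \<notin> C" for x
    by (rule grad_eqI[OF GDERIV_zero_off_closed[of C x \<phi>, OF Ccl that z]])
  obtain W where W: "\<And>x. x \<in> C \<Longrightarrow> \<bar>w x\<bar> \<le> W"
    using compact_imp_bounded[OF compact_continuous_image[OF continuous_on_subset[OF wc CB] C(1)]]
    unfolding bounded_iff by auto
  obtain P1 where P1: "\<And>x. x \<in> C \<Longrightarrow> \<bar>\<phi> x\<bar> \<le> P1"
    using compact_imp_bounded[OF compact_continuous_image[OF continuous_on_subset[OF \<phi>c] C(1)]]
    unfolding bounded_iff by auto
  obtain P2 where P2: "\<And>x. x \<in> C \<Longrightarrow> norm (grad \<phi> x) \<le> P2"
    using compact_imp_bounded[OF compact_continuous_image[OF continuous_on_subset[OF gr\<phi>c] C(1)]]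
    unfolding bounded_iff by auto
  define E where "E = exp (W + 2 * L)"
  have E: "exp (- wk k x) \<le> E" if "x \<in> C" for k x
  proof -
    have "2 * L / n k \<le> 2 * L" using L0 n1[of k] npos[of k] by (simp add: pos_divide_le_eq mult_le_cancel_left1)
    then show ?thesis unfolding E_def using wk_near[OF that, of k] W[OF that] by simp
  qed
  define \<psi> where "\<psi> k x = exp (- wk k x) * \<phi> x" for k x
  define G where "G k x = exp (- wk k x) *\<^sub>R (grad \<phi> x - \<phi> x *\<^sub>R g k x)" for k x
  have \<psi>': "GDERIV (\<psi> k) x :> G k x" for k x
  proof -
    have "((\<lambda>t. exp (- t)) has_real_derivative - exp (- wk k x)) (at (wk k x))"
      by (auto intro!: derivative_eq_intros)
    from GDERIV_mult[OF GDERIV_DERIV_compose[OF wk' this] gr\<phi>] show ?thesis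
      unfolding \<psi>_def G_def by (rule GDERIV_subst) (simp add: algebra_simps)
  qed
  have Gc: "continuous_on UNIV (G k)" for k
    unfolding G_def by (intro continuous_intros wkc gr\<phi>c \<phi>c gc)
  have grad\<psi>: "grad (\<psi> k) = G k" for k using grad_eqI[OF \<psi>'] by (intro ext)
  have C1\<psi>: "C1_on UNIV (\<psi> k)" for k
    unfolding C1_on_def grad\<psi> using \<psi>' GDERIV_imp_differentiable Gc by blast
  have supp: "closure {x. \<psi> k x \<noteq> 0} \<subseteq> C" for k
    by (rule closure_minimal[OF _ Ccl]) (use z in \<open>auto simp: \<psi>_def\<close>)
  define A where "A k x = indicator D x *\<^sub>R (X x \<bullet> G k x)" for k x
  define R where "R k x = indicator D x *\<^sub>R (norm (grad w x) * \<psi> k x)" for k x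
  have "compact (closure {x. \<psi> k x \<noteq> 0})" for k
    using compact_Int_closed[OF C(1) closed_closure] supp by (metis Int_absorb1)
  then have weak_k: "integral\<^sup>L lebesgue (A k) = - integral\<^sup>L lebesgue (R k)" for k
    using weak[unfolded weak_divergence_eq_def, rule_format, of "\<psi> k"] C1\<psi>[of k] supp[of k] CB B
    unfolding grad\<psi> set_lebesgue_integral_def A_def[symmetric] R_def[symmetric] by auto
  have aeD: "AE x in lebesgue. x \<in> C \<longrightarrow> w differentiable (at x) \<and> X x \<bullet> grad w x = norm (grad w x)"
    using ae by eventually_elim (use CB B in auto)
  \<comment> \<open>The gradient of \<open>w\<close> is measurable as an almost everywhere limit of continuous functions.\<close>
  have h_meas: "(\<lambda>x. indicator C x *\<^sub>R norm (grad w x)) \<in> borel_measurable lebesgue"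
  proof (rule borel_measurable_AE)
    have "(\<lambda>x. indicator C x *\<^sub>R norm (g k x)) \<in> borel_measurable lebesgue" for k
    proof -
      have "(\<lambda>x. indicator C x *\<^sub>R norm (g k x)) \<in> borel_measurable borel"
        using Ccl by (intro borel_measurable_continuous_on_indicator continuous_intros continuous_on_subset[OF gc]) auto
      then show ?thesis by (intro measurable_completion) simp
    qed
    then show "(\<lambda>x. lim (\<lambda>k. indicator C x *\<^sub>R norm (g k x))) \<in> borel_measurable lebesgue"
      by (rule borel_measurable_lim_metric)
    show "AE x in lebesgue. lim (\<lambda>k. indicator C x *\<^sub>R norm (g k x)) = indicator C x *\<^sub>R norm (grad w x)"
      using aeD
    proof eventually_elim
      case (elim x)
      show ?case
      proof (cases "x \<in> C")
        case True
        then have "(\<lambda>k. indicator C x *\<^sub>R norm (g k x)) \<longlonglongrightarrow> indicator C x *\<^sub>R norm (grad w x)"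
          using elim by (intro tendsto_intros g_lim) auto
        then show ?thesis by (rule limI)
      qed simp
    qed
  qed
  have A_meas: "A k \<in> borel_measurable lebesgue" for k
    unfolding A_def
    by (intro borel_measurable_lebesgue_continuous D continuous_intros Xc continuous_on_subset[OF Gc]) auto
  have \<psi>_meas: "\<psi> k \<in> borel_measurable lebesgue" for k
  proof -
    have "continuous_on UNIV (\<psi> k)" unfolding \<psi>_def by (intro continuous_intros wkc \<phi>c)
    then have "\<psi> k \<in> borel_measurable borel" by (rule borel_measurable_continuous_onI)
    then show ?thesis by (intro measurable_completion) simp
  qed
  have R_eq: "R k = (\<lambda>x. (indicator C x *\<^sub>R norm (grad w x)) * \<psi> k x)" for k
  proof
    fix x show "R k x = (indicator C x *\<^sub>R norm (grad w x)) * \<psi> k x"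
      using z[of x] CB B by (cases "x \<in> C") (auto simp: R_def \<psi>_def)
  qed
  have R_meas: "R k \<in> borel_measurable lebesgue" for k
    unfolding R_eq by (intro borel_measurable_times h_meas \<psi>_meas)
  define M where "M = E * (P2 + P1 * (256 * L)) + 256 * L * (E * P1)"
  define F where "F x = indicator D x *\<^sub>R ((exp (- w x) *\<^sub>R X x) \<bullet> grad \<phi> x)" for x
  have E0: "0 \<le> E" by (simp add: E_def)
  have A_bound: "\<bar>A k x\<bar> \<le> indicator C x * (E * (P2 + P1 * (256 * L)))" for k x
  proof (cases "x \<in> C")
    case True
    then have xD: "x \<in> D" using CB B by auto
    have "norm (grad \<phi> x - \<phi> x *\<^sub>R g k x) \<le> P2 + P1 * (256 * L)"
    proof -
      have "norm (grad \<phi> x - \<phi> x *\<^sub>R g k x) \<le> norm (grad \<phi> x) + \<bar>\<phi> x\<bar> * norm (g k x)"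
        by (metis norm_scaleR norm_triangle_ineq4)
      also have "\<dots> \<le> P2 + P1 * (256 * L)"
        using P1[OF True] P2[OF True] g_bound[OF True] by (intro add_mono mult_mono) auto
      finally show ?thesis .
    qed
    then have "norm (G k x) \<le> E * (P2 + P1 * (256 * L))"
      unfolding G_def norm_scaleR using E[OF True, of k] E0 by (intro mult_mono) auto
    moreover have "\<bar>X x \<bullet> G k x\<bar> \<le> 1 * norm (G k x)"
      using Cauchy_Schwarz_ineq2[of "X x" "G k x"] Xn[OF xD] mult_right_mono[of "norm (X x)" 1 "norm (G k x)"] by auto
    ultimately show ?thesis using True xD by (simp add: A_def)
  qed (simp add: A_def G_def gz z)
  have R_bound: "AE x in lebesgue. \<bar>R k x\<bar> \<le> indicator C x * (256 * L * (E * P1))" for k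
    using aeD
  proof eventually_elim
    case (elim x)
    show ?case
    proof (cases "x \<in> C")
      case True
      have "(\<lambda>k. norm (g k x)) \<longlonglongrightarrow> norm (grad w x)" using g_lim True elim by (intro tendsto_norm) auto
      then have "norm (grad w x) \<le> 256 * L"
        using g_bound[OF True] by (intro LIMSEQ_le_const2) auto
      moreover have "\<bar>\<psi> k x\<bar> \<le> E * P1"
        unfolding \<psi>_def abs_mult using E[OF True, of k] P1[OF True] E0 by (intro mult_mono) auto
      ultimately have "norm (grad w x) * \<bar>\<psi> k x\<bar> \<le> 256 * L * (E * P1)" using L0 by (intro mult_mono) auto
      then show ?thesis unfolding R_eq using True by (simp add: abs_mult)
    qed (simp add: R_eq)
  qed
  have Cint: "integrable lebesgue (\<lambda>x. indicator C x * K)" for K :: real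
  proof -
    have "C \<in> sets lebesgue" using Ccl by auto
    moreover have "emeasure lebesgue C < \<infinity>"
      using emeasure_compact_finite[OF C(1)] Ccl by simp
    ultimately have "integrable lebesgue (indicator C :: _ \<Rightarrow> real)" by (rule integrable_real_indicator)
    then show ?thesis by (rule integrable_mult_left)
  qed
  have A_int: "integrable lebesgue (A k)" for k
    by (rule Bochner_Integration.integrable_bound[OF Cint A_meas]) (use A_bound[of k] in \<open>auto intro!: AE_I2 order_trans[OF _ abs_ge_self]\<close>)
  have R_int: "integrable lebesgue (R k)" for k
  proof (rule Bochner_Integration.integrable_bound[OF Cint R_meas])
    show "AE x in lebesgue. norm (R k x) \<le> norm (indicator C x * (256 * L * (E * P1)))"
      using R_bound[of k] by eventually_elim auto
  qed
  have S0: "integral\<^sup>L lebesgue (\<lambda>x. A k x + R k x) = 0" for k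
    using weak_k[of k] A_int R_int by simp
  have F_meas: "F \<in> borel_measurable lebesgue"
  proof -
    have "F = (\<lambda>x. indicator (interior (cbox a b)) x *\<^sub>R ((exp (- w x) *\<^sub>R X x) \<bullet> grad \<phi> x))"
    proof
      fix x
      show "F x = indicator (interior (cbox a b)) x *\<^sub>R ((exp (- w x) *\<^sub>R X x) \<bullet> grad \<phi> x)"
      proof (cases "x \<in> C")
        case True
        then have "ball x \<rho> \<subseteq> cbox a b" using C(3) ball_subset_cball by blast
        then have "x \<in> interior (cbox a b)" using C(2) by (meson centre_in_ball interior_maximal open_ball subsetD)
        then show ?thesis using True CB B by (auto simp: F_def)
      qed (simp add: F_def gz)
    qed
    moreover have "continuous_on (interior (cbox a b)) (\<lambda>x. (exp (- w x) *\<^sub>R X x) \<bullet> grad \<phi> x)"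
      using interior_subset[of "cbox a b"] B
      by (intro continuous_intros continuous_on_subset[OF wc] continuous_on_subset[OF Xc] continuous_on_subset[OF gr\<phi>c]) auto
    ultimately show ?thesis by (simp only: borel_measurable_lebesgue_continuous[OF _ open_interior])
  qed
  have "(\<lambda>k. integral\<^sup>L lebesgue (\<lambda>x. A k x + R k x)) \<longlonglongrightarrow> integral\<^sup>L lebesgue F"
  proof (rule integral_dominated_convergence[where w="\<lambda>x. indicator C x * M"])
    show "F \<in> borel_measurable lebesgue" by (rule F_meas)
    show "(\<lambda>x. A k x + R k x) \<in> borel_measurable lebesgue" for k
      by (intro borel_measurable_add A_meas R_meas)
    show "integrable lebesgue (\<lambda>x. indicator C x * M)" by (rule Cint)
    show "AE x in lebesgue. norm (A k x + R k x) \<le> indicator C x * M" for k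
      using R_bound[of k]
    proof eventually_elim
      case (elim x)
      have "indicator C x * M = indicator C x * (E * (P2 + P1 * (256 * L))) + indicator C x * (256 * L * (E * P1))"
        unfolding M_def by (rule distrib_left)
      then show ?case using A_bound[of k x] elim abs_triangle_ineq[of "A k x" "R k x"] unfolding real_norm_def by linarith
    qed
    show "AE x in lebesgue. (\<lambda>k. A k x + R k x) \<longlonglongrightarrow> F x"
      using aeD
    proof eventually_elim
      case (elim x)
      show ?case
      proof (cases "x \<in> C")
        case True
        then have xD: "indicator D x = (1::real)" using CB B by auto
        have "(\<lambda>k. A k x + R k x) \<longlonglongrightarrow> 1 *\<^sub>R (X x \<bullet> (exp (- w x) *\<^sub>R (grad \<phi> x - \<phi> x *\<^sub>R grad w x)))
            + 1 *\<^sub>R (norm (grad w x) * (exp (- w x) * \<phi> x))"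
          unfolding A_def R_def G_def \<psi>_def xD
          using elim True by (intro tendsto_intros w_lim g_lim) auto
        moreover have "1 *\<^sub>R (X x \<bullet> (exp (- w x) *\<^sub>R (grad \<phi> x - \<phi> x *\<^sub>R grad w x)))
            + 1 *\<^sub>R (norm (grad w x) * (exp (- w x) * \<phi> x)) = F x"
          using elim True by (simp add: F_def xD inner_diff_right algebra_simps)
        ultimately show ?thesis by simp
      qed (simp add: A_def R_eq F_def gz z G_def)
    qed
  qed
  then have "integral\<^sup>L lebesgue F = 0" unfolding S0 using LIMSEQ_unique tendsto_const by blast
  moreover have "F = (\<lambda>x. indicator (cbox a b) x *\<^sub>R ((exp (- w x) *\<^sub>R X x) \<bullet> grad \<phi> x))"
  proof
    fix x show "F x = indicator (cbox a b) x *\<^sub>R ((exp (- w x) *\<^sub>R X x) \<bullet> grad \<phi> x)"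
    proof (cases "x \<in> C")
      case True
      then have "x \<in> cbox a b" "x \<in> D" using CB B by blast+
      then show ?thesis by (simp add: F_def)
    qed (simp add: F_def gz)
  qed
  ultimately have zero: "(LINT x:cbox a b|lebesgue. (exp (- w x) *\<^sub>R X x) \<bullet> grad \<phi> x) = 0"
    unfolding set_lebesgue_integral_def by simp
  have "(\<lambda>x. (exp (- w x) *\<^sub>R X x) \<bullet> grad \<phi> x) absolutely_integrable_on cbox a b"
    using B by (intro absolutely_integrable_continuous continuous_intros wc continuous_on_subset[OF Xc] continuous_on_subset[OF gr\<phi>c]) auto
  from set_lebesgue_integral_eq_integral(2)[OF this] zero show ?thesis by (simp only:)
qed

text \<open>With the mollifying kernel as test function the hypothesis states that the mollifications of the
rotated field are curl free, so they have primitives on a disc; since the fields converge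
uniformly, the primitives converge to a primitive of the limit.\<close>

lemma locally_divergence_free_primitive:
  fixes F :: "real^2 \<Rightarrow> real^2"
  assumes r: "0 < r" and B: "cball p (4 * r) \<subseteq> cbox a b" and Fc: "continuous_on (cbox a b) F"
    and weak: "\<And>x n. x \<in> ball p r \<Longrightarrow> 1 / r \<le> n \<Longrightarrow> integral (cbox a b) (\<lambda>y. F y \<bullet> bump_grad n (y - x)) = 0"
  shows "has_local_primitive (\<lambda>x. perp (F x)) p"
proof -
  define V1 where "V1 x = - F x $ 2" for x
  define V2 where "V2 x = F x $ 1" for x
  have c1: "continuous_on (cbox a b) V1" unfolding V1_def by (intro continuous_intros Fc)
  have c2: "continuous_on (cbox a b) V2" unfolding V2_def by (intro continuous_intros Fc)
  define n where "n k = real (Suc k) + 2 / r" for k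
  have npos: "0 < n k" and nr: "1 / r \<le> n k" and n2: "2 / n k \<le> r" for k
  proof -
    have *: "0 < 2 / r" "1 / r \<le> 2 / r" using r by (auto simp: divide_right_mono)
    then show "0 < n k" "1 / r \<le> n k" by (auto simp: n_def intro: add_pos_pos)
    have "2 / r \<le> n k" by (simp add: n_def)
    then show "2 / n k \<le> r" using r \<open>0 < n k\<close> by (simp add: field_simps)
  qed
  have ninf: "(\<lambda>k. 2 / n k) \<longlonglongrightarrow> 0"
  proof (rule tendsto_sandwich[OF _ _ tendsto_const])
    show "\<forall>\<^sub>F k in sequentially. 0 \<le> 2 / n k" using less_imp_le[OF npos] by (intro always_eventually allI) simp
    have "real (Suc k) \<le> n k" for k using r by (simp add: n_def)
    then show "\<forall>\<^sub>F k in sequentially. 2 / n k \<le> 2 * inverse (real (Suc k))"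
      by (intro always_eventually allI) (simp only: divide_inverse, intro mult_left_mono le_imp_inverse_le, auto)
    show "(\<lambda>k. 2 * inverse (real (Suc k))) \<longlonglongrightarrow> 0"
      using tendsto_mult_left[OF LIMSEQ_inverse_real_of_nat, of 2] by simp
  qed
  have near: "cball x (2 / n k) \<subseteq> cbox a b" if "x \<in> ball p r" for x k
  proof
    fix y assume "y \<in> cball x (2 / n k)"
    then have "dist p y \<le> 4 * r" using that n2[of k] dist_triangle[of p y x] r by auto
    then show "y \<in> cbox a b" using B by auto
  qed
  define m where "m k f x = mollified (cbox a b) (n k) f x / bump_mass (n k)" for k f x
  define dm where "dm k f x = mollified_grad (cbox a b) (n k) f x /\<^sub>R bump_mass (n k)" for k f x
  have dm: "GDERIV (m k f) x :> dm k f x" if "continuous_on (cbox a b) f" for k f x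
  proof -
    have h: "(mollified (cbox a b) (n k) f has_derivative (\<lambda>h. h \<bullet> mollified_grad (cbox a b) (n k) f x)) (at x)"
      using GDERIV_mollified[OF that] unfolding gderiv_def .
    show ?thesis unfolding gderiv_def m_def dm_def
      by (rule has_derivative_eq_rhs[OF bounded_linear.has_derivative[OF bounded_linear_divide h]])
         (auto simp: divide_inverse_commute mult.commute)
  qed
  have "\<exists>u. u p = 0 \<and> (\<forall>x\<in>ball p r. GDERIV u x :> vector [m k V1 x, m k V2 x])" for k
  proof (rule Poincare_ball)
    show "GDERIV (m k V1) x :> dm k V1 x" "GDERIV (m k V2) x :> dm k V2 x" for x
      using dm c1 c2 by auto
    show "continuous_on (ball p r) (dm k V1)" "continuous_on (ball p r) (dm k V2)"
      unfolding dm_def by (intro continuous_intros continuous_on_subset[OF continuous_on_mollified_grad[OF c1]] continuous_on_subset[OF continuous_on_mollified_grad[OF c2]]; simp)+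
    fix x assume x: "x \<in> ball p r"
    have int: "(\<lambda>y. f y *\<^sub>R bump_grad (n k) (y - x)) integrable_on cbox a b" if "continuous_on (cbox a b) f" for f
      by (intro integrable_continuous continuous_intros that)
    have comp: "mollified_grad (cbox a b) (n k) f x $ i = - integral (cbox a b) (\<lambda>y. f y * bump_grad (n k) (y - x) $ i)"
      if "continuous_on (cbox a b) f" for f i
      using integral_linear[OF int[OF that] bounded_linear_vec_nth[of i]] by (simp add: mollified_grad_def o_def)
    have i1: "(\<lambda>y. F y $ 1 * bump_grad (n k) (y - x) $ 1) integrable_on cbox a b"
      and i2: "(\<lambda>y. F y $ 2 * bump_grad (n k) (y - x) $ 2) integrable_on cbox a b"
      by (intro integrable_continuous continuous_intros Fc)+
    have "integral (cbox a b) (\<lambda>y. F y $ 1 * bump_grad (n k) (y - x) $ 1) +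
        integral (cbox a b) (\<lambda>y. F y $ 2 * bump_grad (n k) (y - x) $ 2) = 0"
      using weak[OF x nr[of k]] by (simp add: inner_vec_def sum_2 integral_add[OF i1 i2])
    then have "mollified_grad (cbox a b) (n k) V1 x $ 2 = mollified_grad (cbox a b) (n k) V2 x $ 1"
      unfolding comp[OF c1] comp[OF c2] by (simp add: V1_def V2_def)
    then show "dm k V1 x $ 2 = dm k V2 x $ 1" by (simp add: dm_def)
  qed
  then obtain u where u: "\<And>k. u k p = 0" "\<And>k x. x \<in> ball p r \<Longrightarrow> GDERIV (u k) x :> vector [m k V1 x, m k V2 x]"
    by metis
  have "\<exists>v. \<forall>x\<in>ball p r. (\<lambda>k. u k x) \<longlonglongrightarrow> v x \<and> (v has_derivative (\<lambda>h. h \<bullet> perp (F x))) (at x within ball p r)"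
  proof (rule has_derivative_sequence)
    show "(u k has_derivative (\<lambda>h. h \<bullet> vector [m k V1 x, m k V2 x])) (at x within ball p r)" if "x \<in> ball p r" for k x
      using u(2)[OF that] unfolding gderiv_def by (rule has_derivative_at_withinI)
    show "p \<in> ball p r" using r by simp
    show "(\<lambda>k. u k p) \<longlonglongrightarrow> 0" by (simp add: u(1))
    fix e :: real assume e: "0 < e"
    have unif: "\<exists>d>0. \<forall>x\<in>cbox a b. \<forall>y\<in>cbox a b. dist x y < d \<longrightarrow> \<bar>f x - f y\<bar> < e / 2"
      if "continuous_on (cbox a b) f" for f :: "real^2 \<Rightarrow> real"
      using compact_uniformly_continuous[OF that compact_cbox] e
      unfolding uniformly_continuous_on_def dist_real_def by (metis dist_commute half_gt_zero)
    obtain d1 where d1: "0 < d1" "\<And>x y. x \<in> cbox a b \<Longrightarrow> y \<in> cbox a b \<Longrightarrow> dist x y < d1 \<Longrightarrow> \<bar>V1 x - V1 y\<bar> < e / 2"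
      using unif[OF c1] by blast
    obtain d2 where d2: "0 < d2" "\<And>x y. x \<in> cbox a b \<Longrightarrow> y \<in> cbox a b \<Longrightarrow> dist x y < d2 \<Longrightarrow> \<bar>V2 x - V2 y\<bar> < e / 2"
      using unif[OF c2] by blast
    have "\<forall>\<^sub>F k in sequentially. 2 / n k < min d1 d2" using ninf d1(1) d2(1) by (intro order_tendstoD(2)) auto
    then show "\<forall>\<^sub>F k in sequentially. \<forall>x\<in>ball p r. \<forall>h. norm (h \<bullet> vector [m k V1 x, m k V2 x] - h \<bullet> perp (F x)) \<le> e * norm h"
    proof eventually_elim
      case (elim k)
      show ?case
      proof (intro ballI allI)
        fix x h :: "real^2" assume x: "x \<in> ball p r"
        have xy: "x + y \<in> cbox a b \<and> x \<in> cbox a b \<and> dist (x + y) x < min d1 d2" if "norm y \<le> 2 / n k" for y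
        proof -
          have "x \<in> cball x (2 / n k)" using npos[of k] by simp
          moreover have "x + y \<in> cball x (2 / n k)" using that by (simp add: dist_norm)
          ultimately show ?thesis using near[OF x, of k] that elim by (auto simp: dist_norm)
        qed
        have 1: "\<bar>m k V1 x - V1 x\<bar> \<le> e / 2" unfolding m_def
          by (rule mollified_approx[OF npos near[OF x] c1]) (use xy d1(2) in \<open>meson less_imp_le min_less_iff_conj\<close>)
        have 2: "\<bar>m k V2 x - V2 x\<bar> \<le> e / 2" unfolding m_def
          by (rule mollified_approx[OF npos near[OF x] c2]) (use xy d2(2) in \<open>meson less_imp_le min_less_iff_conj\<close>)
        have "norm (vector [m k V1 x, m k V2 x] - perp (F x)) \<le> \<bar>m k V1 x - V1 x\<bar> + \<bar>m k V2 x - V2 x\<bar>"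
          using norm_le_sum2[of "vector [m k V1 x, m k V2 x] - perp (F x)"] by (simp add: perp_def V1_def V2_def)
        also have "\<dots> \<le> e" using 1 2 by simp
        finally have "norm h * norm (vector [m k V1 x, m k V2 x] - perp (F x)) \<le> norm h * e"
          by (intro mult_left_mono) auto
        then show "norm (h \<bullet> vector [m k V1 x, m k V2 x] - h \<bullet> perp (F x)) \<le> e * norm h"
          using Cauchy_Schwarz_ineq2[of h "vector [m k V1 x, m k V2 x] - perp (F x)"]
          by (simp add: inner_diff_right mult.commute)
      qed
    qed
  qed simp
  then obtain v where "\<And>x. x \<in> ball p r \<Longrightarrow> (v has_derivative (\<lambda>h. h \<bullet> perp (F x))) (at x within ball p r)" by blast
  then have "\<forall>x\<in>ball p r. GDERIV v x :> perp (F x)"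
    unfolding gderiv_def using at_within_open[OF _ open_ball] by metis
  then show ?thesis unfolding has_local_primitive_def by (intro exI[of _ r] conjI r exI[of _ v])
qed

lemma has_local_primitive_in_region:
  fixes w :: "real^2 \<Rightarrow> real"
  assumes D: "open D" and Xc: "continuous_on D X" and Xn: "\<And>x. x \<in> D \<Longrightarrow> norm (X x) \<le> 1"
    and Lip: "locally_Lipschitz_on D w"
    and ae: "AE x in lebesgue. x \<in> D \<longrightarrow> w differentiable (at x) \<and> X x \<bullet> grad w x = norm (grad w x)"
    and weak: "weak_divergence_eq D X (\<lambda>x. norm (grad w x))"
    and p: "p \<in> D"
  shows "has_local_primitive (\<lambda>x. perp (exp (- w x) *\<^sub>R X x)) p"
proof -
  obtain s L where s: "0 < s" "L-lipschitz_on (ball p s \<inter> D) w"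
    using Lip p unfolding locally_Lipschitz_on_def by blast
  obtain s' where s': "0 < s'" "ball p s' \<subseteq> D" using openE[OF D p] .
  define t where "t = min s s' / 3"
  have t: "0 < t" using s s' by (simp add: t_def)
  define a where "a = p - vector [t, t]" define b where "b = p + vector [t, t]"
  have mem: "y \<in> cbox a b \<longleftrightarrow> y - p \<in> square t" for y
    by (auto simp: a_def b_def mem_box_cart forall_2 mem_square abs_le_iff algebra_simps)
  have sub: "cbox a b \<subseteq> ball p s \<inter> D"
  proof
    fix y assume "y \<in> cbox a b"
    then have "norm (y - p) \<le> 2 * t" using mem square_norm by blast
    also have "\<dots> < min s s'"
    proof -
      have "0 < min s s'" using s s' by simp
      then show ?thesis unfolding t_def by linarith
    qed
    finally have "dist p y < s" "dist p y < s'" by (auto simp: dist_norm norm_minus_commute)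
    then show "y \<in> ball p s \<inter> D" using s'(2) by auto
  qed
  have LipB: "L-lipschitz_on (cbox a b) w" using lipschitz_on_subset[OF s(2) sub] .
  have cB: "cball p (4 * (t / 4)) \<subseteq> cbox a b"
    using norm_square[of _ t] mem by (auto simp: dist_norm norm_minus_commute)
  show ?thesis
  proof (rule locally_divergence_free_primitive[OF _ cB])
    show "0 < t / 4" using t by simp
    show "continuous_on (cbox a b) (\<lambda>x. exp (- w x) *\<^sub>R X x)"
      using sub by (intro continuous_intros lipschitz_on_continuous_on[OF LipB] continuous_on_subset[OF Xc]) auto
    fix x n assume x: "x \<in> ball p (t / 4)" and n: "1 / (t / 4) \<le> n"
    have n0: "0 < n" using n t by (smt (verit) divide_pos_pos)
    have n1: "1 / n \<le> t / 4" using n n0 t by (simp add: field_simps)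
    have g: "GDERIV (\<lambda>y. bump n (y - x)) y :> bump_grad n (y - x)" for y
      by (rule GDERIV_translate[OF GDERIV_bump])
    have gr: "grad (\<lambda>y. bump n (y - x)) = (\<lambda>y. bump_grad n (y - x))" using grad_eqI[OF g] by blast
    have "integral (cbox a b) (\<lambda>y. (exp (- w y) *\<^sub>R X y) \<bullet> grad (\<lambda>y. bump n (y - x)) y) = 0"
    proof (rule weak_divergence_weighted[OF D Xc Xn _ LipB ae weak, of _ "cball x (1 / n)" "t / 4"])
      show "cbox a b \<subseteq> D" using sub by blast
      show "C1_on UNIV (\<lambda>y. bump n (y - x))"
        unfolding C1_on_def gr using g GDERIV_imp_differentiable
        by (auto intro!: continuous_intros)
      show "bump n (y - x) = 0" if "y \<notin> cball x (1 / n)" for y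
        using that bump_support(1)[OF n0, of "y - x"] by (simp add: dist_norm norm_minus_commute)
      fix y assume y: "y \<in> cball x (1 / n)"
      show "cball y (t / 4) \<subseteq> cbox a b"
      proof
        fix q assume "q \<in> cball y (t / 4)"
        moreover have "dist x y \<le> t / 4" using y n1 by (metis mem_cball order_trans)
        ultimately have "dist p q \<le> 4 * (t / 4)"
          using x t dist_triangle[of p q y] dist_triangle[of p y x] by auto
        then show "q \<in> cbox a b" using cB by auto
      qed
    qed (use t in auto)
    then show "integral (cbox a b) (\<lambda>y. (exp (- w y) *\<^sub>R X y) \<bullet> bump_grad n (y - x)) = 0" unfolding gr .
  qed
qed

section \<open>Descent of the level function inside a region\<close>

lemma negligible_not_AE:
  assumes "AE x in lebesgue. P x"
  shows "negligible {x. \<not> P x}"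
  using assms by (simp add: completion.AE_iff_null_sets negligible_iff_null_sets)

lemma mem_cbox_around: "y \<in> cbox (x - vector [s, s]) (x + vector [s, s]) \<longleftrightarrow> y - x \<in> square s"
  by (auto simp: mem_box_cart forall_2 mem_square abs_le_iff algebra_simps)

text \<open>The sign of the directional derivative is known only almost everywhere, and possibly at no point of
the segment in question. Therefore \<open>w\<close> is averaged over translates of the segment by a small square:
the average is differentiable along the segment by dominated convergence, with derivative at most 0.
If \<open>w\<close> increased from one end to the other, then so would the average, by continuity.\<close>

lemma nonincreasing_in_ball:
  fixes w :: "real^2 \<Rightarrow> real"
  assumes Lip: "L-lipschitz_on (ball p r) w"
    and ae: "AE x in lebesgue. x \<in> ball p r \<longrightarrow> w differentiable (at x) \<and> grad w x \<bullet> v \<le> 0"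
    and x: "x \<in> ball p r" "x + t *\<^sub>R v \<in> ball p r" and t: "0 \<le> t"
  shows "w (x + t *\<^sub>R v) \<le> w x"
proof (rule ccontr)
  assume "\<not> ?thesis"
  then have gap: "0 < w (x + t *\<^sub>R v) - w x" by simp
  then have t0: "0 < t" using t by (cases "t = 0") auto
  define gap where "gap = w (x + t *\<^sub>R v) - w x"
  have L0: "0 \<le> L" using Lip by (rule lipschitz_on_nonneg)
  obtain s1 where s1: "0 < s1" "ball x s1 \<subseteq> ball p r" using openE[OF open_ball x(1)] .
  obtain s2 where s2: "0 < s2" "ball (x + t *\<^sub>R v) s2 \<subseteq> ball p r" using openE[OF open_ball x(2)] .
  \<comment> \<open>Translates by less than \<open>s\<close> stay in the ball and change the increase of \<open>w\<close> by at most half.\<close>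
  define s where "s = min (min s1 s2) (gap / (4 * (L + 1)))"
  have s: "0 < s" "s \<le> s1" "s \<le> s2" "s \<le> gap / (4 * (L + 1))"
    using s1 s2 gap L0 by (auto simp: s_def gap_def)
  have Ls: "L * s \<le> gap / 4"
  proof -
    have "L * s \<le> (L + 1) * s" using s(1) by simp
    also have "\<dots> \<le> gap / 4" using s(4) L0 by (simp add: field_simps)
    finally show ?thesis .
  qed
  define Q where "Q = cbox (x - vector [s / 4, s / 4]) (x + vector [s / 4, s / 4])"
  have Q: "norm (y - x) < s" if "y \<in> Q" for y
  proof -
    have "y - x \<in> square (s / 4)" using that by (simp add: Q_def mem_cbox_around)
    then have "norm (y - x) \<le> 2 * (s / 4)" by (rule square_norm)
    also have "\<dots> < s" using s(1) by simp
    finally show ?thesis .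
  qed
  have Qmeas: "0 < measure lborel Q"
  proof -
    have "x \<in> Q" using s(1) by (simp add: Q_def mem_box_cart forall_2)
    then have "Q \<noteq> {}" by blast
    then show ?thesis using s(1) unfolding Q_def
      by (subst content_cbox_cart) (simp_all add: UNIV_2)
  qed
  have inb: "y + \<tau> *\<^sub>R v \<in> ball p r" if y: "y \<in> Q" and \<tau>: "\<tau> \<in> {0..t}" for y \<tau>
  proof -
    have "y \<in> ball x s1" using Q[OF y] s by (simp add: dist_norm norm_minus_commute)
    then have a: "y \<in> ball p r" using s1 by blast
    have b: "y + t *\<^sub>R v \<in> ball p r"
    proof -
      have "y + t *\<^sub>R v \<in> ball (x + t *\<^sub>R v) s2" using Q[OF y] s by (simp add: dist_norm norm_minus_commute)
      then show ?thesis using s2 by blast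
    qed
    have "(1 - \<tau> / t) *\<^sub>R y + (\<tau> / t) *\<^sub>R (y + t *\<^sub>R v) \<in> ball p r"
      using \<tau> t0 by (intro convexD[OF convex_ball a b]) auto
    moreover have "(1 - \<tau> / t) *\<^sub>R y + (\<tau> / t) *\<^sub>R (y + t *\<^sub>R v) = y + \<tau> *\<^sub>R v"
      using t0 by (simp add: algebra_simps)
    ultimately show ?thesis by simp
  qed
  define g where "g \<tau> = integral Q (\<lambda>y. w (y + \<tau> *\<^sub>R v))" for \<tau>
  have cw: "continuous_on Q (\<lambda>y. w (y + \<tau> *\<^sub>R v))" if "\<tau> \<in> {0..t}" for \<tau>
    by (intro continuous_on_compose2[OF lipschitz_on_continuous_on[OF Lip]] continuous_intros) (use inb that in auto)
  have iw: "(\<lambda>y. w (y + \<tau> *\<^sub>R v)) integrable_on Q" if "\<tau> \<in> {0..t}" for \<tau>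
    using cw[OF that] unfolding Q_def by (rule integrable_continuous)
  have big: "gap / 2 * measure lborel Q \<le> g t - g 0"
  proof -
    have "g t - g 0 = integral Q (\<lambda>y. w (y + t *\<^sub>R v) - w (y + 0 *\<^sub>R v))"
      unfolding g_def using t by (intro integral_diff[symmetric] iw) auto
    also have "\<dots> \<ge> integral Q (\<lambda>y. gap / 2)"
    proof (rule integral_le)
      show "(\<lambda>y. gap / 2) integrable_on Q" unfolding Q_def by (rule integrable_const)
      show "(\<lambda>y. w (y + t *\<^sub>R v) - w (y + 0 *\<^sub>R v)) integrable_on Q"
        using t by (intro integrable_diff iw) auto
      fix y assume y: "y \<in> Q"
      have "dist (w (y + t *\<^sub>R v)) (w (x + t *\<^sub>R v)) \<le> L * dist (y + t *\<^sub>R v) (x + t *\<^sub>R v)"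
        using inb[OF y, of t] t x by (intro lipschitz_onD[OF Lip]) auto
      moreover have "dist (w y) (w x) \<le> L * dist y x"
        using inb[OF y, of 0] t x by (intro lipschitz_onD[OF Lip]) auto
      moreover have "L * dist y x \<le> L * s" using Q[OF y] L0 by (intro mult_left_mono) (auto simp: dist_norm)
      ultimately have a: "\<bar>w (y + t *\<^sub>R v) - w (x + t *\<^sub>R v)\<bar> \<le> gap / 4" "\<bar>w y - w x\<bar> \<le> gap / 4"
        using Ls by (auto simp: dist_real_def dist_norm)
      have arith: "(B - b) / 2 \<le> A - c" if "- (A - B) \<le> (B - b) / 4" "c - b \<le> (B - b) / 4" for A B b c :: real
        using that by (simp add: field_simps)
      have "gap / 2 \<le> w (y + t *\<^sub>R v) - w y"
        unfolding gap_def by (rule arith[OF abs_le_D2[OF a(1)[unfolded gap_def]] abs_le_D1[OF a(2)[unfolded gap_def]]])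
      then show "gap / 2 \<le> w (y + t *\<^sub>R v) - w (y + 0 *\<^sub>R v)" by simp
    qed
    also have "integral Q (\<lambda>y. gap / 2) = gap / 2 * measure lborel Q" unfolding Q_def by simp
    finally show ?thesis .
  qed
  define N where "N = {x. \<not> (x \<in> ball p r \<longrightarrow> w differentiable (at x) \<and> grad w x \<bullet> v \<le> 0)}"
  have negN: "negligible N" unfolding N_def by (rule negligible_not_AE[OF ae])
  define M where "M \<tau> = (+) (- (\<tau> *\<^sub>R v)) ` N" for \<tau>
  have negM: "negligible (M \<tau>)" for \<tau> unfolding M_def using negN by (rule negligible_translation)
  have notM: "y + \<tau> *\<^sub>R v \<notin> N" if "y \<notin> M \<tau>" for y \<tau>
    using that unfolding M_def by (force simp: image_iff)
  \<comment> \<open>The value 0 on the null set makes the convergence of the difference quotients hold everywhere.\<close>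
  define dg where "dg \<tau> y = (if y \<in> M \<tau> then 0 else v \<bullet> grad w (y + \<tau> *\<^sub>R v))" for \<tau> y
  have dg_le: "dg \<tau> y \<le> 0" if "y \<in> Q" "\<tau> \<in> {0..t}" for \<tau> y
    using notM[of y \<tau>] inb[OF that] by (auto simp: dg_def N_def inner_commute)
  have g': "(g has_real_derivative integral Q (dg \<tau>)) (at \<tau> within {0..t})" and dg_int: "integral Q (dg \<tau>) \<le> 0"
    if \<tau>: "\<tau> \<in> {0..t}" for \<tau>
  proof -
    have lim: "(\<lambda>k. (g (T k) - g \<tau>) / (T k - \<tau>)) \<longlonglongrightarrow> integral Q (dg \<tau>) \<and> dg \<tau> integrable_on Q"
      if T: "\<And>k. T k \<in> {0..t} - {\<tau>}" "T \<longlonglongrightarrow> \<tau>" for T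
    proof -
      define q where "q k y = (w (y + T k *\<^sub>R v) - w (y + \<tau> *\<^sub>R v)) / (T k - \<tau>)" for k y
      define q' where "q' k y = (if y \<in> M \<tau> then 0 else q k y)" for k y
      have iq: "q k integrable_on Q" for k
        unfolding q_def using T(1)[of k] \<tau> by (intro integrable_on_divide integrable_diff iw) auto
      have iq': "q' k integrable_on Q" for k
        by (rule integrable_spike[OF iq[of k] negM[of \<tau>]]) (simp add: q'_def)
      have eqq: "integral Q (q' k) = (g (T k) - g \<tau>) / (T k - \<tau>)" for k
      proof -
        have "integral Q (q' k) = integral Q (q k)"
          by (rule integral_spike[OF negM[of \<tau>], symmetric]) (simp add: q'_def)
        also have "\<dots> = integral Q (\<lambda>y. w (y + T k *\<^sub>R v) - w (y + \<tau> *\<^sub>R v)) / (T k - \<tau>)"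
          unfolding q_def by (rule integral_divide)
        also have "integral Q (\<lambda>y. w (y + T k *\<^sub>R v) - w (y + \<tau> *\<^sub>R v)) = g (T k) - g \<tau>"
          unfolding g_def using T(1)[of k] \<tau> by (intro integral_diff iw) auto
        finally show ?thesis .
      qed
      have le: "norm (q' k y) \<le> L * norm v" if y: "y \<in> Q" for k y
      proof -
        have "dist (w (y + T k *\<^sub>R v)) (w (y + \<tau> *\<^sub>R v)) \<le> L * dist (y + T k *\<^sub>R v) (y + \<tau> *\<^sub>R v)"
          using inb[OF y] T(1)[of k] \<tau> by (intro lipschitz_onD[OF Lip]) auto
        also have "dist (y + T k *\<^sub>R v) (y + \<tau> *\<^sub>R v) = norm ((T k - \<tau>) *\<^sub>R v)"
          by (simp add: dist_norm scaleR_diff_left)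
        finally have "\<bar>w (y + T k *\<^sub>R v) - w (y + \<tau> *\<^sub>R v)\<bar> \<le> L * norm v * \<bar>T k - \<tau>\<bar>"
          by (simp add: dist_real_def mult_ac)
        then have "\<bar>q k y\<bar> \<le> L * norm v"
          using T(1)[of k] by (simp add: q_def abs_divide pos_divide_le_eq)
        then show ?thesis using L0 by (simp add: q'_def)
      qed
      have conv: "(\<lambda>k. q' k y) \<longlonglongrightarrow> dg \<tau> y" if y: "y \<in> Q" for y
      proof (cases "y \<in> M \<tau>")
        case False
        have "w differentiable (at (y + \<tau> *\<^sub>R v))"
          using notM[OF False] inb[OF y \<tau>] by (auto simp: N_def)
        from GDERIV_directional[OF differentiable_imp_GDERIV_grad[OF this], of v]
        have "((\<lambda>h. (w (y + \<tau> *\<^sub>R v + h *\<^sub>R v) - w (y + \<tau> *\<^sub>R v)) / h) \<longlongrightarrow> v \<bullet> grad w (y + \<tau> *\<^sub>R v)) (at 0)"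
          by (simp add: DERIV_def)
        moreover have "filterlim (\<lambda>k. T k - \<tau>) (at 0) sequentially"
          unfolding filterlim_at using T LIM_zero[OF T(2)] by (auto intro!: always_eventually)
        ultimately have "(\<lambda>k. (w (y + \<tau> *\<^sub>R v + (T k - \<tau>) *\<^sub>R v) - w (y + \<tau> *\<^sub>R v)) / (T k - \<tau>)) \<longlonglongrightarrow>
            v \<bullet> grad w (y + \<tau> *\<^sub>R v)"
          by (rule filterlim_compose)
        moreover have "y + \<tau> *\<^sub>R v + (T k - \<tau>) *\<^sub>R v = y + T k *\<^sub>R v" for k
          by (simp add: algebra_simps)
        ultimately show ?thesis using False by (simp add: q'_def q_def dg_def)
      qed (simp add: q'_def dg_def)
      have h: "(\<lambda>_. L * norm v) integrable_on Q" unfolding Q_def by (rule integrable_const)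
      have "dg \<tau> integrable_on Q \<and> (\<lambda>k. integral Q (q' k)) \<longlonglongrightarrow> integral Q (dg \<tau>)"
        using dominated_convergence[OF iq' h le conv] by blast
      then show ?thesis by (simp add: eqq)
    qed
    show "(g has_real_derivative integral Q (dg \<tau>)) (at \<tau> within {0..t})"
      unfolding has_field_derivative_iff tendsto_at_iff_sequentially o_def using lim by blast
    show "integral Q (dg \<tau>) \<le> 0"
    proof (cases "dg \<tau> integrable_on Q")
      case True
      then have "integral Q (dg \<tau>) \<le> integral Q (\<lambda>_. 0)"
        using dg_le \<tau> by (intro integral_le) (auto simp: Q_def)
      then show ?thesis by simp
    qed (simp add: not_integrable_integral)
  qed
  have "\<exists>\<tau>\<in>{0<..<t}. g t - g 0 = integral Q (dg \<tau>) * (t - 0)"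
    by (rule mvt_simple[OF t0]) (use g' in \<open>auto simp: has_field_derivative_def\<close>)
  then obtain \<tau> where "\<tau> \<in> {0<..<t}" "g t - g 0 = integral Q (dg \<tau>) * (t - 0)" by blast
  then have "g t - g 0 \<le> 0" using dg_int[of \<tau>] t0 by (simp add: mult_nonpos_nonneg)
  moreover have "0 < gap / 2 * measure lborel Q" using gap Qmeas unfolding gap_def by simp
  ultimately show False using big by linarith
qed


text \<open>The equality case of the Cauchy-Schwarz inequality. It is the reason why \<open>X \<bullet> \<nabla>w = |\<nabla>w|\<close>
determines the direction of \<open>\<nabla>w\<close>.\<close>

lemma grad_parallel:
  fixes X g :: "'a::real_inner"
  assumes "norm X \<le> 1" "X \<bullet> g = norm g"
  shows "g = norm g *\<^sub>R X"
proof -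
  have "(g - norm g *\<^sub>R X) \<bullet> (g - norm g *\<^sub>R X) = g \<bullet> g - 2 * norm g * (X \<bullet> g) + norm g * norm g * (X \<bullet> X)"
    by (simp add: inner_diff_left inner_diff_right inner_commute algebra_simps)
  also have "\<dots> = (norm g)\<^sup>2 * ((norm X)\<^sup>2 - 1)"
    unfolding assms(2) dot_square_norm by (simp add: power2_eq_square algebra_simps)
  also have "\<dots> \<le> 0"
    using assms(1) power_mono[of "norm X" 1 2] by (intro mult_nonneg_nonpos) auto
  finally have "(g - norm g *\<^sub>R X) \<bullet> (g - norm g *\<^sub>R X) = 0" using inner_ge_zero antisym by blast
  then show ?thesis by (simp only: inner_eq_zero_iff right_minus_eq)
qed

text \<open>Here \<open>\<nabla>w \<bullet> v = |\<nabla>w| (X \<bullet> v) \<le> 0\<close> almost everywhere near the segment. Monotonicity near each parameter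
gives monotonicity on the whole segment.\<close>

lemma nonincreasing_along_segment:
  fixes w :: "real^2 \<Rightarrow> real"
  assumes D: "open D" and Xc: "continuous_on D X" and Xn: "\<And>x. x \<in> D \<Longrightarrow> norm (X x) \<le> 1"
    and Lip: "locally_Lipschitz_on D w"
    and ae: "AE x in lebesgue. x \<in> D \<longrightarrow> w differentiable (at x) \<and> X x \<bullet> grad w x = norm (grad w x)"
    and ab: "a \<le> b" and seg: "\<And>t. a \<le> t \<Longrightarrow> t \<le> b \<Longrightarrow> x + t *\<^sub>R v \<in> D \<and> X (x + t *\<^sub>R v) \<bullet> v < 0"
  shows "w (x + b *\<^sub>R v) \<le> w (x + a *\<^sub>R v)"
  using ab
proof (induction rule: Bolzano[consumes 1, case_names trans local])
  case (local t)
  let ?p = "x + t *\<^sub>R v"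
  have p: "?p \<in> D" "X ?p \<bullet> v < 0" using seg local by auto
  obtain r1 L where r1: "0 < r1" "L-lipschitz_on (ball ?p r1 \<inter> D) w"
    using Lip p(1) unfolding locally_Lipschitz_on_def by blast
  obtain r2 where r2: "0 < r2" "ball ?p r2 \<subseteq> D" using openE[OF D p(1)] .
  have "continuous (at ?p) (\<lambda>y. X y \<bullet> v)"
    using Xc D p(1) by (intro continuous_intros) (simp add: continuous_on_eq_continuous_at)
  then have "\<forall>\<^sub>F y in at ?p. X y \<bullet> v < 0"
    using p(2) unfolding isCont_def by (rule order_tendstoD(2))
  then obtain r3 where r3: "0 < r3" "\<And>y. y \<noteq> ?p \<Longrightarrow> dist y ?p < r3 \<Longrightarrow> X y \<bullet> v < 0"
    unfolding eventually_at by blast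
  define r where "r = min r1 (min r2 r3)"
  have r: "0 < r" "r \<le> r1" "r \<le> r2" "r \<le> r3" using r1 r2 r3 by (auto simp: r_def)
  have LipB: "L-lipschitz_on (ball ?p r) w"
    by (rule lipschitz_on_subset[OF r1(2)]) (use r r2 in auto)
  have aeB: "AE y in lebesgue. y \<in> ball ?p r \<longrightarrow> w differentiable (at y) \<and> grad w y \<bullet> v \<le> 0"
    using ae
  proof eventually_elim
    case (elim y)
    show ?case
    proof
      assume y: "y \<in> ball ?p r"
      then have yD: "y \<in> D" using r r2 by auto
      have "X y \<bullet> v < 0" using r3(2)[of y] p(2) y r by (cases "y = ?p") (auto simp: dist_commute)
      then have "norm (grad w y) * (X y \<bullet> v) \<le> 0" by (simp add: mult_nonneg_nonpos)
      moreover have "grad w y = norm (grad w y) *\<^sub>R X y" using elim yD Xn[OF yD] by (intro grad_parallel) auto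
      ultimately show "w differentiable (at y) \<and> grad w y \<bullet> v \<le> 0"
        using elim yD by (metis inner_scaleR_left)
    qed
  qed
  define d where "d = r / (norm v + 1)"
  have d: "0 < d" using r by (simp add: d_def add_nonneg_pos)
  have near: "x + s *\<^sub>R v \<in> ball ?p r" if "\<bar>s - t\<bar> < d" for s
  proof -
    have "dist (x + t *\<^sub>R v) (x + s *\<^sub>R v) = \<bar>s - t\<bar> * norm v"
      by (metis add_diff_cancel_left dist_commute dist_norm norm_scaleR real_norm_def scaleR_diff_left)
    also have "\<dots> \<le> \<bar>s - t\<bar> * (norm v + 1)" by (intro mult_left_mono) auto
    also have "\<dots> < d * (norm v + 1)" using that by (intro mult_strict_right_mono) (auto simp: add_nonneg_pos)
    also have "\<dots> = r" by (simp add: d_def add_nonneg_pos less_imp_neq[symmetric])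
    finally show ?thesis by simp
  qed
  show ?case
  proof (intro exI[of _ d] conjI allI impI d)
    fix s s' assume s: "s \<le> t \<and> t \<le> s' \<and> s' - s < d"
    have "w ((x + s *\<^sub>R v) + (s' - s) *\<^sub>R v) \<le> w (x + s *\<^sub>R v)"
      by (rule nonincreasing_in_ball[OF LipB aeB]) (use s near[of s] near[of s'] in \<open>auto simp: algebra_simps\<close>)
    then show "w (x + s' *\<^sub>R v) \<le> w (x + s *\<^sub>R v)" by (simp add: algebra_simps)
  qed
qed auto

text \<open>At a boundary point the field \<open>X\<close> is the outer normal, so directions \<open>v\<close> with \<open>X \<bullet> v < 0\<close> enter the
region. The open segment then lies in the region, where \<open>w\<close> is nonincreasing, and continuity of \<open>w\<close>
at \<open>x\<close> includes the initial point. Interior points and ridge points are thus treated alike.\<close>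

lemma descent_direction:
  fixes w :: "real^2 \<Rightarrow> real"
  assumes U: "open U" "x \<in> U" and wc: "continuous_on U w" and Xc: "continuous_on U X"
    and D: "open D" "D \<subseteq> U" and Xn: "\<And>x. x \<in> D \<Longrightarrow> norm (X x) \<le> 1"
    and Lip: "locally_Lipschitz_on D w"
    and ae: "AE x in lebesgue. x \<in> D \<longrightarrow> w differentiable (at x) \<and> X x \<bullet> grad w x = norm (grad w x)"
    and x: "x \<in> D \<or> outer_unit_normal D x (X x)" and v: "X x \<bullet> v < 0"
  shows "\<exists>h0>0. \<forall>h. 0 < h \<and> h < h0 \<longrightarrow> x + h *\<^sub>R v \<in> D \<and> w (x + h *\<^sub>R v) \<le> w x"
proof -
  have near: "\<exists>d>0. \<forall>h. 0 < h \<and> h < d \<longrightarrow> P (x + h *\<^sub>R v)" if ev: "\<forall>\<^sub>F y in nhds x. P y" for P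
  proof -
    obtain e where e: "0 < e" "\<And>y. dist y x < e \<Longrightarrow> P y" using ev unfolding eventually_nhds_metric by blast
    have "norm (h *\<^sub>R v) < e" if "0 < h" "h < e / (norm v + 1)" for h
    proof -
      have "norm (h *\<^sub>R v) \<le> h * (norm v + 1)" using that(1) by simp
      also have "\<dots> < e" using that(2) by (simp add: pos_less_divide_eq add_nonneg_pos)
      finally show ?thesis .
    qed
    then show ?thesis using e
      by (intro exI[of _ "e / (norm v + 1)"]) (auto simp: add_nonneg_pos dist_norm)
  qed
  have "\<exists>d>0. \<forall>h. 0 < h \<and> h < d \<longrightarrow> x + h *\<^sub>R v \<in> D"
    using x
  proof
    assume "x \<in> D"
    then show ?thesis using near[of "\<lambda>y. y \<in> D"] D(1) eventually_nhds by blast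
  next
    assume "outer_unit_normal D x (X x)"
    then obtain V f where V: "open V" "x \<in> V" and f: "C1_on V f" "\<And>y. y \<in> V \<Longrightarrow> grad f y \<noteq> 0"
      "D \<inter> V = {y \<in> V. f y < 0}" "f x = 0" and n: "X x = grad f x /\<^sub>R norm (grad f x)"
      unfolding outer_unit_normal_def by blast
    have g: "GDERIV f x :> grad f x"
      using f(1) V(2) differentiable_imp_GDERIV_grad by (auto simp: C1_on_def)
    have ng: "0 < norm (grad f x)" using f(2)[OF V(2)] by simp
    have "grad f x = norm (grad f x) *\<^sub>R X x" using n ng by simp
    then have neg: "v \<bullet> grad f x < 0"
      using v ng by (metis inner_commute inner_scaleR_left mult_pos_neg)
    obtain d1 where d1: "0 < d1" "\<And>h. 0 < h \<Longrightarrow> h < d1 \<Longrightarrow>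
        \<bar>f (x + h *\<^sub>R v) - f x - h * (v \<bullet> grad f x)\<bar> \<le> (- (v \<bullet> grad f x) / 2) * h"
      using GDERIV_increment[OF g, of "- (v \<bullet> grad f x) / 2" v] neg by auto
    obtain d2 where d2: "0 < d2" "\<And>h. 0 < h \<Longrightarrow> h < d2 \<Longrightarrow> x + h *\<^sub>R v \<in> V"
      using near[of "\<lambda>y. y \<in> V"] V eventually_nhds by blast
    have "x + h *\<^sub>R v \<in> D" if h: "0 < h" "h < min d1 d2" for h
    proof -
      have "f (x + h *\<^sub>R v) \<le> h * (v \<bullet> grad f x) + (- (v \<bullet> grad f x) / 2) * h"
        using abs_le_D1[OF d1(2)[of h]] h f(4) by linarith
      also have "\<dots> = h * (v \<bullet> grad f x) / 2" by (simp add: field_simps)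
      also have "\<dots> < 0" using h neg by (simp add: mult_pos_neg)
      finally show ?thesis using d2(2)[of h] h f(3) by auto
    qed
    then show ?thesis using d1(1) d2(1) by (intro exI[of _ "min d1 d2"]) auto
  qed
  then obtain d1 where d1: "0 < d1" "\<And>h. 0 < h \<Longrightarrow> h < d1 \<Longrightarrow> x + h *\<^sub>R v \<in> D" by blast
  have "continuous (at x) (\<lambda>y. X y \<bullet> v)"
    using Xc U by (intro continuous_intros) (simp add: continuous_on_eq_continuous_at)
  moreover have "0 < - (X x \<bullet> v)" using v by simp
  ultimately obtain d where d: "0 < d" "\<And>y. dist y x < d \<Longrightarrow> dist (X y \<bullet> v) (X x \<bullet> v) < - (X x \<bullet> v)"
    unfolding continuous_at_eps_delta by blast
  have "X y \<bullet> v < 0" if "dist y x < d" for y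
    using d(2)[OF that] by (simp add: dist_real_def)
  then have "\<forall>\<^sub>F y in nhds x. X y \<bullet> v < 0" unfolding eventually_nhds_metric using d(1) by blast
  then obtain d2 where d2: "0 < d2" "\<And>h. 0 < h \<Longrightarrow> h < d2 \<Longrightarrow> X (x + h *\<^sub>R v) \<bullet> v < 0"
    using near by blast
  have "w (x + h *\<^sub>R v) \<le> w x" if h: "0 < h" "h < min d1 d2" for h
  proof -
    have le: "w (x + h *\<^sub>R v) \<le> w (x + s *\<^sub>R v)" if s: "0 < s" "s \<le> h" for s
      by (rule nonincreasing_along_segment[OF D(1) continuous_on_subset[OF Xc D(2)] Xn Lip ae s(2)])
        (use d1(2) d2(2) h s in auto)
    have "(\<lambda>k. x + (h * inverse (real (Suc k))) *\<^sub>R v) \<longlonglongrightarrow> x + (h * 0) *\<^sub>R v"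
      by (intro tendsto_intros LIMSEQ_inverse_real_of_nat)
    then have "(\<lambda>k. x + (h * inverse (real (Suc k))) *\<^sub>R v) \<longlonglongrightarrow> x" by simp
    moreover have "isCont w x" using wc U by (simp add: continuous_on_eq_continuous_at)
    ultimately have "(\<lambda>k. w (x + (h * inverse (real (Suc k))) *\<^sub>R v)) \<longlonglongrightarrow> w x"
      by (rule isCont_tendsto_compose[rotated])
    moreover have "w (x + h *\<^sub>R v) \<le> w (x + (h * inverse (real (Suc k))) *\<^sub>R v)" for k
      using h(1) by (intro le) (auto simp: field_simps)
    ultimately show ?thesis by (intro LIMSEQ_le_const) auto
  qed
  then show ?thesis using d1 d2(1) by (intro exI[of _ "min d1 d2"]) auto
qed

section \<open>Regions, ridges and segments\<close>

text \<open>A region with outer normal \<open>X\<close> cannot be left in a direction that makes an obtuse angle with \<open>X\<close>: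
at the first exit point the defining function of the boundary would have to be positive just before.\<close>

lemma region_contains_segment_end:
  assumes D: "open D" and U: "convex B" "B \<subseteq> U"
    and normal: "\<And>p. p \<in> frontier D \<inter> U \<Longrightarrow> outer_unit_normal D p (X p)"
    and y: "y \<in> D" "y \<in> B" and q: "q \<in> B" and X: "\<And>p. p \<in> B \<Longrightarrow> X p \<bullet> (q - y) < 0"
  shows "q \<in> D"
proof (rule ccontr)
  assume qD: "q \<notin> D"
  define c where "c t = y + t *\<^sub>R (q - y)" for t
  define S where "S = {t \<in> {0..1}. c t \<in> - D}"
  have c_cont: "continuous_on {0..1} c" unfolding c_def by (intro continuous_intros)
  have "closed S" unfolding S_def
    using continuous_closed_preimage[OF c_cont closed_atLeastAtMost, of "- D"] D
    by (simp add: vimage_def Int_def closed_Compl)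
  moreover have "1 \<in> S" using qD by (simp add: S_def c_def)
  moreover have bdd: "bdd_below S" by (rule bdd_belowI[of _ 0]) (auto simp: S_def)
  ultimately have t0: "Inf S \<in> S" using closed_contains_Inf[of S] by blast
  define t where "t = Inf S"
  have t: "0 < t" "t \<le> 1" "c t \<notin> D"
  proof -
    have "t \<in> S" using t0 by (simp add: t_def)
    moreover have "c 0 \<in> D" using y by (simp add: c_def)
    ultimately show "0 < t" "t \<le> 1" "c t \<notin> D" by (auto simp: S_def less_le)
  qed
  have before: "c s \<in> D" if "0 \<le> s" "s < t" for s
  proof (rule ccontr)
    assume "c s \<notin> D"
    then have "s \<in> S" using that t by (simp add: S_def)
    then have "t \<le> s" unfolding t_def using bdd by (rule cInf_lower)
    then show False using that by simp
  qed
  have cB: "c t \<in> B"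
  proof -
    have "c t = (1 - t) *\<^sub>R y + t *\<^sub>R q" by (simp add: c_def algebra_simps)
    then show ?thesis using convexD[OF U(1) y(2) q] t by simp
  qed
  have "c t \<in> closure D"
  proof -
    have "(\<lambda>k. c (t - t * inverse (real (Suc k)))) \<longlonglongrightarrow> c (t - t * 0)"
      unfolding c_def by (intro tendsto_intros LIMSEQ_inverse_real_of_nat)
    moreover have "c (t - t * inverse (real (Suc k))) \<in> D" for k
    proof (rule before)
      have "t * inverse (real (Suc k)) \<le> t * 1" using t(1) by (intro mult_left_mono) (auto simp: inverse_le_1_iff)
      then show "0 \<le> t - t * inverse (real (Suc k))" by simp
      show "t - t * inverse (real (Suc k)) < t" using t(1) by simp
    qed
    ultimately show ?thesis unfolding closure_sequential
      by (intro exI[of _ "\<lambda>k. c (t - t * inverse (real (Suc k)))"]) (simp only: mult_zero_right diff_zero, blast)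
  qed
  then have "c t \<in> frontier D \<inter> U" using t(3) D cB U(2) by (auto simp: frontier_def interior_open)
  from normal[OF this] obtain V f where V: "open V" "c t \<in> V" and f: "C1_on V f" "\<And>y. y \<in> V \<Longrightarrow> grad f y \<noteq> 0"
      "D \<inter> V = {y \<in> V. f y < 0}" "f (c t) = 0" and n: "X (c t) = grad f (c t) /\<^sub>R norm (grad f (c t))"
    unfolding outer_unit_normal_def by blast
  have g: "GDERIV f (c t) :> grad f (c t)"
    using f(1) V(2) differentiable_imp_GDERIV_grad by (auto simp: C1_on_def)
  have ng: "0 < norm (grad f (c t))" using f(2)[OF V(2)] by simp
  have "grad f (c t) = norm (grad f (c t)) *\<^sub>R X (c t)" using n ng by simp
  then have pos: "0 < (- (q - y)) \<bullet> grad f (c t)"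
    using X[OF cB] ng by (metis inner_commute inner_minus_left inner_scaleR_left mult_pos_neg neg_0_less_iff_less)
  obtain d1 where d1: "0 < d1" "\<And>h. 0 < h \<Longrightarrow> h < d1 \<Longrightarrow>
      \<bar>f (c t + h *\<^sub>R (- (q - y))) - f (c t) - h * ((- (q - y)) \<bullet> grad f (c t))\<bar> \<le> ((- (q - y)) \<bullet> grad f (c t) / 2) * h"
    using GDERIV_increment[OF g, of "(- (q - y)) \<bullet> grad f (c t) / 2" "- (q - y)"] pos by auto
  have "(\<lambda>h. c t + h *\<^sub>R (- (q - y))) \<midarrow>0\<rightarrow> c t + 0 *\<^sub>R (- (q - y))" by (intro tendsto_intros)
  then have "\<forall>\<^sub>F h in at 0. c t + h *\<^sub>R (- (q - y)) \<in> V"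
    using V by (intro topological_tendstoD) auto
  then obtain d2 where d2: "0 < d2" "\<And>h. h \<noteq> 0 \<Longrightarrow> dist h 0 < d2 \<Longrightarrow> c t + h *\<^sub>R (- (q - y)) \<in> V"
    unfolding eventually_at by blast
  define h where "h = min (min d1 d2) t / 2"
  have h: "0 < h" "h < d1" "h < d2" "h < t" using d1 d2 t by (auto simp: h_def)
  have eq: "c t + h *\<^sub>R (- (q - y)) = c (t - h)" by (simp add: c_def algebra_simps)
  have "c (t - h) \<in> D \<inter> V" using before[of "t - h"] d2(2)[of h] h eq by auto
  then have "f (c (t - h)) < 0" using f(3) by auto
  moreover have "h * ((- (q - y)) \<bullet> grad f (c t)) - ((- (q - y)) \<bullet> grad f (c t) / 2) * h \<le> f (c (t - h))"
    using abs_le_D2[OF d1(2)[OF h(1,2)]] unfolding eq f(4) by linarith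
  moreover have "0 < h * ((- (q - y)) \<bullet> grad f (c t))" using h(1) pos by (rule mult_pos_pos)
  ultimately show False by (simp add: mult.commute)
qed

text \<open>Regions could a priori become thin and accumulate at \<open>x\<close>, so that \<open>x\<close> is in the closure of none.
But near \<open>x\<close> the field \<open>\<nu>\<close> is almost constant. Hence a region with sign \<open>\<chi>\<close> that has a point close to
\<open>x\<close> also contains \<open>x - \<chi> (\<rho>/4) \<nu>(x)\<close>. By disjointness at most one region of each sign comes close to
\<open>x\<close>; as the union of all regions is dense, \<open>x\<close> is in the closure of one of these two.\<close>

lemma in_closure_of_region:
  fixes \<nu> :: "real^2 \<Rightarrow> real^2"
  assumes U: "open U" "x \<in> U" and disj: "disjoint \<D>" and op: "\<And>D. D \<in> \<D> \<Longrightarrow> open D"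
    and normal: "\<And>D p. D \<in> \<D> \<Longrightarrow> p \<in> frontier D \<inter> U \<Longrightarrow> outer_unit_normal D p (chi D *\<^sub>R \<nu> p)"
    and chi: "\<And>D. D \<in> \<D> \<Longrightarrow> chi D \<in> {1, -1}"
    and \<nu>: "continuous_on U \<nu>" "\<And>p. p \<in> U \<Longrightarrow> norm (\<nu> p) = 1"
    and dense: "U \<subseteq> closure (\<Union>\<D>)"
  shows "\<exists>D\<in>\<D>. x \<in> D \<or> outer_unit_normal D x (chi D *\<^sub>R \<nu> x)"
proof -
  have "continuous (at x) \<nu>" using \<nu>(1) U by (simp add: continuous_on_eq_continuous_at)
  then obtain d where d: "0 < d" "\<And>y. dist y x < d \<Longrightarrow> dist (\<nu> y) (\<nu> x) < 1 / 4"
    unfolding continuous_at_eps_delta by (meson zero_less_divide_1_iff zero_less_numeral)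
  obtain d' where d': "0 < d'" "ball x d' \<subseteq> U" using openE[OF U] .
  define \<rho> where "\<rho> = min d d'"
  have \<rho>: "0 < \<rho>" "ball x \<rho> \<subseteq> U" "\<And>y. y \<in> ball x \<rho> \<Longrightarrow> norm (\<nu> y - \<nu> x) \<le> 1 / 4"
    using d d' by (auto simp: \<rho>_def dist_commute dist_norm intro: less_imp_le)
  define q where "q s = x - (s * \<rho> / 4) *\<^sub>R \<nu> x" for s :: real
  have in_D: "q (chi D) \<in> D" if D: "D \<in> \<D>" and y: "y \<in> D" "y \<in> ball x (\<rho> / 8)" for D y
  proof (rule region_contains_segment_end[OF op[OF D] convex_ball \<rho>(2) normal[OF D] y(1)])
    have c1: "\<bar>chi D\<bar> = 1" "chi D * chi D = 1" using chi[OF D] by auto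
    show "y \<in> ball x \<rho>" using y(2) \<rho>(1) by auto
    show "q (chi D) \<in> ball x \<rho>" using \<rho>(1) c1 \<nu>(2)[OF U(2)] by (simp add: q_def dist_norm abs_mult)
    fix p assume p: "p \<in> ball x \<rho>"
    have np: "norm (\<nu> p) = 1" using p \<rho>(2) \<nu>(2) by blast
    have "\<nu> p \<bullet> (\<nu> p - \<nu> x) \<le> 1 / 4"
      using norm_cauchy_schwarz[of "\<nu> p" "\<nu> p - \<nu> x"] np \<rho>(3)[OF p] by simp
    then have big: "3 / 4 \<le> \<nu> p \<bullet> \<nu> x" using np by (simp add: inner_diff_right dot_square_norm)
    have "\<bar>\<nu> p \<bullet> (x - y)\<bar> \<le> norm (x - y)"
      using Cauchy_Schwarz_ineq2[of "\<nu> p" "x - y"] np by simp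
    also have "\<dots> < \<rho> / 8" using y(2) by (simp add: dist_norm)
    finally have "\<bar>chi D * (\<nu> p \<bullet> (x - y))\<bar> < \<rho> / 8" using c1 by (simp add: abs_mult)
    then have "chi D * (\<nu> p \<bullet> (x - y)) < \<rho> / 8" by simp
    moreover have "\<rho> / 4 * (3 / 4) \<le> \<rho> / 4 * (\<nu> p \<bullet> \<nu> x)" using big \<rho>(1) by (intro mult_left_mono) auto
    moreover have "(chi D *\<^sub>R \<nu> p) \<bullet> (q (chi D) - y) = chi D * (\<nu> p \<bullet> (x - y)) - (chi D * chi D) * (\<rho> / 4 * (\<nu> p \<bullet> \<nu> x))"
      by (simp add: q_def inner_diff_right algebra_simps)
    ultimately show "(chi D *\<^sub>R \<nu> p) \<bullet> (q (chi D) - y) < 0" unfolding c1(2) using \<rho>(1) by linarith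
  qed
  define \<D>' where "\<D>' = {D \<in> \<D>. D \<inter> ball x (\<rho> / 8) \<noteq> {}}"
  have "inj_on chi \<D>'"
  proof (rule inj_onI)
    fix D D' assume D: "D \<in> \<D>'" "D' \<in> \<D>'" "chi D = chi D'"
    obtain y y' where y: "y \<in> D" "y \<in> ball x (\<rho> / 8)" "y' \<in> D'" "y' \<in> ball x (\<rho> / 8)"
      using D(1,2) unfolding \<D>'_def by blast
    have "q (chi D) \<in> D" using in_D[of D y] D(1) y by (simp add: \<D>'_def)
    moreover have "q (chi D) \<in> D'" using in_D[of D' y'] D(2,3) y by (simp add: \<D>'_def)
    moreover have "D \<in> \<D>" "D' \<in> \<D>" using D by (auto simp: \<D>'_def)
    ultimately show "D = D'" using disj unfolding disjoint_def by blast
  qed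
  moreover have "finite (chi ` \<D>')"
    by (rule finite_subset[of _ "{1, -1}"]) (use chi in \<open>auto simp: \<D>'_def\<close>)
  ultimately have fin: "finite \<D>'" using finite_imageD by blast
  have "x \<in> closure (\<Union>\<D>')"
    unfolding closure_approachable
  proof (intro allI impI)
    fix e :: real assume "0 < e"
    then have "0 < min e (\<rho> / 8)" using \<rho>(1) by simp
    moreover have "x \<in> closure (\<Union>\<D>)" using dense U(2) by blast
    ultimately obtain y where y: "y \<in> \<Union>\<D>" "dist y x < min e (\<rho> / 8)"
      using closure_approachable[of x "\<Union>\<D>"] by blast
    then obtain D where D: "D \<in> \<D>" "y \<in> D" by blast
    have "y \<in> ball x (\<rho> / 8)" using y(2) by (simp add: dist_commute)
    then have "D \<in> \<D>'" using D unfolding \<D>'_def by blast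
    then have "y \<in> \<Union>\<D>'" using D(2) by blast
    then show "\<exists>y\<in>\<Union>\<D>'. dist y x < e" using y(2) by auto
  qed
  moreover have "closure (\<Union>\<D>') \<subseteq> (\<Union>D\<in>\<D>'. closure D)"
    using fin closure_subset by (intro closure_minimal closed_UN) auto
  ultimately obtain D where D: "D \<in> \<D>'" "x \<in> closure D" by blast
  then have D': "D \<in> \<D>" by (simp add: \<D>'_def)
  show ?thesis
  proof (cases "x \<in> D")
    case False
    then have "x \<in> frontier D \<inter> U" using D(2) U(2) op[OF D'] by (simp add: frontier_def interior_open)
    then show ?thesis using normal[OF D'] D' by blast
  qed (use D' in blast)
qed

lemma curve_negligible:
  fixes c :: "real \<Rightarrow> real^2"
  assumes "\<And>t. (c has_vector_derivative c' t) (at t)"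
  shows "negligible (range c)"
proof (rule negligible_differentiable_image_lowdim)
  show "c differentiable_on UNIV"
    using assms unfolding differentiable_on_def has_vector_derivative_def differentiable_def by blast
qed simp

text \<open>The pieces of the parameter line between consecutive integers. The family need not be locally
finite in the plane, because a ridge may return close to itself infinitely often.\<close>

lemma curve_arcs:
  fixes c :: "real \<Rightarrow> real^2"
  assumes c: "\<And>t. (c has_vector_derivative c' t) (at t)" and c': "continuous_on UNIV c'"
  shows "\<exists>\<A>. countable \<A> \<and> (\<forall>\<Gamma>\<in>\<A>. Lipschitz_arc \<Gamma>) \<and> range c \<subseteq> \<Union>\<A>"
proof -
  define A where "A k = (\<lambda>t. c (real_of_int k + t)) ` {0..1}" for k
  have "Lipschitz_arc (A k)" for k
  proof -
    have "compact (c' ` {of_int k..of_int k + 1})"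
      by (intro compact_continuous_image continuous_on_subset[OF c']) auto
    then obtain L where L: "\<And>t. t \<in> {of_int k..of_int k + 1} \<Longrightarrow> norm (c' t) \<le> L"
      using compact_imp_bounded[OF \<open>compact _\<close>] unfolding bounded_iff by blast
    have L0: "0 \<le> L" using order_trans[OF norm_ge_zero L[of "of_int k"]] by simp
    have "L-lipschitz_on {0..1} (\<lambda>t. c (real_of_int k + t))"
    proof (rule lipschitz_onI[OF _ L0])
      fix s t :: real assume st: "s \<in> {0..1}" "t \<in> {0..1}"
      have "norm (c (of_int k + s) - c (of_int k + t)) \<le> L * norm ((of_int k + s) - (of_int k + t))"
      proof (rule differentiable_bound[where S="{of_int k..of_int k + 1}" and f'="\<lambda>t h. h *\<^sub>R c' t"])
        show "(c has_derivative (\<lambda>h. h *\<^sub>R c' t)) (at t within {of_int k..of_int k + 1})" for t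
          using c has_derivative_at_withinI unfolding has_vector_derivative_def by blast
        show "onorm (\<lambda>h. h *\<^sub>R c' t) \<le> L" if "t \<in> {of_int k..of_int k + 1}" for t
          by (rule onorm_le) (use L[OF that] in \<open>simp add: mult.commute[of L] mult_left_mono\<close>)
      qed (use st in auto)
      then show "dist (c (of_int k + s)) (c (of_int k + t)) \<le> L * dist s t" by (simp add: dist_norm)
    qed
    then show ?thesis unfolding Lipschitz_arc_def A_def by blast
  qed
  moreover have "range c \<subseteq> \<Union> (range A)"
  proof clarify
    fix t :: real
    have "t - of_int \<lfloor>t\<rfloor> \<in> {0..1}" by (simp add: le_diff_eq) linarith
    then have "c (of_int \<lfloor>t\<rfloor> + (t - of_int \<lfloor>t\<rfloor>)) \<in> A \<lfloor>t\<rfloor>" unfolding A_def by (rule imageI)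
    then show "c t \<in> \<Union> (range A)" by auto
  qed
  ultimately show ?thesis by (intro exI[of _ "range A"]) auto
qed

lemma bounded_segment_arc:
  fixes x0 e :: "real^2"
  shows "Lipschitz_arc ((\<lambda>t. x0 + (2 * r * t - r) *\<^sub>R e) ` {0..1::real})"
proof -
  have "(\<bar>2 * r\<bar> * norm e)-lipschitz_on {0..1} (\<lambda>t. x0 + (2 * r * t - r) *\<^sub>R e)"
  proof (rule lipschitz_onI)
    fix s t :: real
    have "x0 + (2 * r * s - r) *\<^sub>R e - (x0 + (2 * r * t - r) *\<^sub>R e) = (2 * r * (s - t)) *\<^sub>R e"
      by (simp add: algebra_simps)
    then show "dist (x0 + (2 * r * s - r) *\<^sub>R e) (x0 + (2 * r * t - r) *\<^sub>R e) \<le> \<bar>2 * r\<bar> * norm e * dist s t"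
      unfolding dist_norm by (simp add: abs_mult)
  qed simp
  then show ?thesis unfolding Lipschitz_arc_def by blast
qed

lemma singleton_arc: "Lipschitz_arc {x :: real^2}"
proof -
  have "0-lipschitz_on {0..1} (\<lambda>_::real. x)" by (simp add: lipschitz_on_def)
  then show ?thesis unfolding Lipschitz_arc_def by force
qed

text \<open>A point of \<open>\<sigma>\<close> that is neither first nor last in the direction \<open>e\<close> lies strictly between two others.\<close>

lemma segment_endpoints_finite:
  fixes \<sigma> :: "(real^2) set"
  assumes cv: "convex \<sigma>" and e: "unit_tangent \<sigma> e"
  shows "\<exists>F. finite F \<and> (\<forall>x\<in>\<sigma> - F. \<exists>h0>0. \<forall>h. \<bar>h\<bar> < h0 \<longrightarrow> x + h *\<^sub>R e \<in> \<sigma>)"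
proof -
  have ee: "e \<bullet> e = 1" using e by (simp add: unit_tangent_def norm_eq_1)
  have line: "y = x + ((y - x) \<bullet> e) *\<^sub>R e" if "x \<in> \<sigma>" "y \<in> \<sigma>" for x y
  proof -
    obtain t where "y - x = t *\<^sub>R e" using e \<open>x \<in> \<sigma>\<close> \<open>y \<in> \<sigma>\<close> unfolding unit_tangent_def by blast
    then show ?thesis using ee by (simp add: algebra_simps)
  qed
  \<comment> \<open>The last and the first point of the segment, if they exist.\<close>
  define F1 where "F1 = {x \<in> \<sigma>. \<forall>y\<in>\<sigma>. y \<bullet> e \<le> x \<bullet> e}"
  define F2 where "F2 = {x \<in> \<sigma>. \<forall>y\<in>\<sigma>. x \<bullet> e \<le> y \<bullet> e}"
  have fin: "finite A" if "\<And>x y. x \<in> A \<Longrightarrow> y \<in> A \<Longrightarrow> x \<in> \<sigma> \<and> y \<in> \<sigma> \<and> y \<bullet> e = x \<bullet> e" for A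
  proof (cases "A = {}")
    case False
    then obtain a where a: "a \<in> A" by blast
    have "A \<subseteq> {a}"
    proof
      fix b assume b: "b \<in> A"
      have "b = a + ((b - a) \<bullet> e) *\<^sub>R e" using line that[OF a b] by blast
      then show "b \<in> {a}" using that[OF a b] by (simp add: inner_diff_left)
    qed
    then show ?thesis using finite_subset by blast
  qed simp
  have "finite F1" by (rule fin) (auto simp: F1_def intro: antisym)
  moreover have "finite F2" by (rule fin) (auto simp: F2_def intro: antisym)
  moreover have "\<exists>h0>0. \<forall>h. \<bar>h\<bar> < h0 \<longrightarrow> x + h *\<^sub>R e \<in> \<sigma>" if x: "x \<in> \<sigma> - (F1 \<union> F2)" for x
  proof -
    obtain y z where yz: "y \<in> \<sigma>" "x \<bullet> e < y \<bullet> e" "z \<in> \<sigma>" "z \<bullet> e < x \<bullet> e"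
      using x unfolding F1_def F2_def by force
    define a where "a = (x - z) \<bullet> e" define b where "b = (y - x) \<bullet> e"
    have ab: "0 < a" "0 < b" using yz by (auto simp: a_def b_def inner_diff_left)
    have y: "y = x + b *\<^sub>R e" using line[of x y] x yz unfolding b_def by simp
    have z: "z = x - a *\<^sub>R e"
    proof -
      have "(z - x) \<bullet> e = - a" by (simp add: a_def inner_diff_left)
      then show ?thesis using line[of x z] x yz by simp
    qed
    have "x + h *\<^sub>R e \<in> \<sigma>" if h: "\<bar>h\<bar> < min a b" for h
    proof -
      define \<alpha> where "\<alpha> = (h + a) / (a + b)"
      have \<alpha>: "0 \<le> \<alpha>" "\<alpha> \<le> 1" using h ab by (auto simp: \<alpha>_def divide_le_eq)
      have "\<alpha> * (a + b) = h + a" using ab by (simp add: \<alpha>_def)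
      then have "\<alpha> * b - (1 - \<alpha>) * a = h" by (simp add: algebra_simps)
      moreover have "(1 - \<alpha>) *\<^sub>R z + \<alpha> *\<^sub>R y = x + (\<alpha> * b - (1 - \<alpha>) * a) *\<^sub>R e"
        unfolding y z by (simp add: algebra_simps)
      moreover have "(1 - \<alpha>) *\<^sub>R z + \<alpha> *\<^sub>R y \<in> \<sigma>" using \<alpha> by (intro convexD[OF cv yz(3,1)]) auto
      ultimately show ?thesis by simp
    qed
    then show ?thesis using ab by (intro exI[of _ "min a b"]) auto
  qed
  ultimately show ?thesis by (intro exI[of _ "F1 \<union> F2"]) auto
qed

text \<open>The segment may be unbounded or half-open, but within a disc it is covered by a compact piece of
its line; covering suffices for removability.\<close>

lemma segment_arcs:
  fixes \<sigma> :: "(real^2) set"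
  assumes e: "unit_tangent \<sigma> e"
  shows "\<exists>\<Gamma>. Lipschitz_arc \<Gamma> \<and> \<sigma> \<inter> ball p r \<subseteq> \<Gamma>"
proof (cases "\<sigma> \<inter> ball p r = {}")
  case True
  then show ?thesis using singleton_arc[of p] by (intro exI[of _ "{p}"]) simp
next
  case False
  then obtain x0 where x0: "x0 \<in> \<sigma>" "x0 \<in> ball p r" by blast
  then have r: "0 < r" using zero_le_dist[of p x0] by (metis le_less_trans mem_ball)
  define \<Gamma> where "\<Gamma> = (\<lambda>t. x0 + (2 * (2 * r) * t - 2 * r) *\<^sub>R e) ` {0..1::real}"
  have "\<sigma> \<inter> ball p r \<subseteq> \<Gamma>"
  proof
    fix x assume x: "x \<in> \<sigma> \<inter> ball p r"
    obtain t where t: "x - x0 = t *\<^sub>R e" using e x x0 unfolding unit_tangent_def by blast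
    have ne: "norm e = 1" using e by (simp add: unit_tangent_def)
    have "\<bar>t\<bar> = norm (x - x0)" unfolding t using ne by simp
    also have "\<dots> \<le> 2 * r"
      using x x0 dist_triangle[of x x0 p] by (simp add: dist_norm[symmetric] dist_commute)
    finally have tr: "\<bar>t\<bar> \<le> 2 * r" .
    have "2 * (2 * r) * ((t + 2 * r) / (4 * r)) - 2 * r = t" using r by (simp add: field_simps)
    then have "x = x0 + (2 * (2 * r) * ((t + 2 * r) / (4 * r)) - 2 * r) *\<^sub>R e"
      using t by (simp add: algebra_simps)
    moreover have "(t + 2 * r) / (4 * r) \<in> {0..1}" using tr r by (auto simp: divide_le_eq)
    ultimately show "x \<in> \<Gamma>" unfolding \<Gamma>_def by (rule image_eqI)
  qed
  then show ?thesis using bounded_segment_arc[of x0 "2 * r" e] unfolding \<Gamma>_def by blast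
qed

section \<open>Growth on spheres and touching functions\<close>

text \<open>The set \<open>K\<close> consists of the points of the disc that satisfy the bounds which a chain of steps
starting at \<open>y\<close> preserves; by the triangle inequality it is closed under short steps. A maximum point of \<open>u\<close> on \<open>K\<close> in the open
disc would therefore admit a further step inside \<open>K\<close>. The exceptional point \<open>z\<close> is not the maximum
point, since \<open>u z < u y\<close>.\<close>

lemma ascent_to_sphere:
  fixes u m :: "'a::euclidean_space \<Rightarrow> real"
  assumes cont: "continuous_on (cball z R) u" "continuous_on (cball z R) m"
    and step: "\<And>x \<epsilon> \<rho>. x \<in> ball z R \<Longrightarrow> x \<noteq> z \<Longrightarrow> 0 < m x \<Longrightarrow> 0 < \<epsilon> \<Longrightarrow> 0 < \<rho> \<Longrightarrow>
      \<exists>x'. x' \<noteq> x \<and> dist x' x < \<rho> \<and> m x \<le> m x' \<and> (m x - \<epsilon>) * dist x' x \<le> u x' - u x"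
    and y: "dist y z + r < R" "0 < r" "u z < u y" and \<epsilon>: "0 < \<epsilon>" "\<epsilon> < m y"
  shows "\<exists>x. dist x y = r \<and> u y + (m y - \<epsilon>) * r \<le> u x"
proof -
  define K where "K = {x \<in> cball y r. m y \<le> m x} \<inter> {x \<in> cball y r. u y + (m y - \<epsilon>) * dist x y \<le> u x}"
  have sub: "cball y r \<subseteq> ball z R"
  proof
    fix x assume "x \<in> cball y r"
    then show "x \<in> ball z R"
      using y(1) dist_triangle[of x z y] by (simp add: dist_commute)
  qed
  then have c: "continuous_on (cball y r) u" "continuous_on (cball y r) m"
    using cont ball_subset_cball by (meson continuous_on_subset order_trans)+
  have "closed {x \<in> cball y r. m y \<le> m x}"
    by (intro continuous_on_closed_Collect_le continuous_intros c) auto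
  moreover have "closed {x \<in> cball y r. u y + (m y - \<epsilon>) * dist x y \<le> u x}"
    by (intro continuous_on_closed_Collect_le continuous_intros c) auto
  ultimately have "closed K" unfolding K_def by blast
  moreover have "K \<subseteq> cball y r" by (auto simp: K_def)
  ultimately have "compact K"
    using bounded_subset[OF bounded_cball] by (metis compact_eq_bounded_closed)
  moreover have "y \<in> K" using y(2) by (auto simp: K_def)
  moreover have "continuous_on K u"
    by (rule continuous_on_subset[OF c(1)]) (auto simp: K_def)
  ultimately obtain x where x: "x \<in> K" "\<And>x'. x' \<in> K \<Longrightarrow> u x' \<le> u x"
    using continuous_attains_sup[of K u] by blast
  have xK: "dist x y \<le> r" "m y \<le> m x" "u y + (m y - \<epsilon>) * dist x y \<le> u x"
    using x(1) by (auto simp: K_def dist_commute)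
  have "dist x y = r"
  proof (rule ccontr)
    assume "dist x y \<noteq> r"
    then have lt: "dist x y < r" using xK by simp
    have "x \<in> ball z R" using sub x(1) by (auto simp: K_def)
    moreover have "x \<noteq> z" using x(2)[OF \<open>y \<in> K\<close>] y(3) by auto
    moreover have "0 < m x" using xK \<epsilon> by simp
    ultimately obtain x' where x': "x' \<noteq> x" "dist x' x < r - dist x y" "m x \<le> m x'"
      "(m x - \<epsilon>) * dist x' x \<le> u x' - u x"
      using step[of x \<epsilon> "r - dist x y"] \<epsilon>(1) lt by auto
    have tri: "dist x' y \<le> dist x' x + dist x y" by (rule dist_triangle)
    have "(m y - \<epsilon>) * dist x' y \<le> (m y - \<epsilon>) * (dist x' x + dist x y)"
      using tri \<epsilon> by (intro mult_left_mono) auto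
    also have "\<dots> \<le> (m x - \<epsilon>) * dist x' x + (m y - \<epsilon>) * dist x y"
      using xK(2) by (simp add: algebra_simps mult_right_mono)
    also have "\<dots> \<le> u x' - u y" using x'(4) xK(3) by linarith
    finally have "x' \<in> K"
      using x' tri xK lt by (auto simp: K_def dist_commute)
    moreover have "0 < (m x - \<epsilon>) * dist x' x"
      using x'(1) \<epsilon> xK by (intro mult_pos_pos) auto
    ultimately show False using x(2)[of x'] x'(4) by linarith
  qed
  then show ?thesis using xK(3) by metis
qed

text \<open>Start the ascent at points \<open>y\<close> that tend to \<open>z\<close> in the direction of the gradient, so that
\<open>u z < u y\<close>, and let the loss \<open>\<epsilon>\<close> in the rate tend to 0.\<close>

lemma growth_on_spheres:
  fixes u m :: "'a::euclidean_space \<Rightarrow> real"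
  assumes cont: "continuous_on (cball z R) u" "continuous_on (cball z R) m"
    and step: "\<And>x \<epsilon> \<rho>. x \<in> ball z R \<Longrightarrow> x \<noteq> z \<Longrightarrow> 0 < m x \<Longrightarrow> 0 < \<epsilon> \<Longrightarrow> 0 < \<rho> \<Longrightarrow>
      \<exists>x'. x' \<noteq> x \<and> dist x' x < \<rho> \<and> m x \<le> m x' \<and> (m x - \<epsilon>) * dist x' x \<le> u x' - u x"
    and r: "0 < r" "r < R" and mz: "0 < m z" and g: "GDERIV u z :> g" "g \<noteq> 0"
  shows "\<exists>x. dist x z = r \<and> u z + m z * r \<le> u x"
proof -
  from GDERIV_increment[OF g(1), of "g \<bullet> g / 2" g] g(2)
  obtain h0 where h0: "h0 > 0" "\<And>h. 0 < h \<Longrightarrow> h < h0 \<Longrightarrow>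
      \<bar>u (z + h *\<^sub>R g) - u z - h * (g \<bullet> g)\<bar> \<le> g \<bullet> g / 2 * h" by auto
  have up: "u z < u (z + h *\<^sub>R g)" if "0 < h" "h < h0" for h
  proof -
    have "0 < h * (g \<bullet> g)" using that g(2) by simp
    moreover have "- (u (z + h *\<^sub>R g) - u z - h * (g \<bullet> g)) \<le> g \<bullet> g / 2 * h"
      by (rule abs_le_D2[OF h0(2)[OF that]])
    moreover have "g \<bullet> g / 2 * h = h * (g \<bullet> g) / 2" by simp
    ultimately show ?thesis by linarith
  qed
  define y where "y n = z + (1 / real (Suc n)) *\<^sub>R g" for n
  define \<epsilon> where "\<epsilon> n = 1 / real (Suc n)" for n
  have \<epsilon>0: "\<epsilon> \<longlonglongrightarrow> 0" unfolding \<epsilon>_def using LIMSEQ_inverse_real_of_nat by (simp add: inverse_eq_divide)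
  have "(\<lambda>n. z + \<epsilon> n *\<^sub>R g) \<longlonglongrightarrow> z + 0 *\<^sub>R g" by (intro tendsto_intros \<epsilon>0)
  moreover have "y = (\<lambda>n. z + \<epsilon> n *\<^sub>R g)" by (simp add: fun_eq_iff y_def \<epsilon>_def)
  ultimately have y0: "y \<longlonglongrightarrow> z" by simp
  have zi: "z \<in> interior (cball z R)" using r by simp
  have um: "isCont u z" "isCont m z"
    using cont zi continuous_on_interior by blast+
  have my: "(\<lambda>n. m (y n)) \<longlonglongrightarrow> m z" using isCont_tendsto_compose[OF um(2) y0] .
  have uy: "(\<lambda>n. u (y n)) \<longlonglongrightarrow> u z" using isCont_tendsto_compose[OF um(1) y0] .
  have "(\<lambda>n. m (y n) - \<epsilon> n) \<longlonglongrightarrow> m z - 0" by (intro tendsto_intros my \<epsilon>0)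
  then have ev1: "\<forall>\<^sub>F n in sequentially. 0 < m (y n) - \<epsilon> n"
    using mz by (intro order_tendstoD(1)) auto
  have "(\<lambda>n. dist (y n) z + r) \<longlonglongrightarrow> dist z z + r" by (intro tendsto_intros y0)
  then have ev2: "\<forall>\<^sub>F n in sequentially. dist (y n) z + r < R"
    using r by (intro order_tendstoD(2)) auto
  have ev3: "\<forall>\<^sub>F n in sequentially. \<epsilon> n < h0" using \<epsilon>0 h0(1) by (intro order_tendstoD(2))
  obtain N where N: "\<And>n. n \<ge> N \<Longrightarrow> 0 < m (y n) - \<epsilon> n \<and> dist (y n) z + r < R \<and> \<epsilon> n < h0"
    using eventually_conj[OF ev1 eventually_conj[OF ev2 ev3]] unfolding eventually_sequentially by blast
  have "\<exists>x. dist x (y n) = r \<and> u (y n) + (m (y n) - \<epsilon> n) * r \<le> u x" if "n \<ge> N" for n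
  proof (rule ascent_to_sphere[OF cont step])
    show "0 < \<epsilon> n" by (simp add: \<epsilon>_def)
    show "u z < u (y n)" unfolding y_def using up[of "\<epsilon> n"] N[OF that] by (simp add: \<epsilon>_def)
  qed (use N[OF that] r in auto)
  then obtain x where x: "\<And>n. n \<ge> N \<Longrightarrow> dist (x n) (y n) = r \<and> u (y n) + (m (y n) - \<epsilon> n) * r \<le> u (x n)"
    by metis
  have xR: "x (n + N) \<in> cball z R" for n
    using x[of "n + N"] N[of "n + N"] dist_triangle[of "x (n + N)" z "y (n + N)"]
    by (auto simp: dist_commute)
  obtain l s where l: "l \<in> cball z R" "strict_mono (s :: nat \<Rightarrow> nat)" "((\<lambda>n. x (n + N)) \<circ> s) \<longlonglongrightarrow> l"
    using compact_cball[of z R, unfolded compact_def, rule_format, of "\<lambda>n. x (n + N)"] xR by blast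
  define k where "k n = s n + N" for n
  have ks: "strict_mono k" using l(2) by (auto simp: k_def strict_mono_def)
  have kN: "k n \<ge> N" for n by (simp add: k_def)
  have xl: "(\<lambda>n. x (k n)) \<longlonglongrightarrow> l" using l(3) by (simp add: o_def k_def)
  have sub: "(\<lambda>n. f (k n)) \<longlonglongrightarrow> a" if "f \<longlonglongrightarrow> a" for f :: "nat \<Rightarrow> 'b::topological_space" and a
    using LIMSEQ_subseq_LIMSEQ[OF that ks] by (simp add: o_def)
  have "(\<lambda>n. dist (x (k n)) (y (k n))) \<longlonglongrightarrow> dist l z"
    by (intro tendsto_intros xl sub[OF y0])
  moreover have "(\<lambda>n. dist (x (k n)) (y (k n))) = (\<lambda>_. r)" using x[OF kN] by blast
  ultimately have "dist l z = r" using LIMSEQ_unique[OF _ tendsto_const] by metis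
  have "u z + m z * r \<le> u l"
  proof (rule LIMSEQ_le)
    have "(\<lambda>n. u (y (k n)) + (m (y (k n)) - \<epsilon> (k n)) * r) \<longlonglongrightarrow> u z + (m z - 0) * r"
      by (intro tendsto_intros sub[OF uy] sub[OF my] sub[OF \<epsilon>0])
    then show "(\<lambda>n. u (y (k n)) + (m (y (k n)) - \<epsilon> (k n)) * r) \<longlonglongrightarrow> u z + m z * r" by simp
    have "l \<in> interior (cball z R)" using \<open>dist l z = r\<close> r by (simp add: dist_commute)
    then have "isCont u l" using cont(1) continuous_on_interior by blast
    then show "(\<lambda>n. u (x (k n))) \<longlonglongrightarrow> u l" using xl isCont_tendsto_compose by blast
    show "\<exists>N. \<forall>n\<ge>N. u (y (k n)) + (m (y (k n)) - \<epsilon> (k n)) * r \<le> u (x (k n))"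
      using x[OF kN] by blast
  qed
  then show ?thesis using \<open>dist l z = r\<close> by blast
qed

lemma second_order_Taylor:
  assumes V: "open V" "z \<in> V" and C2: "C2_on V \<phi>" and e: "0 < e"
  shows "\<exists>d>0. \<forall>v. norm v < d \<longrightarrow>
    \<bar>\<phi> (z + v) - \<phi> z - grad \<phi> z \<bullet> v - (v \<bullet> (hess \<phi> z *v v)) / 2\<bar> \<le> e * (norm v)\<^sup>2"
proof -
  have dg: "grad \<phi> differentiable (at z)" and C1: "C1_on V \<phi>" using C2 V by (auto simp: C2_on_def)
  have gr: "GDERIV \<phi> x :> grad \<phi> x" if "x \<in> V" for x
    using C1 that differentiable_imp_GDERIV_grad by (auto simp: C1_on_def)
  define H where "H = frechet_derivative (grad \<phi>) (at z)"
  have H: "(grad \<phi> has_derivative H) (at z)" using dg frechet_derivative_works H_def by blast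
  interpret H: bounded_linear H using H by (rule has_derivative_bounded_linear)
  have hess: "hess \<phi> z *v v = H v" for v
    unfolding hess_def H_def[symmetric] using H.linear by (simp add: matrix_works linear_matrix_vector_mul_eq)
  obtain d1 where d1: "d1 > 0" "ball z d1 \<subseteq> V" using V open_contains_ball by blast
  obtain d2 where d2: "d2 > 0" "\<And>y. norm (y - z) < d2 \<Longrightarrow>
      norm (grad \<phi> y - grad \<phi> z - H (y - z)) \<le> e * norm (y - z)"
    using H e unfolding has_derivative_at_alt by blast
  show ?thesis
  proof (intro exI[of _ "min d1 d2"] conjI allI impI)
    show "0 < min d1 d2" using d1 d2 by simp
    fix v :: "real^2" assume v: "norm v < min d1 d2"
    define q where "q t = \<phi> (z + t *\<^sub>R v) - t * (grad \<phi> z \<bullet> v) - t\<^sup>2 / 2 * (v \<bullet> H v)" for t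
    have small: "norm (t *\<^sub>R v) \<le> norm v" if "0 \<le> t" "t \<le> 1" for t
      using that by (simp add: mult_left_le_one_le)
    have q': "(q has_real_derivative (v \<bullet> (grad \<phi> (z + t *\<^sub>R v) - grad \<phi> z - t *\<^sub>R H v))) (at t)"
      if t: "0 \<le> t" "t \<le> 1" for t
    proof -
      have "z + t *\<^sub>R v \<in> V" using d1(2) small[OF t] v by (auto simp: dist_norm subset_eq)
      then have "(\<phi> has_derivative (\<lambda>h. h \<bullet> grad \<phi> (z + t *\<^sub>R v))) (at (z + t *\<^sub>R v))"
        using gr unfolding gderiv_def by blast
      moreover have "((\<lambda>t. z + t *\<^sub>R v) has_derivative (\<lambda>h. h *\<^sub>R v)) (at t)"
        by (auto intro!: derivative_eq_intros)
      ultimately have "((\<lambda>t. \<phi> (z + t *\<^sub>R v)) has_derivative (\<lambda>h. (h *\<^sub>R v) \<bullet> grad \<phi> (z + t *\<^sub>R v))) (at t)"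
        using has_derivative_compose by blast
      then have d: "((\<lambda>t. \<phi> (z + t *\<^sub>R v)) has_real_derivative v \<bullet> grad \<phi> (z + t *\<^sub>R v)) (at t)"
        unfolding has_field_derivative_def by (simp add: mult.commute[of _ "_ \<bullet> _"])
      show ?thesis unfolding q_def
        by (auto intro!: derivative_eq_intros d simp: algebra_simps inner_commute)
    qed
    have "\<bar>q 1 - q 0\<bar> \<le> (e * (norm v)\<^sup>2) * \<bar>1 - 0\<bar>"
    proof -
      have "norm (q 1 - q 0) \<le> (e * (norm v)\<^sup>2) * norm (1 - 0 :: real)"
      proof (rule field_differentiable_bound[where S="{0..1}"])
        show "(q has_field_derivative (v \<bullet> (grad \<phi> (z + t *\<^sub>R v) - grad \<phi> z - t *\<^sub>R H v))) (at t within {0..1})"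
          if "t \<in> {0..1}" for t using q' that has_field_derivative_at_within by fastforce
        show "norm (v \<bullet> (grad \<phi> (z + t *\<^sub>R v) - grad \<phi> z - t *\<^sub>R H v)) \<le> e * (norm v)\<^sup>2"
          if "t \<in> {0..1}" for t
        proof -
          have t: "0 \<le> t" "t \<le> 1" using that by auto
          have "norm (grad \<phi> (z + t *\<^sub>R v) - grad \<phi> z - H (t *\<^sub>R v)) \<le> e * norm (t *\<^sub>R v)"
            using d2(2)[of "z + t *\<^sub>R v"] small[OF t] v by auto
          also have "\<dots> \<le> e * norm v" using e small[OF t] by (intro mult_left_mono) auto
          finally have 1: "norm (grad \<phi> (z + t *\<^sub>R v) - grad \<phi> z - t *\<^sub>R H v) \<le> e * norm v"
            by (simp add: H.scaleR)
          have "norm (v \<bullet> (grad \<phi> (z + t *\<^sub>R v) - grad \<phi> z - t *\<^sub>R H v)) \<le>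
            norm v * norm (grad \<phi> (z + t *\<^sub>R v) - grad \<phi> z - t *\<^sub>R H v)"
            by (simp add: Cauchy_Schwarz_ineq2)
          also have "\<dots> \<le> norm v * (e * norm v)" using 1 by (intro mult_left_mono) auto
          finally show ?thesis by (simp add: power2_eq_square mult_ac)
        qed
      qed auto
      then show ?thesis by simp
    qed
    then show "\<bar>\<phi> (z + v) - \<phi> z - grad \<phi> z \<bullet> v - v \<bullet> (hess \<phi> z *v v) / 2\<bar> \<le> e * (norm v)\<^sup>2"
      by (simp add: q_def hess)
  qed
qed

text \<open>Let \<open>x = z + r d\<close> be the point of the sphere of radius \<open>r\<close> given by the growth of \<open>u \<le> \<phi>\<close>. The expansion
gives \<open>|g| \<le> g \<bullet> d + r (d \<bullet> H d)/2 + o(r)\<close>. To first order this forces \<open>d\<close> to converge to \<open>g/|g|\<close>; and as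
\<open>g \<bullet> d \<le> |g|\<close>, what remains after division by \<open>r\<close> is \<open>0 \<le> d \<bullet> H d\<close> in the limit. The expansion is a hypothesis,
so that the lemma also applies to \<open>-\<phi>\<close>.\<close>

lemma touching_from_above:
  fixes H :: "real^2^2"
  assumes Taylor: "\<And>e. 0 < e \<Longrightarrow> \<exists>d>0. \<forall>v. norm v < d \<longrightarrow>
      \<bar>\<phi> (z + v) - \<phi> z - g \<bullet> v - (v \<bullet> (H *v v)) / 2\<bar> \<le> e * (norm v)\<^sup>2"
    and touch: "\<phi> z = u z" and above: "\<forall>\<^sub>F x in nhds z. u x \<le> \<phi> x" and R: "0 < R"
    and growth: "\<And>r. 0 < r \<Longrightarrow> r < R \<Longrightarrow> \<exists>x. dist x z = r \<and> u z + norm g * r \<le> u x"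
  shows "0 \<le> g \<bullet> (H *v g)"
proof (cases "g = 0")
  case False
  obtain \<rho> where \<rho>: "\<rho> > 0" "\<And>x. dist x z < \<rho> \<Longrightarrow> u x \<le> \<phi> x"
    using above unfolding eventually_nhds_metric by blast
  define r where "r n = min R \<rho> / real (n + 2)" for n
  have r: "0 < r n" "r n < R" "r n < \<rho>" for n
  proof -
    have "min R \<rho> * 1 < min R \<rho> * real (n + 2)" using R \<rho>(1) by (intro mult_strict_left_mono) auto
    then have "r n < min R \<rho>" unfolding r_def by (subst divide_less_eq) simp
    then show "0 < r n" "r n < R" "r n < \<rho>" using R \<rho>(1) by (auto simp: r_def)
  qed
  have r0: "r \<longlonglongrightarrow> 0"
    unfolding r_def using LIMSEQ_ignore_initial_segment[OF lim_const_over_n[of "min R \<rho>"], of 2] by simp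
  have "\<forall>n. \<exists>x. dist x z = r n \<and> u z + norm g * r n \<le> u x" using growth r by blast
  then obtain x where "\<forall>n. dist (x n) z = r n \<and> u z + norm g * r n \<le> u (x n)"
    by (rule choice[THEN exE])
  then have x: "\<And>n. dist (x n) z = r n" "\<And>n. u z + norm g * r n \<le> u (x n)" by auto
  define d where "d n = (x n - z) /\<^sub>R r n" for n
  have nd: "norm (d n) = 1" for n using x(1)[of n] r(1)[of n] by (simp add: d_def dist_norm)
  have xd: "x n = z + r n *\<^sub>R d n" for n using r(1)[of n] by (simp add: d_def)
  have grow: "norm g * r n \<le> \<phi> (z + r n *\<^sub>R d n) - \<phi> z" for n
    using x(2)[of n] \<rho>(2)[of "x n"] x(1)[of n] r(3)[of n] touch by (simp add: xd)
  have key: "\<forall>\<^sub>F n in sequentially. norm g \<le> g \<bullet> d n + r n * ((d n \<bullet> (H *v d n)) / 2 + e)" if epos: "e > 0" for e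
  proof -
    obtain \<delta> where \<delta>: "\<delta> > 0" "\<And>v. norm v < \<delta> \<Longrightarrow>
        \<bar>\<phi> (z + v) - \<phi> z - g \<bullet> v - (v \<bullet> (H *v v)) / 2\<bar> \<le> e * (norm v)\<^sup>2"
      using Taylor[OF epos] by blast
    have "\<forall>\<^sub>F n in sequentially. r n < \<delta>" using r0 \<delta>(1) by (rule order_tendstoD(2))
    then show ?thesis
    proof eventually_elim
      case (elim n)
      have "norm (r n *\<^sub>R d n) = r n" using r(1)[of n] nd by simp
      then have "\<phi> (z + r n *\<^sub>R d n) - \<phi> z \<le> g \<bullet> (r n *\<^sub>R d n) + ((r n *\<^sub>R d n) \<bullet> (H *v (r n *\<^sub>R d n))) / 2 + e * (r n)\<^sup>2"
        using \<delta>(2)[of "r n *\<^sub>R d n"] elim by simp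
      also have "\<dots> = r n * (g \<bullet> d n + r n * ((d n \<bullet> (H *v d n)) / 2 + e))"
        by (simp add: algebra_simps power2_eq_square matrix_vector_mult_scaleR)
      finally have "r n * norm g \<le> r n * (g \<bullet> d n + r n * ((d n \<bullet> (H *v d n)) / 2 + e))"
        using grow[of n] by (simp add: mult.commute)
      then show ?case using r(1)[of n] by simp
    qed
  qed
  have "\<And>n. d n \<in> sphere 0 1" using nd by simp
  then obtain l s where l: "l \<in> sphere 0 1" "strict_mono (s :: nat \<Rightarrow> nat)" "(d \<circ> s) \<longlonglongrightarrow> l"
    using compact_sphere[of "0::real^2" 1, unfolded compact_def, rule_format, of d] by blast
  have dl: "(\<lambda>n. d (s n)) \<longlonglongrightarrow> l" using l(3) by (simp add: o_def)
  have rs: "(\<lambda>n. r (s n)) \<longlonglongrightarrow> 0" using LIMSEQ_subseq_LIMSEQ[OF r0 l(2)] by (simp add: o_def)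
  have ev: "\<forall>\<^sub>F n in sequentially. P (s n)" if "\<forall>\<^sub>F n in sequentially. P n" for P
    using eventually_subseq[OF l(2) that] .
  have Hd: "(\<lambda>n. H *v d (s n)) \<longlonglongrightarrow> H *v l"
    by (rule bounded_linear.tendsto[OF matrix_vector_mul_bounded_linear dl])
  have nl: "norm l = 1" using l(1) by simp
  have "norm g \<le> g \<bullet> l"
  proof (rule tendsto_le[OF _ _ tendsto_const])
    have "(\<lambda>n. g \<bullet> d (s n) + r (s n) * ((d (s n) \<bullet> (H *v d (s n))) / 2 + 1)) \<longlonglongrightarrow>
        g \<bullet> l + 0 * ((l \<bullet> (H *v l)) / 2 + 1)"
      by (intro tendsto_intros dl rs Hd) simp
    then show "(\<lambda>n. g \<bullet> d (s n) + r (s n) * ((d (s n) \<bullet> (H *v d (s n))) / 2 + 1)) \<longlonglongrightarrow> g \<bullet> l" by simp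
    show "\<forall>\<^sub>F n in sequentially. norm g \<le> g \<bullet> d (s n) + r (s n) * ((d (s n) \<bullet> (H *v d (s n))) / 2 + 1)"
      using ev[OF key[of 1]] by simp
  qed simp
  moreover have "g \<bullet> l \<le> norm g" using norm_cauchy_schwarz[of g l] nl by simp
  ultimately have "g \<bullet> l = norm g * norm l" using nl by simp
  then have gl: "g = norm g *\<^sub>R l" using norm_cauchy_schwarz_eq[of g l] nl by simp
  have "0 \<le> (l \<bullet> (H *v l)) / 2 + e" if "e > 0" for e
  proof (rule tendsto_le[OF _ _ tendsto_const])
    show "(\<lambda>n. (d (s n) \<bullet> (H *v d (s n))) / 2 + e) \<longlonglongrightarrow> (l \<bullet> (H *v l)) / 2 + e"
      by (intro tendsto_intros dl Hd) simp
    show "\<forall>\<^sub>F n in sequentially. 0 \<le> (d (s n) \<bullet> (H *v d (s n))) / 2 + e"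
      using ev[OF key[OF that]]
    proof eventually_elim
      case (elim n)
      have "g \<bullet> d (s n) \<le> norm g" using norm_cauchy_schwarz[of g "d (s n)"] nd by simp
      then have "0 \<le> r (s n) * ((d (s n) \<bullet> (H *v d (s n))) / 2 + e)" using elim by linarith
      then show ?case using r(1)[of "s n"] by (simp add: zero_le_mult_iff)
    qed
  qed simp
  then have "0 \<le> (l \<bullet> (H *v l)) / 2" by (rule field_le_epsilon)
  moreover have "g \<bullet> (H *v g) = (norm g)\<^sup>2 * (l \<bullet> (H *v l))"
    by (subst (1 2) gl) (simp add: matrix_vector_mult_scaleR power2_eq_square)
  ultimately show ?thesis by simp
qed simp

text \<open>Steps along \<open>v\<close> gain \<open>v \<bullet> g = m x\<close> per unit of the parameter at a length of at most \<open>1 + \<delta>\<close> per unit. For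
\<open>\<delta>\<close> small this is a rate of at least \<open>m x - \<epsilon>\<close>, with room for the error of the first-order expansion.\<close>

lemma step_of_descent:
  fixes u m :: "real^2 \<Rightarrow> real"
  assumes g: "GDERIV u x :> g" and m: "0 < m x"
    and desc: "\<And>\<delta>. 0 < \<delta> \<Longrightarrow> \<exists>v. norm v \<le> 1 + \<delta> \<and> v \<bullet> g = m x \<and>
      (\<exists>h0>0. \<forall>h. 0 < h \<and> h < h0 \<longrightarrow> m x \<le> m (x + h *\<^sub>R v))"
    and \<epsilon>: "0 < \<epsilon>" and \<rho>: "0 < \<rho>"
  shows "\<exists>x'. x' \<noteq> x \<and> dist x' x < \<rho> \<and> m x \<le> m x' \<and> (m x - \<epsilon>) * dist x' x \<le> u x' - u x"
proof -
  \<comment> \<open>Half of \<open>\<epsilon>\<close> pays for the length of \<open>v\<close>, the other half for the error of the expansion. If the rate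
    \<open>m x - \<epsilon>\<close> is not positive, it is enough not to lose height; hence the bound \<open>e \<le> m x\<close>.\<close>
  define \<delta> where "\<delta> = \<epsilon> / (2 * m x)"
  define e where "e = min (\<epsilon> / 2) (m x)"
  have \<delta>: "0 < \<delta>" "\<delta> * m x = \<epsilon> / 2" using \<epsilon> m by (auto simp: \<delta>_def)
  have e: "0 < e" "e \<le> \<epsilon> / 2" "e \<le> m x" using \<epsilon> m by (auto simp: e_def)
  obtain v h0 where v: "norm v \<le> 1 + \<delta>" "v \<bullet> g = m x" and h0: "0 < h0" "\<And>h. 0 < h \<Longrightarrow> h < h0 \<Longrightarrow> m x \<le> m (x + h *\<^sub>R v)"
    using desc[OF \<delta>(1)] by blast
  obtain h1 where h1: "0 < h1" "\<And>h. 0 < h \<Longrightarrow> h < h1 \<Longrightarrow> \<bar>u (x + h *\<^sub>R v) - u x - h * (v \<bullet> g)\<bar> \<le> e * h"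
    using GDERIV_increment[OF g e(1), of v] by blast
  have v0: "v \<noteq> 0" using v(2) m by auto
  have "0 < min (min h0 h1) (\<rho> / norm v)" using h0 h1 \<rho> v0 by simp
  then obtain h where "0 < h" "h < min (min h0 h1) (\<rho> / norm v)" using dense by blast
  then have h: "0 < h" "h < h0" "h < h1" "h < \<rho> / norm v" by auto
  have d: "dist (x + h *\<^sub>R v) x = h * norm v" using h(1) by (simp add: dist_norm)
  have key: "(m x - \<epsilon>) * norm v \<le> m x - e"
  proof (cases "m x - \<epsilon> \<le> 0")
    case True
    then have "(m x - \<epsilon>) * norm v \<le> 0" by (simp add: mult_nonpos_nonneg)
    then show ?thesis using e(3) by linarith
  next
    case False
    then have "(m x - \<epsilon>) * norm v \<le> (m x - \<epsilon>) * (1 + \<delta>)" using v(1) by (intro mult_left_mono) auto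
    also have "\<dots> = m x - \<epsilon> + \<delta> * m x - \<epsilon> * \<delta>" by (simp add: algebra_simps)
    also have "\<dots> \<le> m x - e" using \<delta> \<epsilon> e(2) mult_pos_pos[OF \<epsilon> \<delta>(1)] by linarith
    finally show ?thesis .
  qed
  have "(m x - \<epsilon>) * (h * norm v) \<le> h * (m x - e)"
    using mult_left_mono[OF key, of h] h(1) by (simp add: mult_ac)
  also have "\<dots> \<le> u (x + h *\<^sub>R v) - u x"
    using abs_le_D2[OF h1(2)[OF h(1,3)]] unfolding v(2) by (simp add: algebra_simps)
  finally have "(m x - \<epsilon>) * dist (x + h *\<^sub>R v) x \<le> u (x + h *\<^sub>R v) - u x" unfolding d .
  moreover have "dist (x + h *\<^sub>R v) x < \<rho>" unfolding d using h(4) v0 by (simp add: pos_less_divide_eq)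
  moreover have "x + h *\<^sub>R v \<noteq> x" using h(1) v0 by simp
  ultimately show ?thesis using h0(2)[OF h(1,2)] by blast
qed

text \<open>A function that touches \<open>u\<close> at \<open>z\<close> has gradient \<open>V z\<close> there. The two inequalities follow from the
growth of \<open>u\<close> and of \<open>-u\<close>, respectively.\<close>

lemma infinity_harmonic_of_growth:
  fixes u :: "real^2 \<Rightarrow> real"
  assumes g: "\<And>x. x \<in> \<Omega> \<Longrightarrow> GDERIV u x :> V x"
    and growth: "\<And>z s. z \<in> \<Omega> \<Longrightarrow> V z \<noteq> 0 \<Longrightarrow> s \<in> {1, -1} \<Longrightarrow>
      \<exists>R>0. \<forall>r. 0 < r \<and> r < R \<longrightarrow> (\<exists>x. dist x z = r \<and> s * u z + norm (V z) * r \<le> s * u x)"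
  shows "infinity_harmonic \<Omega> u"
  unfolding infinity_harmonic_def
proof (intro conjI ballI allI impI)
  show "continuous_on \<Omega> u"
    using g unfolding gderiv_def by (auto intro!: continuous_at_imp_continuous_on has_derivative_continuous)
  fix z W \<phi> assume z: "z \<in> \<Omega>" and W: "open W \<and> z \<in> W \<and> C2_on W \<phi> \<and> \<phi> z = u z"
  note Taylor = second_order_Taylor[of W z \<phi>]
  have "GDERIV \<phi> z :> grad \<phi> z"
    using W differentiable_imp_GDERIV_grad by (auto simp: C2_on_def C1_on_def)
  then have diff: "((\<lambda>x. \<phi> x - u x) has_derivative (\<lambda>h. h \<bullet> (grad \<phi> z - V z))) (at z)"
    using GDERIV_diff[OF _ g[OF z]] unfolding gderiv_def by blast
  have eqI: "grad \<phi> z = V z" if "(\<lambda>h. h \<bullet> (grad \<phi> z - V z)) = (\<lambda>h. 0)"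
  proof -
    have "(grad \<phi> z - V z) \<bullet> (grad \<phi> z - V z) = 0" using that by (rule fun_cong)
    then show ?thesis by (simp only: inner_eq_zero_iff right_minus_eq)
  qed
  have nhd: "\<exists>S. open S \<and> z \<in> S \<and> (\<forall>x\<in>S. P x)" if "\<forall>\<^sub>F x in nhds z. P x" for P
    using that unfolding eventually_nhds by blast
  {
    assume above: "\<forall>\<^sub>F x in nhds z. u x \<le> \<phi> x"
    obtain S where S: "open S" "z \<in> S" "\<And>x. x \<in> S \<Longrightarrow> u x \<le> \<phi> x" using nhd[OF above] by blast
    have "(\<lambda>h. h \<bullet> (grad \<phi> z - V z)) = (\<lambda>h. 0)"
      by (rule differential_zero_maxmin[OF S(2,1) diff]) (use S(3) W in auto)
    then have gz: "grad \<phi> z = V z" by (rule eqI)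
    show "0 \<le> grad \<phi> z \<bullet> (hess \<phi> z *v grad \<phi> z)"
    proof (cases "V z = 0")
      case False
      obtain R where R: "0 < R" "\<And>r. 0 < r \<Longrightarrow> r < R \<Longrightarrow> \<exists>x. dist x z = r \<and> 1 * u z + norm (V z) * r \<le> 1 * u x"
        using growth[OF z False, of 1] by auto
      show ?thesis
        by (rule touching_from_above[OF _ _ above R(1)]) (use Taylor W R(2) gz in auto)
    qed (simp add: gz)
  }
  {
    assume below: "\<forall>\<^sub>F x in nhds z. \<phi> x \<le> u x"
    obtain S where S: "open S" "z \<in> S" "\<And>x. x \<in> S \<Longrightarrow> \<phi> x \<le> u x" using nhd[OF below] by blast
    have "(\<lambda>h. h \<bullet> (grad \<phi> z - V z)) = (\<lambda>h. 0)"
      by (rule differential_zero_maxmin[OF S(2,1) diff]) (use S(3) W in auto)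
    then have gz: "grad \<phi> z = V z" by (rule eqI)
    show "grad \<phi> z \<bullet> (hess \<phi> z *v grad \<phi> z) \<le> 0"
    proof (cases "V z = 0")
      case False
      obtain R where R: "0 < R" "\<And>r. 0 < r \<Longrightarrow> r < R \<Longrightarrow> \<exists>x. dist x z = r \<and> - 1 * u z + norm (V z) * r \<le> - 1 * u x"
        using growth[OF z False, of "-1"] by auto
      have neg: "(- hess \<phi> z) *v v = - (hess \<phi> z *v v)" for v
        by (simp add: matrix_vector_mult_def vec_eq_iff sum_negf)
      have "0 \<le> (- grad \<phi> z) \<bullet> ((- hess \<phi> z) *v (- grad \<phi> z))"
      proof (rule touching_from_above[where \<phi>="\<lambda>x. - \<phi> x" and u="\<lambda>x. - u x" and z=z, OF _ _ _ R(1)])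
        fix e :: real assume e: "0 < e"
        obtain d where d: "0 < d" "\<And>v. norm v < d \<Longrightarrow>
            \<bar>\<phi> (z + v) - \<phi> z - grad \<phi> z \<bullet> v - (v \<bullet> (hess \<phi> z *v v)) / 2\<bar> \<le> e * (norm v)\<^sup>2"
          using Taylor e W by blast
        show "\<exists>d>0. \<forall>v. norm v < d \<longrightarrow>
            \<bar>- \<phi> (z + v) - - \<phi> z - (- grad \<phi> z) \<bullet> v - (v \<bullet> ((- hess \<phi> z) *v v)) / 2\<bar> \<le> e * (norm v)\<^sup>2"
        proof (intro exI[of _ d] conjI d(1) allI impI)
          fix v :: "real^2" assume "norm v < d"
          have "- \<phi> (z + v) - - \<phi> z - (- grad \<phi> z) \<bullet> v - (v \<bullet> ((- hess \<phi> z) *v v)) / 2 =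
              - (\<phi> (z + v) - \<phi> z - grad \<phi> z \<bullet> v - (v \<bullet> (hess \<phi> z *v v)) / 2)"
            unfolding neg by simp
          then show "\<bar>- \<phi> (z + v) - - \<phi> z - (- grad \<phi> z) \<bullet> v - (v \<bullet> ((- hess \<phi> z) *v v)) / 2\<bar> \<le> e * (norm v)\<^sup>2"
            using d(2)[OF \<open>norm v < d\<close>] by (simp only: abs_minus_cancel)
        qed
      qed (use W below R(2) gz in auto)
      moreover have "(- hess \<phi> z) *v (- grad \<phi> z) = hess \<phi> z *v grad \<phi> z"
        unfolding neg using matrix_vector_mult_scaleR[of "hess \<phi> z" "-1" "grad \<phi> z"] by simp
      ultimately show ?thesis by simp
    qed (simp add: gz)
  }
qed

section \<open>The potential of a unit-calibrated cluster\<close>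

theorem theorem4p1:
  fixes \<Omega> :: "(real^2) set" and w :: "real^2 \<Rightarrow> ereal" and \<nu> :: "real^2 \<Rightarrow> real^2"
  assumes "open \<Omega>" and "connected \<Omega>" and "simply_connected \<Omega>"
    and "mixed_IMCF_cluster \<Omega> w \<nu>" and "unit_calibrated \<Omega> w \<nu>"
  shows "\<exists>u. infinity_harmonic \<Omega> u \<and> C1_on \<Omega> u \<and>
           (\<forall>x\<in>\<Omega>. grad u x = exp_minus (w x) *\<^sub>R perp (\<nu> x))"
proof -
  define wr where "wr x = real_of_ereal (w x)" for x
  obtain Z \<S> \<D> chi where
    Z: "Z \<subseteq> \<Omega>" and seg: "\<forall>\<sigma>\<in>\<S>. line_segment \<sigma> \<and> closedin (top_of_set \<Omega>) \<sigma>"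
    and F_cont: "continuous_on \<Omega> (\<lambda>x. exp_minus (w x) *\<^sub>R \<nu> x)"
    and wZ: "{x\<in>\<Omega>. w x = \<infinity>} \<subseteq> Z"
    and seg_data: "\<forall>\<sigma>\<in>\<S>. \<exists>(a::real) n e. (\<forall>x\<in>\<sigma>. w x = ereal a \<and> \<nu> x = n) \<and>
           unit_tangent \<sigma> e \<and> n \<in> {perp e, - perp e}"
    and locfin: "\<forall>K. compact K \<and> K \<subseteq> \<Omega> \<longrightarrow> finite (Z \<inter> K) \<and> finite {\<sigma>\<in>\<S>. \<sigma> \<inter> K \<noteq> {}}"
    and simple: "simple_IMCF_cluster (\<Omega> - (Z \<union> \<Union>\<S>)) (\<lambda>x. real_of_ereal (w x)) \<nu> \<D> chi"
    using assms(4) unfolding mixed_IMCF_cluster_def by (elim exE conjE) (rule that; assumption)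
  \<comment> \<open>The part of the domain on which the cluster is simple.\<close>
  define U where "U = \<Omega> - (Z \<union> \<Union>\<S>)"
  note simple' = simple[folded U_def wr_def[abs_def], unfolded simple_IMCF_cluster_def]
  have U: "open U" using simple' by - (elim conjE, assumption)
  have disj: "disjoint \<D>" using simple' by - (elim conjE, assumption)
  have wc: "continuous_on U wr" using simple' by - (elim conjE, assumption)
  have \<nu>c: "continuous_on U \<nu>" using simple' by - (elim conjE, assumption)
  have dom_all: "\<forall>D\<in>\<D>. C1_domain_in U D" using simple' by - (elim conjE, assumption)
  have chi_all: "\<forall>D\<in>\<D>. chi D \<in> {1, -1}" using simple' by - (elim conjE, assumption)
  have regions: "\<forall>D\<in>\<D>. locally_Lipschitz_on D wr \<and>
      (AE x in lebesgue. x \<in> D \<longrightarrow>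
         wr differentiable (at x) \<and> (chi D *\<^sub>R \<nu> x) \<bullet> grad wr x = norm (grad wr x)) \<and>
      weak_divergence_eq D (\<lambda>x. chi D *\<^sub>R \<nu> x) (\<lambda>x. norm (grad wr x)) \<and>
      (\<forall>p \<in> frontier D \<inter> U. outer_unit_normal D p (chi D *\<^sub>R \<nu> p))"
    using simple' by - (elim conjE, assumption)
  have chi: "\<And>D. D \<in> \<D> \<Longrightarrow> chi D \<in> {1, -1}" using chi_all by simp
  have Lip: "\<And>D. D \<in> \<D> \<Longrightarrow> locally_Lipschitz_on D wr"
    and ae: "\<And>D. D \<in> \<D> \<Longrightarrow> AE x in lebesgue. x \<in> D \<longrightarrow>
           wr differentiable (at x) \<and> (chi D *\<^sub>R \<nu> x) \<bullet> grad wr x = norm (grad wr x)"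
    and weak: "\<And>D. D \<in> \<D> \<Longrightarrow> weak_divergence_eq D (\<lambda>x. chi D *\<^sub>R \<nu> x) (\<lambda>x. norm (grad wr x))"
    and normal: "\<And>D p. D \<in> \<D> \<Longrightarrow> p \<in> frontier D \<inter> U \<Longrightarrow> outer_unit_normal D p (chi D *\<^sub>R \<nu> p)"
    using regions by (simp_all del: Int_iff)
  have "\<exists>\<G>. countable \<G> \<and> disjoint \<G> \<and> (\<forall>\<gamma>\<in>\<G>. C1_curve_without_endpoints U \<gamma>) \<and> U - \<Union>\<D> = \<Union>\<G>"
    using simple' by - (elim conjE, assumption)
  then obtain \<G> where \<G>: "countable \<G>" "\<And>\<gamma>. \<gamma> \<in> \<G> \<Longrightarrow> C1_curve_without_endpoints U \<gamma>" "U - \<Union>\<D> = \<Union>\<G>"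
    by blast
  have U\<Omega>: "U \<subseteq> \<Omega>" and UZ: "U \<inter> Z = {}" by (auto simp: U_def)
  have D_open: "open D" and D_sub: "D \<subseteq> U" if "D \<in> \<D>" for D
    using dom_all that by (auto simp: C1_domain_in_def)
  have E_exp: "exp_minus (w x) = exp (- wr x)" if "x \<in> \<Omega>" "w x \<noteq> \<infinity>" for x
    using that by (simp add: exp_minus_def wr_def)
  have finU: "w x \<noteq> \<infinity>" if "x \<in> U" for x using that wZ U\<Omega> UZ by blast
  have n\<nu>: "norm (\<nu> x) = 1" if "x \<in> \<Omega>" "w x \<noteq> \<infinity>" for x
    using assms(5) that unfolding unit_calibrated_def by (simp add: less_le)
  have n\<nu>U: "norm (\<nu> x) = 1" if "x \<in> U" for x using n\<nu> finU that U\<Omega> by blast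
  have E0: "0 \<le> exp_minus a" for a by (simp add: exp_minus_def)
  define V where "V x = exp_minus (w x) *\<^sub>R perp (\<nu> x)" for x
  have nV: "norm (V x) = exp_minus (w x)" if "x \<in> \<Omega>" for x
  proof (cases "w x = \<infinity>")
    case False
    then show ?thesis using n\<nu>[OF that False] E0[of "w x"] by (simp add: V_def norm_perp)
  qed (simp add: V_def exp_minus_def)
  have V_cont: "continuous_on \<Omega> V"
    using continuous_on_perp[OF F_cont] by (simp add: V_def[abs_def] perp_scaleR)

  have prim_D: "has_local_primitive V x" if D: "D \<in> \<D>" and x: "x \<in> D" for D x
  proof -
    have "has_local_primitive (\<lambda>x. perp (exp (- wr x) *\<^sub>R (chi D *\<^sub>R \<nu> x))) x"
    proof (rule has_local_primitive_in_region[OF D_open[OF D] _ _ Lip[OF D] ae[OF D] weak[OF D] x])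
      show "continuous_on D (\<lambda>x. chi D *\<^sub>R \<nu> x)"
        by (intro continuous_intros continuous_on_subset[OF \<nu>c D_sub[OF D]])
      show "norm (chi D *\<^sub>R \<nu> y) \<le> 1" if "y \<in> D" for y
        using n\<nu>U[of y] D_sub[OF D] that chi[OF D] by auto
    qed
    \<comment> \<open>Multiplication by the sign removes it, since its square is 1.\<close>
    from has_local_primitive_scaleR[OF this, of "chi D"]
    show ?thesis
    proof (rule has_local_primitive_cong[OF D_open[OF D] x, rotated])
      fix y assume "y \<in> D"
      then have "exp_minus (w y) = exp (- wr y)" using E_exp finU D_sub[OF D] U\<Omega> by blast
      moreover have "chi D * chi D = 1" using chi[OF D] by auto
      ultimately show "chi D *\<^sub>R perp (exp (- wr y) *\<^sub>R chi D *\<^sub>R \<nu> y) = V y"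
        by (simp add: V_def perp_scaleR mult.left_commute)
    qed
  qed

  have ridge: "\<exists>\<A>. countable \<A> \<and> (\<forall>\<Gamma>\<in>\<A>. Lipschitz_arc \<Gamma>) \<and> \<gamma> \<subseteq> \<Union>\<A>" and ridge_negl: "negligible \<gamma>"
    if \<gamma>: "\<gamma> \<in> \<G>" for \<gamma>
  proof -
    obtain c c' where c: "\<And>t::real. (c has_vector_derivative c' t) (at t)" "continuous_on UNIV c'" "\<gamma> = range c"
      using \<G>(2)[OF \<gamma>] unfolding C1_curve_without_endpoints_def by blast
    show "\<exists>\<A>. countable \<A> \<and> (\<forall>\<Gamma>\<in>\<A>. Lipschitz_arc \<Gamma>) \<and> \<gamma> \<subseteq> \<Union>\<A>"
      unfolding c(3) by (rule curve_arcs[OF c(1,2)])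
    show "negligible \<gamma>" unfolding c(3) by (rule curve_negligible[OF c(1)])
  qed

  have dense: "U \<subseteq> closure (\<Union>\<D>)"
  proof
    fix x assume x: "x \<in> U"
    show "x \<in> closure (\<Union>\<D>)"
    proof (rule ccontr)
      assume "x \<notin> closure (\<Union>\<D>)"
      then have "x \<in> U - closure (\<Union>\<D>)" using x by blast
      moreover have "open (U - closure (\<Union>\<D>))" using U by (intro open_Diff) auto
      ultimately have "\<not> negligible (U - closure (\<Union>\<D>))" using open_not_negligible by blast
      moreover have "U - closure (\<Union>\<D>) \<subseteq> \<Union>\<G>" using \<G>(3) closure_subset[of "\<Union>\<D>"] by blast
      moreover have "negligible (\<Union>\<G>)" using \<G>(1) ridge_negl by (rule negligible_countable_Union)
      ultimately show False using negligible_subset by blast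
    qed
  qed

  have cover: "\<exists>r>0. \<exists>\<A>. countable \<A> \<and> (\<forall>\<Gamma>\<in>\<A>. Lipschitz_arc \<Gamma>) \<and>
      (\<forall>x\<in>ball p r \<inter> \<Omega> - \<Union>\<A>. has_local_primitive V x)" if p: "p \<in> \<Omega>" for p
  proof -
    obtain r where r: "0 < r" "cball p r \<subseteq> \<Omega>" using assms(1) p open_contains_cball by metis
    define \<S>' where "\<S>' = {\<sigma>\<in>\<S>. \<sigma> \<inter> cball p r \<noteq> {}}"
    have fin: "finite (Z \<inter> cball p r)" "finite \<S>'" using locfin r(2) by (auto simp: \<S>'_def)
    have "\<exists>\<Gamma>. Lipschitz_arc \<Gamma> \<and> \<sigma> \<inter> ball p r \<subseteq> \<Gamma>" if "\<sigma> \<in> \<S>'" for \<sigma>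
      using segment_arcs seg_data that unfolding \<S>'_def by blast
    then obtain a where a: "\<And>\<sigma>. \<sigma> \<in> \<S>' \<Longrightarrow> Lipschitz_arc (a \<sigma>) \<and> \<sigma> \<inter> ball p r \<subseteq> a \<sigma>" by metis
    obtain b where b: "\<And>\<gamma>. \<gamma> \<in> \<G> \<Longrightarrow> countable (b \<gamma>) \<and> (\<forall>\<Gamma>\<in>b \<gamma>. Lipschitz_arc \<Gamma>) \<and> \<gamma> \<subseteq> \<Union>(b \<gamma>)"
      using ridge by metis
    \<comment> \<open>Near \<open>p\<close> finitely many points and segments matter, but all ridges may come close.\<close>
    define \<A> where "\<A> = (\<lambda>z. {z}) ` (Z \<inter> cball p r) \<union> a ` \<S>' \<union> (\<Union>\<gamma>\<in>\<G>. b \<gamma>)"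
    have "countable \<A>" unfolding \<A>_def using fin \<G>(1) b
      by (intro countable_Un countable_UN countable_image) (auto intro: countable_finite)
    moreover have "\<forall>\<Gamma>\<in>\<A>. Lipschitz_arc \<Gamma>" unfolding \<A>_def using singleton_arc a b by blast
    moreover have "has_local_primitive V x" if x: "x \<in> ball p r \<inter> \<Omega> - \<Union>\<A>" for x
    proof -
      have xb: "x \<in> ball p r" "x \<in> cball p r" "x \<in> \<Omega>" using x by auto
      have "x \<notin> Z" using x xb unfolding \<A>_def by blast
      moreover have "x \<notin> \<sigma>" if "\<sigma> \<in> \<S>" for \<sigma>
      proof
        assume "x \<in> \<sigma>"
        then have "\<sigma> \<in> \<S>'" using that xb unfolding \<S>'_def by blast
        then have "x \<in> a \<sigma>" "a \<sigma> \<in> \<A>" using a \<open>x \<in> \<sigma>\<close> xb unfolding \<A>_def by blast+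
        then show False using x by blast
      qed
      ultimately have "x \<in> U" using xb by (auto simp: U_def)
      moreover have "x \<notin> \<Union>\<G>"
      proof
        assume "x \<in> \<Union>\<G>"
        then obtain \<gamma> where \<gamma>: "\<gamma> \<in> \<G>" "x \<in> \<gamma>" by blast
        then obtain \<Gamma> where "\<Gamma> \<in> b \<gamma>" "x \<in> \<Gamma>" using b by blast
        then show False using x \<gamma> unfolding \<A>_def by blast
      qed
      ultimately have "x \<in> \<Union>\<D>" using \<G>(3) by blast
      then show ?thesis using prim_D by blast
    qed
    ultimately show ?thesis using r(1) by (intro exI[of _ r] conjI exI[of _ \<A>]) auto
  qed

  obtain u where u: "\<And>x. x \<in> \<Omega> \<Longrightarrow> GDERIV u x :> V x"
    using plane_primitive_off_arcs[OF assms(1,3) V_cont cover] by blast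

  have "\<exists>F. finite F \<and> (\<forall>x\<in>\<sigma> - F. \<exists>h0>0. \<forall>h. \<bar>h\<bar> < h0 \<longrightarrow> x + h *\<^sub>R perp (\<nu> x) \<in> \<sigma>)" if \<sigma>: "\<sigma> \<in> \<S>" for \<sigma>
  proof -
    obtain a n e where d: "\<And>x. x \<in> \<sigma> \<Longrightarrow> w x = ereal a \<and> \<nu> x = n" "unit_tangent \<sigma> e" "n \<in> {perp e, - perp e}"
      using seg_data \<sigma> by blast
    have "convex \<sigma>" using seg \<sigma> by (simp add: line_segment_def)
    from segment_endpoints_finite[OF this d(2)] obtain F where F: "finite F"
      "\<And>x. x \<in> \<sigma> - F \<Longrightarrow> \<exists>h0>0. \<forall>h. \<bar>h\<bar> < h0 \<longrightarrow> x + h *\<^sub>R e \<in> \<sigma>" by blast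
    \<comment> \<open>Rotating the normal gives the tangent up to sign, so one may step along the segment both ways.\<close>
    have pn: "perp n = - e \<or> perp n = e" using d(3) by (auto simp: perp_perp perp_minus)
    have "\<exists>h0>0. \<forall>h. \<bar>h\<bar> < h0 \<longrightarrow> x + h *\<^sub>R perp (\<nu> x) \<in> \<sigma>" if x: "x \<in> \<sigma> - F" for x
    proof -
      obtain h0 where h0: "0 < h0" "\<And>h. \<bar>h\<bar> < h0 \<Longrightarrow> x + h *\<^sub>R e \<in> \<sigma>" using F(2)[OF x] by blast
      have \<nu>x: "\<nu> x = n" using d(1) x by blast
      have "x + h *\<^sub>R perp n \<in> \<sigma>" if "\<bar>h\<bar> < h0" for h
        using pn h0(2)[of h] h0(2)[of "- h"] that by auto
      then show ?thesis using h0(1) \<nu>x by auto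
    qed
    then show ?thesis using F(1) by blast
  qed
  then obtain ends where ends: "\<And>\<sigma>. \<sigma> \<in> \<S> \<Longrightarrow> finite (ends \<sigma>)"
    "\<And>\<sigma> x. \<sigma> \<in> \<S> \<Longrightarrow> x \<in> \<sigma> - ends \<sigma> \<Longrightarrow> \<exists>h0>0. \<forall>h. \<bar>h\<bar> < h0 \<longrightarrow> x + h *\<^sub>R perp (\<nu> x) \<in> \<sigma>"
    by metis

  have step: "\<exists>x'. x' \<noteq> x \<and> dist x' x < \<rho> \<and> norm (V x) \<le> norm (V x') \<and> (norm (V x) - \<epsilon>) * dist x' x \<le> s * u x' - s * u x"
    if x: "x \<in> \<Omega>" "x \<notin> Z" "\<And>\<sigma>. \<sigma> \<in> \<S> \<Longrightarrow> x \<in> \<sigma> \<Longrightarrow> x \<notin> ends \<sigma>" and s: "s \<in> {1, -1}"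
      and m: "0 < norm (V x)" and \<epsilon>: "0 < \<epsilon>" and \<rho>: "0 < \<rho>" for x s \<epsilon> \<rho>
  proof (rule step_of_descent[where u="\<lambda>x. s * u x" and m="\<lambda>x. norm (V x)" and g="s *\<^sub>R V x", OF _ m _ \<epsilon> \<rho>])
    show "GDERIV (\<lambda>x. s * u x) x :> s *\<^sub>R V x"
      using has_derivative_mult_right[OF u[OF x(1), unfolded gderiv_def], of s] unfolding gderiv_def by simp
    have ss: "s * s = 1" using s by auto
    have fin: "w x \<noteq> \<infinity>" using x wZ by blast
    have \<nu>1: "norm (\<nu> x) = 1" using n\<nu>[OF x(1) fin] .
    then have \<nu>\<nu>: "\<nu> x \<bullet> \<nu> x = 1" by (simp add: norm_eq_1)
    have vg: "(s *\<^sub>R perp (\<nu> x) - c *\<^sub>R \<nu> x) \<bullet> (s *\<^sub>R V x) = norm (V x)" for c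
    proof -
      have "(s *\<^sub>R perp (\<nu> x) - c *\<^sub>R \<nu> x) \<bullet> (s *\<^sub>R V x) = (s * s) * exp_minus (w x)"
        using \<nu>\<nu> by (simp add: V_def inner_diff_left inner_perp mult_ac)
      then show ?thesis using ss nV[OF x(1)] by simp
    qed
    fix \<delta> :: real assume \<delta>: "0 < \<delta>"
    show "\<exists>v. norm v \<le> 1 + \<delta> \<and> v \<bullet> (s *\<^sub>R V x) = norm (V x) \<and>
        (\<exists>h0>0. \<forall>h. 0 < h \<and> h < h0 \<longrightarrow> norm (V x) \<le> norm (V (x + h *\<^sub>R v)))"
    proof (cases "x \<in> \<Union>\<S>")
      case True
      then obtain \<sigma> where \<sigma>: "\<sigma> \<in> \<S>" "x \<in> \<sigma>" by blast
      then have "x \<in> \<sigma> - ends \<sigma>" using x(3) by blast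
      then obtain h0 where h0: "0 < h0" "\<And>h. \<bar>h\<bar> < h0 \<Longrightarrow> x + h *\<^sub>R perp (\<nu> x) \<in> \<sigma>" using ends(2)[OF \<sigma>(1)] by blast
      obtain a where a: "\<And>y. y \<in> \<sigma> \<Longrightarrow> w y = ereal a" using seg_data \<sigma>(1) by blast
      have \<sigma>\<Omega>: "\<sigma> \<subseteq> \<Omega>" using seg \<sigma>(1) closedin_imp_subset by blast
      have "norm (V x) \<le> norm (V (x + h *\<^sub>R (s *\<^sub>R perp (\<nu> x))))" if h: "0 < h" "h < h0" for h
      proof -
        have "\<bar>h * s\<bar> < h0" using h s by auto
        from h0(2)[OF this] have y: "x + h *\<^sub>R (s *\<^sub>R perp (\<nu> x)) \<in> \<sigma>" by simp
        then have "x + h *\<^sub>R (s *\<^sub>R perp (\<nu> x)) \<in> \<Omega>" using \<sigma>\<Omega> by blast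
        from nV[OF this] show ?thesis unfolding nV[OF x(1)] a[OF \<sigma>(2)] a[OF y] by simp
      qed
      moreover have "norm (s *\<^sub>R perp (\<nu> x)) \<le> 1 + \<delta>" using s \<delta> \<nu>1 by (auto simp: norm_perp)
      ultimately show ?thesis using vg[of 0] h0(1)
        by (intro exI[of _ "s *\<^sub>R perp (\<nu> x)"] conjI exI[of _ h0]) auto
    next
      case False
      then have xU: "x \<in> U" using x by (auto simp: U_def)
      obtain D where D: "D \<in> \<D>" "x \<in> D \<or> outer_unit_normal D x (chi D *\<^sub>R \<nu> x)"
        using in_closure_of_region[OF U xU disj D_open normal chi \<nu>c n\<nu>U dense] by blast
      have cc: "chi D * chi D = 1" "\<bar>chi D\<bar> = 1" using chi[OF D(1)] by auto
      \<comment> \<open>The direction of \<open>s V\<close>, tilted slightly so that it enters the region and decreases \<open>w\<close>.\<close>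
      define v where "v = s *\<^sub>R perp (\<nu> x) - (\<delta> * chi D) *\<^sub>R \<nu> x"
      have "(chi D *\<^sub>R \<nu> x) \<bullet> v = - \<delta> * (chi D * chi D)"
        using \<nu>\<nu> by (simp add: v_def inner_diff_right inner_perp)
      then have neg: "(chi D *\<^sub>R \<nu> x) \<bullet> v < 0" using cc \<delta> by simp
      have "\<exists>h0>0. \<forall>h. 0 < h \<and> h < h0 \<longrightarrow> x + h *\<^sub>R v \<in> D \<and> wr (x + h *\<^sub>R v) \<le> wr x"
      proof (rule descent_direction[OF U xU wc _ D_open[OF D(1)] D_sub[OF D(1)] _ Lip[OF D(1)] ae[OF D(1)] D(2) neg])
        show "continuous_on U (\<lambda>x. chi D *\<^sub>R \<nu> x)" by (intro continuous_intros \<nu>c)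
        show "norm (chi D *\<^sub>R \<nu> y) \<le> 1" if "y \<in> D" for y
          using n\<nu>U[of y] D_sub[OF D(1)] that cc(2) by auto
      qed
      then obtain h0 where h0: "0 < h0" "\<And>h. 0 < h \<Longrightarrow> h < h0 \<Longrightarrow> x + h *\<^sub>R v \<in> D \<and> wr (x + h *\<^sub>R v) \<le> wr x" by blast
      have "norm (V x) \<le> norm (V (x + h *\<^sub>R v))" if h: "0 < h" "h < h0" for h
      proof -
        have y: "x + h *\<^sub>R v \<in> U" "wr (x + h *\<^sub>R v) \<le> wr x" using h0(2)[OF h] D_sub[OF D(1)] by auto
        have "x + h *\<^sub>R v \<in> \<Omega>" using y(1) U\<Omega> by blast
        then show ?thesis using y nV[OF x(1)] nV E_exp[OF x(1) fin] E_exp finU[OF y(1)] by simp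
      qed
      moreover have "norm v \<le> 1 + \<delta>"
        using norm_triangle_ineq4[of "s *\<^sub>R perp (\<nu> x)" "(\<delta> * chi D) *\<^sub>R \<nu> x"] s \<delta> \<nu>1 cc(2)
        by (auto simp: v_def norm_perp abs_mult)
      moreover have "v \<bullet> (s *\<^sub>R V x) = norm (V x)" unfolding v_def by (rule vg)
      ultimately show ?thesis using h0(1) by (intro exI[of _ v] conjI exI[of _ h0]) auto
    qed
  qed

  have growth: "\<exists>R>0. \<forall>r. 0 < r \<and> r < R \<longrightarrow> (\<exists>x. dist x z = r \<and> s * u z + norm (V z) * r \<le> s * u x)"
    if z: "z \<in> \<Omega>" "V z \<noteq> 0" and s: "s \<in> {1, -1}" for z s
  proof -
    obtain r where r: "0 < r" "cball z r \<subseteq> \<Omega>" using assms(1) z(1) open_contains_cball by metis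
    define \<S>' where "\<S>' = {\<sigma>\<in>\<S>. \<sigma> \<inter> cball z r \<noteq> {}}"
    \<comment> \<open>The exceptional points near \<open>z\<close>; the radius is chosen such that at most \<open>z\<close> itself is one.\<close>
    define B where "B = (Z \<inter> cball z r) \<union> (\<Union>\<sigma>\<in>\<S>'. ends \<sigma>)"
    have "finite (Z \<inter> cball z r)" "finite \<S>'" using locfin r(2) by (auto simp: \<S>'_def)
    then have "finite B" unfolding B_def using ends(1) by (auto simp: \<S>'_def)
    then obtain d where d: "0 < d" "\<And>x. x \<in> B \<Longrightarrow> x \<noteq> z \<Longrightarrow> d \<le> dist z x"
      using finite_set_avoid[of B z] by blast
    define R where "R = min r d"
    have R: "0 < R" "R \<le> r" "R \<le> d" using r d by (auto simp: R_def)
    have sub: "cball z R \<subseteq> \<Omega>" using r(2) R(2) subset_cball[of R r z] by blast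
    have uc: "continuous_on (cball z R) u"
      using u sub unfolding gderiv_def by (intro continuous_at_imp_continuous_on ballI has_derivative_continuous) blast
    have "\<exists>x. dist x z = t \<and> s * u z + norm (V z) * t \<le> s * u x" if t: "0 < t" "t < R" for t
    proof (rule growth_on_spheres[where u="\<lambda>x. s * u x" and m="\<lambda>x. norm (V x)" and R=R and g="s *\<^sub>R V z"])
      show "continuous_on (cball z R) (\<lambda>x. s * u x)" by (intro continuous_intros uc)
      show "continuous_on (cball z R) (\<lambda>x. norm (V x))" by (intro continuous_intros continuous_on_subset[OF V_cont sub])
      show "GDERIV (\<lambda>x. s * u x) z :> s *\<^sub>R V z"
        using has_derivative_mult_right[OF u[OF z(1), unfolded gderiv_def], of s] unfolding gderiv_def by simp
      show "s *\<^sub>R V z \<noteq> 0" using s z(2) by auto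
      fix \<epsilon> \<rho> :: real and x' assume x: "x' \<in> ball z R" "x' \<noteq> z" "0 < norm (V x')" "0 < \<epsilon>" "0 < \<rho>"
      have xr: "x' \<in> cball z r" using x(1) R(2) by auto
      have xB: "x' \<notin> B" using d(2)[of x'] x(1,2) R(3) by auto
      show "\<exists>y. y \<noteq> x' \<and> dist y x' < \<rho> \<and> norm (V x') \<le> norm (V y) \<and> (norm (V x') - \<epsilon>) * dist y x' \<le> s * u y - s * u x'"
      proof (rule step[OF _ _ _ s x(3,4,5)])
        show "x' \<in> \<Omega>" using xr r(2) by blast
        show "x' \<notin> Z" using xB xr unfolding B_def by blast
        show "x' \<notin> ends \<sigma>" if "\<sigma> \<in> \<S>" "x' \<in> \<sigma>" for \<sigma>
        proof -
          have "\<sigma> \<in> \<S>'" using that xr unfolding \<S>'_def by blast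
          then show ?thesis using xB unfolding B_def by blast
        qed
      qed
    qed (use z t in auto)
    then show ?thesis using R(1) by blast
  qed
  have "infinity_harmonic \<Omega> u" by (rule infinity_harmonic_of_growth[OF u growth])
  moreover have "grad u x = V x" if "x \<in> \<Omega>" for x using grad_eqI[OF u[OF that]] .
  moreover have "C1_on \<Omega> u"
    unfolding C1_on_def
  proof
    show "\<forall>x\<in>\<Omega>. u differentiable (at x)" using u GDERIV_imp_differentiable by blast
    show "continuous_on \<Omega> (grad u)"
      using V_cont continuous_on_cong[OF refl] calculation(2) by (metis (no_types, lifting))
  qed
  ultimately show ?thesis unfolding V_def by blast
qed

end
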